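(* For every $p\in[0,1]^N$ one has $p\in\mathcal R_{N,d}$ if and only if $\|p\|_{\mathcal Q}^*\le 1$. In other words, $\mathcal R_{N,d}$ is the intersection of $[0,1]^N$ with the closed unit ball of the dual norm $\|\cdot\|_{\mathcal Q}^*$.
   Context: Fix integers $d\ge 2$, $N\ge 1$. Let $|\Omega\rangle=\sum_{i=1}^d|i\rangle\otimes|i\rangle\in\mathbb C^d\otimes\mathbb C^d$ (unnormalized) and $\omega=|\Omega\rangle\langle\Omega|$. On $(\mathbb C^d)^{\otimes(N+1)}$, with tensor factors labelled $0,1,\dots,N$, $\omega_{(0,i)}\otimes I^{\otimes(N-1)}$ denotes the operator acting as $\omega$ on factors $0$ and $i$ and as the identity on the other factors. A quantum channel $T:\mathcal M_d\to\mathcal M_d^{\otimes N}$ is a completely positive trace-preserving linear map; its marginals are $T_i(\rho)=\mathrm{Tr}_{\{1,\dots,N\}\setminus\{i\}}[T(\rho)]$. The cloning region is $\mathcal R_{N,d}=\{p\in[0,1]^N:\ \exists$ a quantum channel $T$ with $T_i(\rho)=p_i\rho+(1-p_i)I/d$ for all density matrices $\rho\in\mathcal M_d$ and all $1\le i\le N\}$. For $x\in\mathbb R^N$ let $S_x=\sum_{i=1}^N|x_i|\,\omega_{(0,i)}\otimes I^{\otimes(N-1)}$ and define the $\mathcal Q$-norm $\|x\|_{\mathcal Q}=\frac{d\,\lambda_{\max}(S_x)-\|x\|_1}{d^2-1}$, where $\lambda_{\max}$ is the largest eigenvalue and $\|x\|_1=\sum_i|x_i|$. Its dual norm is $\|y\|^*_{\mathcal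 Q}=\sup_{x\neq 0}\langle y,x\rangle/\|x\|_{\mathcal Q}$. *)

theory Defs
  imports Complex_Main "Jordan_Normal_Form.Char_Poly"
begin

text \<open>Conventions. A basis index of (C^d)^{tensor k} is a natural number a < d^k;
  its j-th tensor factor (j = 0,...,k-1) is the digit (a div d^j) mod d.
  For the output space of T : M_d -> M_d^{tensor N} the factor labelled i (1 <= i <= N)
  is digit i-1. For (C^d)^{tensor (N+1)} the factor labelled j (0 <= j <= N) is digit j.
  Vectors of R^N are functions nat => real, only the values at 1..N matter.\<close>

definition digit :: "nat \<Rightarrow> nat \<Rightarrow> nat \<Rightarrow> nat" where
  "digit d j a = (a div d ^ j) mod d"

definition mtrace :: "complex mat \<Rightarrow> complex" where
  "mtrace A = (\<Sum>i<dim_row A. A $$ (i,i))"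

definition is_psd :: "complex mat \<Rightarrow> bool" where
  "is_psd A \<longleftrightarrow> dim_row A = dim_col A
     \<and> (\<forall>i<dim_row A. \<forall>j<dim_row A. A $$ (i,j) = cnj (A $$ (j,i)))
     \<and> (\<forall>v \<in> carrier_vec (dim_row A).
          0 \<le> Re (\<Sum>i<dim_row A. \<Sum>j<dim_row A. cnj (v $ i) * A $$ (i,j) * v $ j))"

definition density_matrix :: "nat \<Rightarrow> complex mat \<Rightarrow> bool" where
  "density_matrix d \<rho> \<longleftrightarrow> \<rho> \<in> carrier_mat d d \<and> is_psd \<rho> \<and> mtrace \<rho> = 1"

text \<open>(id_k tensor T)(X) for X in M_k tensor M_d (a kd x kd matrix, block (a,b) = d x d block);
  the output is a k m x k m matrix, where m is the output dimension.\<close>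
definition ampliate :: "nat \<Rightarrow> nat \<Rightarrow> nat \<Rightarrow> (complex mat \<Rightarrow> complex mat) \<Rightarrow> complex mat \<Rightarrow> complex mat" where
  "ampliate k d m T X = mat (k * m) (k * m) (\<lambda>(r, s).
      T (mat d d (\<lambda>(u, v). X $$ ((r div m) * d + u, (s div m) * d + v))) $$ (r mod m, s mod m))"

definition quantum_channel :: "nat \<Rightarrow> nat \<Rightarrow> (complex mat \<Rightarrow> complex mat) \<Rightarrow> bool" where
  "quantum_channel d m T \<longleftrightarrow>
     (\<forall>A \<in> carrier_mat d d. T A \<in> carrier_mat m m)
   \<and> (\<forall>A \<in> carrier_mat d d. \<forall>B \<in> carrier_mat d d. T (A + B) = T A + T B)
   \<and> (\<forall>A \<in> carrier_mat d d. \<forall>c. T (c \<cdot>\<^sub>m A) = c \<cdot>\<^sub>m T A)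
   \<and> (\<forall>k. \<forall>X \<in> carrier_mat (k * d) (k * d). is_psd X \<longrightarrow> is_psd (ampliate k d m T X))
   \<and> (\<forall>A \<in> carrier_mat d d. mtrace (T A) = mtrace A)"

definition marginal :: "nat \<Rightarrow> nat \<Rightarrow> nat \<Rightarrow> complex mat \<Rightarrow> complex mat" where
  "marginal d N i M = mat d d (\<lambda>(u, v).
      \<Sum>a<d ^ N. \<Sum>b<d ^ N.
        if digit d (i - 1) a = u \<and> digit d (i - 1) b = v
           \<and> (\<forall>j<N. j \<noteq> i - 1 \<longrightarrow> digit d j a = digit d j b)
        then M $$ (a, b) else 0)"

definition cloning_region :: "nat \<Rightarrow> nat \<Rightarrow> (nat \<Rightarrow> real) set" where
  "cloning_region N d = {p. (\<forall>i\<in>{1..N}. 0 \<le> p i \<and> p i \<le> 1) \<and>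
     (\<exists>T. quantum_channel d (d ^ N) T \<and>
        (\<forall>\<rho>. density_matrix d \<rho> \<longrightarrow> (\<forall>i\<in>{1..N}.
           marginal d N i (T \<rho>) =
             complex_of_real (p i) \<cdot>\<^sub>m \<rho> + complex_of_real ((1 - p i) / real d) \<cdot>\<^sub>m 1\<^sub>m d)))}"

text \<open>omega_(0,i) tensor identity on (C^d)^{tensor (N+1)}, factors 0..N = digits 0..N.\<close>
definition omega_0i :: "nat \<Rightarrow> nat \<Rightarrow> nat \<Rightarrow> complex mat" where
  "omega_0i d N i = mat (d ^ (N + 1)) (d ^ (N + 1)) (\<lambda>(a, b).
      if digit d 0 a = digit d i a \<and> digit d 0 b = digit d i b
         \<and> (\<forall>j\<le>N. j \<noteq> 0 \<and> j \<noteq> i \<longrightarrow> digit d j a = digit d j b)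
      then 1 else 0)"

definition S_mat :: "nat \<Rightarrow> nat \<Rightarrow> (nat \<Rightarrow> real) \<Rightarrow> complex mat" where
  "S_mat d N x = mat (d ^ (N + 1)) (d ^ (N + 1))
      (\<lambda>(a, b). \<Sum>i\<in>{1..N}. complex_of_real \<bar>x i\<bar> * omega_0i d N i $$ (a, b))"

definition lambda_max :: "complex mat \<Rightarrow> real" where
  "lambda_max A = Max {r::real. eigenvalue A (complex_of_real r)}"

definition l1norm :: "nat \<Rightarrow> (nat \<Rightarrow> real) \<Rightarrow> real" where
  "l1norm N x = (\<Sum>i\<in>{1..N}. \<bar>x i\<bar>)"

definition Q_norm :: "nat \<Rightarrow> nat \<Rightarrow> (nat \<Rightarrow> real) \<Rightarrow> real" where
  "Q_norm N d x = (real d * lambda_max (S_mat d N x) - l1norm N x) / (real d ^ 2 - 1)"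

definition Q_dual_norm :: "nat \<Rightarrow> nat \<Rightarrow> (nat \<Rightarrow> real) \<Rightarrow> real" where
  "Q_dual_norm N d y = Sup {(\<Sum>i\<in>{1..N}. y i * x i) / Q_norm N d x | x. \<exists>i\<in>{1..N}. x i \<noteq> 0}"

end

theory Submission
  imports Defs "HOL-Analysis.Function_Topology"
begin

text \<open>Normalised Choi matrices turn channels into states \<open>\<rho>\<close> on \<open>N + 1\<close> factors, and the marginal
  conditions give \<open>tr (\<rho> \<omega>\<^sub>(\<^sub>0\<^sub>,\<^sub>i\<^sub>)) = q i\<close> with \<open>q i = (p i (d\<^sup>2 - 1) + 1) / d\<close>. Since \<open>\<lambda>\<^sub>m\<^sub>a\<^sub>x (S\<^sub>x)\<close>
  is the maximum of \<open>tr (\<rho> S\<^sub>x)\<close> over states, this yields \<open>\<langle>p, x\<rangle> \<le> Q x\<close>.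

  Conversely, if \<open>\<langle>p, x\<rangle> \<le> Q x\<close> for all \<open>x\<close>, a separation argument gives a state with overlaps \<open>q\<close>.
  Among these, the one of least Hilbert-Schmidt norm is invariant under conjugation by
  \<open>cnj U \<otimes> U \<otimes> \<dots> \<otimes> U\<close>. Hence its marginals on the factors \<open>0, i\<close> are combinations of \<open>\<omega>\<close> and the
  identity, and it is the Choi matrix of a channel with the required marginals.

  Operators are represented as functions on index pairs, so that the product topology provides
  compactness of the set of states in every dimension.\<close>

section \<open>Positive semidefinite matrices and states\<close>

text \<open>The number \<open>q i\<close> is read off from the desired marginal: \<open>p\<close>
  times the normalised \<omega> plus \<open>1 - p\<close> times the maximally mixed state, that is,
  \<open>p \<omega> / d + (1 - p) I / d\<^sup>2\<close>, has overlap
  \<open>p d + (1 - p) / d\<close> with \<omega>. Substituting this affine relation into the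
  eigenvalue inequality and clearing \<open>d\<close> produces the subtracted 1-norm and the
  denominator \<open>d\<^sup>2 - 1\<close> of the Q-norm.

  Two gaps shape the converse. Overlaps prescribe one number for each \<open>i\<close>, whereas a
  cloning channel has prescribed full marginals and preserves the trace. Symmetry closes this gap:
  an invariant marginal has two free parameters, fixed by trace and overlap, and trace preservation
  can then be read off from any marginal. The other gap is one of signs: \<open>S_mat\<close>
  depends on \<open>x\<close> only through absolute values, so separation works for nonnegative
  functionals only, and it must be shown that no others occur.

  Invariance holds under all unitaries, but diagonal phases, transpositions and one Hadamard matrix
  already determine the form of the marginals.\<close>

definition qform :: "nat \<Rightarrow> (nat \<times> nat \<Rightarrow> complex) \<Rightarrow> (nat \<Rightarrow> complex) \<Rightarrow> complex" where
  "qform n A v = (\<Sum>a<n. \<Sum>b<n. cnj (v a) * A (a, b) * v b)"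

definition hermitian_on :: "nat \<Rightarrow> (nat \<times> nat \<Rightarrow> complex) \<Rightarrow> bool" where
  "hermitian_on n A \<longleftrightarrow> (\<forall>a<n. \<forall>b<n. A (a, b) = cnj (A (b, a)))"

definition psd :: "nat \<Rightarrow> (nat \<times> nat \<Rightarrow> complex) \<Rightarrow> bool" where
  "psd n A \<longleftrightarrow> hermitian_on n A \<and> (\<forall>v. 0 \<le> Re (qform n A v))"

definition trace_prod :: "nat \<Rightarrow> (nat \<times> nat \<Rightarrow> complex) \<Rightarrow> (nat \<times> nat \<Rightarrow> complex) \<Rightarrow> complex" where
  "trace_prod n A B = (\<Sum>a<n. \<Sum>b<n. A (a, b) * B (b, a))"

definition state :: "nat \<Rightarrow> (nat \<times> nat \<Rightarrow> complex) \<Rightarrow> bool" where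
  "state n \<rho> \<longleftrightarrow> psd n \<rho> \<and> (\<Sum>a<n. \<rho> (a, a)) = 1"

lemma mult_delta_left: "(if P then x else 0) * y = (if P then x * y else (0 :: 'a :: mult_zero))"
  by simp

lemma mult_delta_right: "y * (if P then x else 0) = (if P then y * x else (0 :: 'a :: mult_zero))"
  by simp

lemma hermitian_onD: "hermitian_on n A \<Longrightarrow> a < n \<Longrightarrow> b < n \<Longrightarrow> A (a, b) = cnj (A (b, a))"
  unfolding hermitian_on_def by blast

lemma is_psd_iff_psd:
  assumes "A \<in> carrier_mat n n"
  shows "is_psd A \<longleftrightarrow> psd n (($$) A)"
proof -
  have "(\<forall>v \<in> carrier_vec n. 0 \<le> Re (\<Sum>i<n. \<Sum>j<n. cnj (v $ i) * A $$ (i,j) * v $ j))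
      \<longleftrightarrow> (\<forall>v. 0 \<le> Re (qform n (($$) A) v))" (is "?L \<longleftrightarrow> ?R")
  proof
    assume L: ?L
    show ?R
    proof
      fix v
      have "0 \<le> Re (\<Sum>i<n. \<Sum>j<n. cnj (vec n v $ i) * A $$ (i,j) * vec n v $ j)"
        by (rule bspec[OF L]) simp
      also have "(\<Sum>i<n. \<Sum>j<n. cnj (vec n v $ i) * A $$ (i,j) * vec n v $ j) = qform n (($$) A) v"
        by (simp add: qform_def)
      finally show "0 \<le> Re (qform n (($$) A) v)" .
    qed
  next
    assume ?R
    then show ?L unfolding qform_def by blast
  qed
  then show ?thesis
    using assms unfolding is_psd_def psd_def hermitian_on_def by auto
qed

lemma qform_cong:
  "(\<And>a b. a < n \<Longrightarrow> b < n \<Longrightarrow> A (a, b) = B (a, b)) \<Longrightarrow> qform n A v = qform n B v"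
  unfolding qform_def by (intro sum.cong) auto

lemma psd_cong:
  assumes "\<And>a b. a < n \<Longrightarrow> b < n \<Longrightarrow> A (a, b) = B (a, b)"
  shows "psd n A \<longleftrightarrow> psd n B"
  unfolding psd_def hermitian_on_def using qform_cong[of n A B, OF assms] assms by auto

text \<open>Varying a single coordinate serves two purposes: a small multiple of \<open>- s\<close>
  detects kernel vectors, and the minimising \<open>t\<close> completes the square in the Schur
  complement.\<close>

lemma qform_add_single:
  fixes v :: "nat \<Rightarrow> complex"
  assumes "hermitian_on n A" "m < n"
  defines "s \<equiv> (\<Sum>b<n. A (m, b) * v b)"
  shows "qform n A (\<lambda>a. v a + (if a = m then t else 0))
         = qform n A v + cnj t * s + t * cnj s + cnj t * t * A (m, m)"
proof -
  have c: "cnj s = (\<Sum>a<n. cnj (v a) * A (a, m))"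
    unfolding s_def cnj_sum
    by (intro sum.cong refl) (metis assms(1,2) complex_cnj_mult hermitian_onD lessThan_iff mult.commute)
  have "qform n A (\<lambda>a. v a + (if a = m then t else 0))
     = (\<Sum>a<n. \<Sum>b<n. cnj (v a) * A (a, b) * v b
          + (if a = m then cnj t * (A (m, b) * v b) else 0)
          + (if b = m then t * (cnj (v a) * A (a, m)) else 0)
          + (if a = m then if b = m then cnj t * t * A (m, m) else 0 else 0))"
    unfolding qform_def by (intro sum.cong refl) (auto simp: algebra_simps)
  also have "\<dots> = qform n A v + cnj t * s + t * cnj s + cnj t * t * A (m, m)"
  proof -
    have "(\<Sum>a<n. \<Sum>b<n. if a = m then cnj t * (A (m, b) * v b) else 0)
        = (\<Sum>a<n. if a = m then cnj t * s else 0)"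
      by (intro sum.cong) (auto simp: s_def sum_distrib_left)
    moreover have "(\<Sum>a<n. \<Sum>b<n. if a = m then if b = m then cnj t * t * A (m, m) else 0 else 0)
        = (\<Sum>a<n. if a = m then cnj t * t * A (m, m) else 0)"
      using \<open>m < n\<close> by (intro sum.cong) auto
    ultimately show ?thesis
      using \<open>m < n\<close> by (simp add: sum.distrib qform_def c flip: sum_distrib_left)
  qed
  finally show ?thesis .
qed

lemma hermitian_diag_real: "hermitian_on n A \<Longrightarrow> m < n \<Longrightarrow> A (m, m) = of_real (Re (A (m, m)))"
  using hermitian_onD[of n A m m] by (simp add: complex_eq_iff)

text \<open>First-order optimality along a segment: dividing by \<open>s\<close> and letting it tend
  to \<open>0\<close> leaves \<open>- 2 * B\<close>. The range \<open>0 < s \<le> 1\<close> is that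
  of convex combinations.\<close>

lemma nonneg_quadratic_imp_linear_nonpos:
  fixes B C :: real
  assumes "\<And>s. 0 < s \<Longrightarrow> s \<le> 1 \<Longrightarrow> 0 \<le> s\<^sup>2 * C - 2 * s * B"
  shows "B \<le> 0"
proof (rule ccontr)
  assume "\<not> B \<le> 0"
  \<comment> \<open>Small enough for the linear term to win: \<open>s\<close> lies in the admissible
    range and \<open>s * \<bar>C\<bar> \<le> B < 2 * B\<close>.\<close>
  define s where "s = B / (B + \<bar>C\<bar>)"
  have s: "0 < s" "s \<le> 1" using \<open>\<not> B \<le> 0\<close> by (auto simp: s_def field_simps)
  have "s * \<bar>C\<bar> \<le> B" using \<open>\<not> B \<le> 0\<close> by (simp add: s_def field_simps)
  then have "s * C < 2 * B"
    using \<open>\<not> B \<le> 0\<close> s mult_left_mono[of C "\<bar>C\<bar>" s] by linarith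
  then have "s * (s * C - 2 * B) < 0"
    using s by (simp add: mult_pos_neg)
  then show False using assms[OF s] by (simp add: power2_eq_square algebra_simps)
qed

text \<open>A vector of value zero minimises a nonnegative form, so all first-order variations
  vanish there; the variation of coordinate \<open>m\<close> is governed by entry \<open>m\<close>
  of the image of \<open>v\<close>.\<close>

lemma psd_qform_zero_imp_kernel:
  assumes "psd n A" "Re (qform n A v) = 0" "m < n"
  shows "(\<Sum>b<n. A (m, b) * v b) = 0"
proof -
  define s where "s = (\<Sum>b<n. A (m, b) * v b)"
  have herm: "hermitian_on n A" using assms(1) by (simp add: psd_def)
  have "(cmod s)\<^sup>2 \<le> 0"
  proof (rule nonneg_quadratic_imp_linear_nonpos[where C = "(cmod s)\<^sup>2 * Re (A (m, m))"])
    fix x :: real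
    assume "0 < x" "x \<le> 1"
    \<comment> \<open>Descent along the gradient, with step length \<open>x\<close>.\<close>
    define t where "t = - of_real x * s"
    have "0 \<le> Re (qform n A (\<lambda>a. v a + (if a = m then t else 0)))"
      using assms(1) by (simp add: psd_def)
    also have "\<dots> = Re (qform n A v + cnj t * s + t * cnj s + cnj t * t * A (m, m))"
      using qform_add_single[OF herm \<open>m < n\<close>, of v t] by (simp add: s_def)
    also have "\<dots> = Re (cnj t * s + t * cnj s + cnj t * t * of_real (Re (A (m, m))))"
      using assms(2) hermitian_diag_real[OF herm \<open>m < n\<close>] by simp
    also have "\<dots> = x\<^sup>2 * ((cmod s)\<^sup>2 * Re (A (m, m))) - 2 * x * (cmod s)\<^sup>2"
      unfolding t_def cmod_power2 by (simp add: power2_eq_square algebra_simps)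
    finally show "0 \<le> x\<^sup>2 * ((cmod s)\<^sup>2 * Re (A (m, m))) - 2 * x * (cmod s)\<^sup>2" .
  qed
  then show ?thesis by (simp add: s_def)
qed

lemma qform_single:
  assumes "m < n"
  shows "qform n A (\<lambda>a. if a = m then 1 else 0) = A (m, m)"
proof -
  have "cnj (if a = m then 1 else 0) * z = (if a = m then z else 0)" for a z by simp
  then show ?thesis unfolding qform_def using assms
    by (simp only: mult.assoc mult_delta_right flip: sum_distrib_left) simp
qed

lemma psd_diag_nonneg: "psd n A \<Longrightarrow> m < n \<Longrightarrow> 0 \<le> Re (A (m, m))"
  by (metis psd_def qform_single)

text \<open>Cholesky decomposition: one pivot is removed at a time by a Schur complement.\<close>

lemma psd_decomposition_aux:
  assumes "psd n A" "m \<le> n" "\<And>a b. a < n \<Longrightarrow> b < n \<Longrightarrow> m \<le> a \<Longrightarrow> A (a, b) = 0"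
  shows "\<exists>w. \<forall>a<n. \<forall>b<n. A (a, b) = (\<Sum>k<m. w k a * cnj (w k b))"
  using assms
proof (induction m arbitrary: A)
  case 0
  then show ?case by auto
next
  case (Suc m)
  have herm: "hermitian_on n A" using Suc.prems by (simp add: psd_def)
  have mn: "m < n" using Suc.prems by simp
  show ?case
  proof (cases "A (m, m) = 0")
    case True
    \<comment> \<open>A vanishing pivot means that basis vector \<open>m\<close> has value zero and
      so lies in the kernel: row and column \<open>m\<close> vanish and contribute no
      vector.\<close>
    have "A (m, b) = 0" if "b < n" for b
    proof -
      have "(\<Sum>c<n. A (b, c) * (if c = m then 1 else 0)) = 0"
        using Suc.prems(1) qform_single[OF mn, of A] True that
        by (intro psd_qform_zero_imp_kernel) auto
      then have "A (b, m) = 0" using mn by (simp add: mult_delta_right)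
      then show ?thesis using hermitian_onD[OF herm mn that] by simp
    qed
    then have "\<And>a b. a < n \<Longrightarrow> b < n \<Longrightarrow> m \<le> a \<Longrightarrow> A (a, b) = 0"
      using Suc.prems(3) by (metis le_antisym not_less_eq_eq)
    from Suc.IH[OF Suc.prems(1) _ this] mn obtain w
      where w: "\<forall>a<n. \<forall>b<n. A (a, b) = (\<Sum>k<m. w k a * cnj (w k b))" by auto
    show ?thesis
      by (rule exI[of _ "w(m := \<lambda>_. 0)"]) (use w in simp)
  next
    case False
    define c where "c = Re (A (m, m))"
    have c: "A (m, m) = of_real c" using hermitian_diag_real[OF herm mn] by (simp add: c_def)
    have "0 \<le> c" using psd_diag_nonneg[OF Suc.prems(1) mn] unfolding c_def .
    moreover have "c \<noteq> 0" using False c by auto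
    ultimately have "c > 0" by simp
    define B where "B = (\<lambda>(a, b). A (a, b) - A (a, m) * A (m, b) / of_real c)"
    have "psd n B"
      unfolding psd_def
    proof (intro conjI allI)
      show "hermitian_on n B"
        unfolding hermitian_on_def
      proof (intro allI impI)
        fix a b assume "a < n" "b < n"
        then show "B (a, b) = cnj (B (b, a))"
          using hermitian_onD[OF herm, of a b] hermitian_onD[OF herm, of a m]
            hermitian_onD[OF herm, of m b] mn
          by (simp add: B_def)
      qed
      fix v
      define s where "s = (\<Sum>b<n. A (m, b) * v b)"
      have cs: "cnj s = (\<Sum>a<n. cnj (v a) * A (a, m))"
        unfolding s_def cnj_sum
        by (intro sum.cong refl) (metis herm mn complex_cnj_mult hermitian_onD lessThan_iff mult.commute)
      \<comment> \<open>The minimiser over coordinate \<open>m\<close>: the value of the Schur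
        complement \<open>B\<close> at \<open>v\<close> is the least value of the form of
        \<open>A\<close> when that coordinate varies freely.\<close>
      define t where "t = - s / of_real c"
      have "qform n B v = qform n A v - (\<Sum>a<n. \<Sum>b<n. (cnj (v a) * A (a, m)) * (A (m, b) * v b) / of_real c)"
        unfolding qform_def B_def sum_subtractf[symmetric]
        by (intro sum.cong refl) (simp add: field_simps)
      also have "\<dots> = qform n A v - cnj s * s / of_real c"
        unfolding cs by (simp add: s_def sum_product sum_divide_distrib)
      also have "\<dots> = qform n A (\<lambda>a. v a + (if a = m then t else 0))"
        unfolding qform_add_single[OF herm mn] s_def[symmetric]
        using \<open>c > 0\<close> by (simp add: t_def c field_simps)
      finally show "0 \<le> Re (qform n B v)"
        using Suc.prems(1) by (simp add: psd_def)
    qed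
    moreover have "B (a, b) = 0" if "a < n" "b < n" "m \<le> a" for a b
    proof (cases "a = m")
      case True
      then show ?thesis using \<open>c > 0\<close> c by (simp add: B_def)
    next
      case False
      then show ?thesis using that Suc.prems(3)[of a] mn by (simp add: B_def)
    qed
    ultimately obtain w where w: "\<forall>a<n. \<forall>b<n. B (a, b) = (\<Sum>k<m. w k a * cnj (w k b))"
      using Suc.IH[of B] mn by auto
    have "A (a, b) = (\<Sum>k<Suc m. (w(m := \<lambda>a. A (a, m) / of_real (sqrt c))) k a *
              cnj ((w(m := \<lambda>a. A (a, m) / of_real (sqrt c))) k b))"
      if "a < n" "b < n" for a b
    proof -
      have "of_real (sqrt c) * of_real (sqrt c) = (of_real c :: complex)"
        using \<open>c > 0\<close> by (simp flip: of_real_mult)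
      then have "A (a, m) / of_real (sqrt c) * cnj (A (b, m) / of_real (sqrt c)) = A (a, m) * A (m, b) / of_real c"
        using hermitian_onD[OF herm mn that(2)] by simp
      moreover have "A (a, b) = B (a, b) + A (a, m) * A (m, b) / of_real c" by (simp add: B_def)
      ultimately show ?thesis using w that by simp
    qed
    then show ?thesis by blast
  qed
qed

text \<open>A Gram decomposition takes the place of the spectral theorem: conjugation, reindexing
  and complete positivity are all checked on its rank one terms.\<close>

lemma psd_decomposition:
  assumes "psd n A"
  obtains w where "\<And>a b. a < n \<Longrightarrow> b < n \<Longrightarrow> A (a, b) = (\<Sum>k<n. w k a * cnj (w k b))"
  using psd_decomposition_aux[OF assms order_refl] by auto

lemma trace_prod_rank_one:
  "trace_prod n (\<lambda>(a, b). v a * cnj (v b)) B = qform n B v"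
  unfolding trace_prod_def qform_def
  by (subst sum.swap) (auto intro!: sum.cong)

lemma trace_prod_cong:
  assumes "\<And>a b. a < n \<Longrightarrow> b < n \<Longrightarrow> A (a, b) = A' (a, b)"
    "\<And>a b. a < n \<Longrightarrow> b < n \<Longrightarrow> B (a, b) = B' (a, b)"
  shows "trace_prod n A B = trace_prod n A' B'"
  unfolding trace_prod_def using assms by (intro sum.cong) auto

lemma trace_prod_sum_left:
  "trace_prod n (\<lambda>x. \<Sum>k\<in>K. A k x) B = (\<Sum>k\<in>K. trace_prod n (A k) B)"
  unfolding trace_prod_def sum_distrib_right
  by (subst sum.swap) (simp add: sum.swap[of _ K])

lemma trace_prod_sum_right:
  "trace_prod n A (\<lambda>x. \<Sum>k\<in>K. B k x) = (\<Sum>k\<in>K. trace_prod n A (B k))"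
  unfolding trace_prod_def sum_distrib_left
  by (subst sum.swap) (simp add: sum.swap[of _ K])

lemma trace_prod_scale_left: "trace_prod n (\<lambda>x. c * A x) B = c * trace_prod n A B"
  unfolding trace_prod_def by (simp add: sum_distrib_left mult.assoc)

lemma trace_prod_scale_right: "trace_prod n A (\<lambda>x. c * B x) = c * trace_prod n A B"
  unfolding trace_prod_def by (simp add: sum_distrib_left mult.left_commute)

lemma trace_prod_diff_right: "trace_prod n A (\<lambda>x. B x - B' x) = trace_prod n A B - trace_prod n A B'"
  unfolding trace_prod_def by (simp add: sum_subtractf algebra_simps)

lemma trace_prod_add_left: "trace_prod n (\<lambda>x. A x + A' x) B = trace_prod n A B + trace_prod n A' B"
  unfolding trace_prod_def by (simp add: sum.distrib algebra_simps)

lemma trace_prod_psd_eq: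
  assumes "\<And>a b. a < n \<Longrightarrow> b < n \<Longrightarrow> A (a, b) = (\<Sum>k<n. w k a * cnj (w k b))"
  shows "trace_prod n A B = (\<Sum>k<n. qform n B (w k))"
proof -
  have "trace_prod n A B = trace_prod n (\<lambda>x. \<Sum>k<n. (\<lambda>(a, b). w k a * cnj (w k b)) x) B"
    using assms by (intro trace_prod_cong) auto
  then show ?thesis by (simp only: trace_prod_sum_left trace_prod_rank_one)
qed

lemma psd_rank_one: "psd n (\<lambda>(a, b). v a * cnj (v b))"
  unfolding psd_def
proof (intro conjI allI)
  show "hermitian_on n (\<lambda>(a, b). v a * cnj (v b))" by (simp add: hermitian_on_def)
  fix u
  have "qform n (\<lambda>(a, b). v a * cnj (v b)) u = (\<Sum>a<n. cnj (u a) * v a) * cnj (\<Sum>a<n. cnj (u a) * v a)"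
    unfolding qform_def cnj_sum sum_product by (intro sum.cong refl) (simp add: ac_simps)
  then show "0 \<le> Re (qform n (\<lambda>(a, b). v a * cnj (v b)) u)"
    by (simp only: complex_norm_square[symmetric] Re_complex_of_real zero_le_power2)
qed

lemma psd_sum:
  assumes "\<And>k. k \<in> K \<Longrightarrow> psd n (A k)"
  shows "psd n (\<lambda>x. \<Sum>k\<in>K. A k x)"
  unfolding psd_def
proof (intro conjI allI)
  show "hermitian_on n (\<lambda>x. \<Sum>k\<in>K. A k x)"
    unfolding hermitian_on_def
  proof (intro allI impI)
    fix a b assume "a < n" "b < n"
    then show "(\<Sum>k\<in>K. A k (a, b)) = cnj (\<Sum>k\<in>K. A k (b, a))"
      unfolding cnj_sum using assms by (intro sum.cong) (auto simp: psd_def dest: hermitian_onD)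
  qed
  fix v
  have "qform n (\<lambda>x. \<Sum>k\<in>K. A k x) v = (\<Sum>k\<in>K. qform n (A k) v)"
    unfolding qform_def sum_distrib_left sum_distrib_right
    by (subst sum.swap) (simp add: sum.swap[of _ K])
  then show "0 \<le> Re (qform n (\<lambda>x. \<Sum>k\<in>K. A k x) v)"
    using assms by (simp add: psd_def sum_nonneg)
qed

lemma psd_scale:
  assumes "psd n A" "0 \<le> c"
  shows "psd n (\<lambda>x. of_real c * A x)"
proof -
  have "qform n (\<lambda>x. of_real c * A x) v = of_real c * qform n A v" for v
    unfolding qform_def by (simp add: sum_distrib_left ac_simps)
  moreover have "hermitian_on n (\<lambda>x. of_real c * A x)"
    using assms(1) unfolding psd_def hermitian_on_def by (metis complex_cnj_complex_of_real complex_cnj_mult)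
  ultimately show ?thesis
    using assms unfolding psd_def by simp
qed

lemma psd_add:
  assumes "psd n A" "psd n B"
  shows "psd n (\<lambda>x. A x + B x)"
  using psd_sum[of "UNIV :: bool set" n "\<lambda>k. if k then A else B"] assms
  by (simp add: UNIV_bool add.commute)

section \<open>Convexity and compactness of the set of states\<close>

lemma state_convex:
  assumes "state n \<rho>" "state n \<sigma>" "0 \<le> s" "s \<le> 1"
  shows "state n (\<lambda>x. of_real (1 - s) * \<rho> x + of_real s * \<sigma> x)"
proof -
  have "(\<Sum>a<n. of_real (1 - s) * \<rho> (a, a) + of_real s * \<sigma> (a, a)) = 1"
    using assms(1,2) unfolding sum.distrib sum_distrib_left[symmetric] state_def
    by (simp flip: of_real_add)
  then show ?thesis
    using assms unfolding state_def by (intro conjI psd_add psd_scale) auto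
qed

lemma state_rank_one:
  assumes "(\<Sum>a<n. (cmod (v a))\<^sup>2) = 1"
  shows "state n (\<lambda>(a, b). v a * cnj (v b))"
proof -
  have "(\<Sum>a<n. v a * cnj (v a)) = of_real (\<Sum>a<n. (cmod (v a))\<^sup>2)"
    unfolding of_real_sum by (intro sum.cong refl) (simp add: complex_norm_square del: of_real_power)
  then show ?thesis unfolding state_def using psd_rank_one assms by simp
qed

text \<open>In terms of Gram vectors, the modulus of an entry is at most the mean of two diagonal
  entries, and each of these is at most the trace. This is the boundedness behind
  compactness.\<close>

lemma state_entry_bound:
  assumes "state n \<rho>" "a < n" "b < n"
  shows "cmod (\<rho> (a, b)) \<le> 1"
proof -
  obtain w where w: "\<And>a b. a < n \<Longrightarrow> b < n \<Longrightarrow> \<rho> (a, b) = (\<Sum>k<n. w k a * cnj (w k b))"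
    using psd_decomposition assms(1) unfolding state_def by blast
  have diag: "\<rho> (c, c) = of_real (\<Sum>k<n. (cmod (w k c))\<^sup>2)" if "c < n" for c
    unfolding w[OF that that] of_real_sum by (intro sum.cong refl) (simp add: complex_norm_square del: of_real_power)
  have "of_real (\<Sum>c<n. \<Sum>k<n. (cmod (w k c))\<^sup>2) = (1 :: complex)"
    using assms(1) diag unfolding state_def of_real_sum by simp
  then have tr: "(\<Sum>c<n. \<Sum>k<n. (cmod (w k c))\<^sup>2) = 1"
    by (metis of_real_1 of_real_eq_iff)
  have le1: "(\<Sum>k<n. (cmod (w k c))\<^sup>2) \<le> 1" if "c < n" for c
    unfolding tr[symmetric] using that
    by (intro member_le_sum[where f = "\<lambda>c. \<Sum>k<n. (cmod (w k c))\<^sup>2"]) (auto intro: sum_nonneg)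
  have "cmod (\<rho> (a, b)) \<le> (\<Sum>k<n. cmod (w k a) * cmod (w k b))"
    unfolding w[OF assms(2,3)] by (rule sum_norm_le) (simp add: norm_mult)
  also have "\<dots> \<le> (\<Sum>k<n. ((cmod (w k a))\<^sup>2 + (cmod (w k b))\<^sup>2) / 2)"
  proof (intro sum_mono)
    fix k
    show "cmod (w k a) * cmod (w k b) \<le> ((cmod (w k a))\<^sup>2 + (cmod (w k b))\<^sup>2) / 2"
      using sum_squares_bound[of "cmod (w k a)" "cmod (w k b)"] by simp
  qed
  also have "\<dots> = ((\<Sum>k<n. (cmod (w k a))\<^sup>2) + (\<Sum>k<n. (cmod (w k b))\<^sup>2)) / 2"
    by (simp add: sum.distrib flip: sum_divide_distrib)
  also have "\<dots> \<le> 1" using le1[OF assms(2)] le1[OF assms(3)] by simp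
  finally show ?thesis .
qed

text \<open>A state is a function on all pairs, with arbitrary values outside the \<open>n\<close>
  by \<open>n\<close> block. Setting these to zero selects one representative, and compactness is
  obtained for the representatives.\<close>

definition restrict_entries :: "nat \<Rightarrow> (nat \<times> nat \<Rightarrow> complex) \<Rightarrow> (nat \<times> nat \<Rightarrow> complex)" where
  "restrict_entries n \<rho> = (\<lambda>x. if fst x < n \<and> snd x < n then \<rho> x else 0)"

lemma state_cong:
  assumes "\<And>a b. a < n \<Longrightarrow> b < n \<Longrightarrow> A (a, b) = B (a, b)"
  shows "state n A \<longleftrightarrow> state n B"
  unfolding state_def using psd_cong[of n A B, OF assms] assms by simp

lemma continuous_entry: "continuous_on UNIV (\<lambda>\<rho> :: nat \<times> nat \<Rightarrow> complex. \<rho> x)"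
  by (rule continuous_on_product_coordinates)

text \<open>Tychonoff's theorem makes the product of squares compact, and the states are cut out by
  closed conditions, each on finitely many entries.\<close>

lemma compact_states:
  "compact {\<rho>. state n \<rho> \<and> restrict_entries n \<rho> = \<rho>}" (is "compact ?D")
proof -
  define Q where "Q = (\<lambda>z. of_real (fst z) + \<i> * of_real (snd z)) ` ({-1..1::real} \<times> {-1..1::real})"
  have "compact Q"
    unfolding Q_def by (intro compact_continuous_image compact_Times compact_Icc continuous_intros)
  have Q: "z \<in> Q" if "cmod z \<le> 1" for z
    using that abs_Re_le_cmod[of z] abs_Im_le_cmod[of z] complex_eq[of z]
    unfolding Q_def by (intro image_eqI[where x = "(Re z, Im z)"]) auto
  define K where "K = (\<Pi>\<^sub>E x\<in>(UNIV :: (nat \<times> nat) set). Q)"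
  have "compactin (product_topology (\<lambda>_. euclidean) UNIV) K"
    unfolding K_def compactin_PiE using \<open>compact Q\<close> by simp
  then have "compact K" by (simp add: euclidean_product_topology)
  have "?D \<subseteq> K"
  proof
    fix \<rho> assume r: "\<rho> \<in> ?D"
    have "cmod (\<rho> x) \<le> 1" for x
    proof (cases "fst x < n \<and> snd x < n")
      case True
      then show ?thesis using r state_entry_bound[of n \<rho> "fst x" "snd x"] by simp
    next
      case False
      have "restrict_entries n \<rho> x = \<rho> x" using r by simp
      then have "\<rho> x = 0" using False by (simp add: restrict_entries_def split: if_splits)
      then show ?thesis by simp
    qed
    then show "\<rho> \<in> K" using Q by (auto simp: K_def)
  qed
  moreover have "closed ?D"
  proof -
    have "closed {\<rho>. hermitian_on n \<rho>}"
      unfolding hermitian_on_def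
      by (intro closed_Collect_all closed_Collect_imp open_Collect_const closed_Collect_eq
          continuous_intros continuous_entry)
    moreover have "closed {\<rho>. \<forall>v. 0 \<le> Re (qform n \<rho> v)}"
      unfolding qform_def
      by (intro closed_Collect_all closed_Collect_le continuous_intros continuous_entry)
    moreover have "closed {\<rho> :: nat \<times> nat \<Rightarrow> complex. (\<Sum>a<n. \<rho> (a, a)) = 1}"
      by (intro closed_Collect_eq continuous_intros continuous_entry)
    moreover have "closed {\<rho> :: nat \<times> nat \<Rightarrow> complex. \<forall>x. \<not> (fst x < n \<and> snd x < n) \<longrightarrow> 0 = \<rho> x}"
      by (intro closed_Collect_all closed_Collect_imp open_Collect_const closed_Collect_eq
          continuous_intros continuous_entry)
    moreover have "restrict_entries n \<rho> = \<rho> \<longleftrightarrow> (\<forall>x. \<not> (fst x < n \<and> snd x < n) \<longrightarrow> 0 = \<rho> x)" for \<rho>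
      unfolding restrict_entries_def fun_eq_iff by auto
    ultimately show ?thesis
      unfolding state_def psd_def by (simp only:) (intro closed_Collect_conj)
  qed
  ultimately show ?thesis using \<open>compact K\<close> compact_Int_closed[of K ?D] by (simp add: inf_absorb2)
qed

text \<open>The extreme value theorem for states. Compactness concerns representatives supported on
  the block, so objective and constraint must be compatible with erasing the entries outside
  it.\<close>

lemma state_minimiser_exists:
  fixes f :: "(nat \<times> nat \<Rightarrow> complex) \<Rightarrow> real"
  assumes "continuous_on UNIV f" "closed C"
    and f_local: "\<And>\<rho>. f (restrict_entries n \<rho>) = f \<rho>"
    and C_local: "\<And>\<rho>. \<rho> \<in> C \<Longrightarrow> restrict_entries n \<rho> \<in> C"
    and "state n \<sigma>" "\<sigma> \<in> C"
  obtains \<rho> where "state n \<rho>" "\<rho> \<in> C" "\<And>\<sigma>. state n \<sigma> \<Longrightarrow> \<sigma> \<in> C \<Longrightarrow> f \<rho> \<le> f \<sigma>"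
proof -
  let ?D = "{\<rho>. state n \<rho> \<and> restrict_entries n \<rho> = \<rho>} \<inter> C"
  have mem: "restrict_entries n \<rho> \<in> ?D" if "state n \<rho>" "\<rho> \<in> C" for \<rho>
    using that C_local state_cong[of n "restrict_entries n \<rho>" \<rho>] by (auto simp: restrict_entries_def)
  have "compact ?D" using compact_states assms(2) by (rule compact_Int_closed)
  moreover have "?D \<noteq> {}" using mem assms(5,6) by blast
  ultimately obtain \<rho> where \<rho>: "\<rho> \<in> ?D" and min: "\<And>\<sigma>. \<sigma> \<in> ?D \<Longrightarrow> f \<rho> \<le> f \<sigma>"
    using continuous_attains_inf[of ?D f] continuous_on_subset[OF assms(1) subset_UNIV] by blast
  have "f \<rho> \<le> f \<sigma>" if "state n \<sigma>" "\<sigma> \<in> C" for \<sigma>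
    using min[OF mem[OF that]] f_local by simp
  then show ?thesis using \<rho> that[of \<rho>] by blast
qed

lemma continuous_trace_prod:
  "continuous_on UNIV (\<lambda>\<rho>. trace_prod n \<rho> B)"
  unfolding trace_prod_def by (intro continuous_intros continuous_entry)

lemma trace_prod_restrict: "trace_prod n (restrict_entries n \<rho>) B = trace_prod n \<rho> B"
  by (rule trace_prod_cong) (auto simp: restrict_entries_def)

lemma state_first_basis: "0 < n \<Longrightarrow> state n (\<lambda>(a, b). (if a = 0 then 1 else 0) * cnj (if b = 0 then 1 else 0))"
  by (rule state_rank_one) (simp add: if_distrib[where f = "\<lambda>x. (cmod x)\<^sup>2"] cong: if_cong)

section \<open>The largest eigenvalue as a maximum over states\<close>

lemma eigenvalue_iff_function:
  assumes "A \<in> carrier_mat n n"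
  shows "eigenvalue A \<mu> \<longleftrightarrow>
    (\<exists>v. (\<exists>a<n. v a \<noteq> 0) \<and> (\<forall>a<n. (\<Sum>b<n. A $$ (a, b) * v b) = \<mu> * v a))" (is "_ \<longleftrightarrow> (\<exists>v. ?P v)")
proof
  assume "eigenvalue A \<mu>"
  then obtain v where v: "v \<in> carrier_vec n" "v \<noteq> 0\<^sub>v n" "A *\<^sub>v v = \<mu> \<cdot>\<^sub>v v"
    using assms unfolding eigenvalue_def eigenvector_def by auto
  have "(\<Sum>b<n. A $$ (a, b) * v $ b) = \<mu> * v $ a" if "a < n" for a
  proof -
    have "(A *\<^sub>v v) $ a = (\<mu> \<cdot>\<^sub>v v) $ a" using v(3) by simp
    then show ?thesis using that assms v(1) by (simp add: scalar_prod_def atLeast0LessThan)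
  qed
  moreover have "\<exists>a<n. v $ a \<noteq> 0" using v(1,2) by (auto simp: vec_eq_iff)
  ultimately show "\<exists>v. ?P v" by blast
next
  assume "\<exists>v. ?P v"
  then obtain v where v: "?P v" by blast
  have "vec n v \<noteq> 0\<^sub>v n" using v by (metis index_vec index_zero_vec(1))
  moreover have "A *\<^sub>v vec n v = \<mu> \<cdot>\<^sub>v vec n v"
    using v assms by (auto simp: vec_eq_iff scalar_prod_def atLeast0LessThan)
  ultimately show "eigenvalue A \<mu>"
    using assms unfolding eigenvalue_def eigenvector_def
    by (intro exI[of _ "vec n v"]) auto
qed

lemma qform_eigen:
  assumes "\<And>a. a < n \<Longrightarrow> (\<Sum>b<n. A (a, b) * v b) = \<mu> * v a"
  shows "qform n A v = \<mu> * of_real (\<Sum>a<n. (cmod (v a))\<^sup>2)"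
proof -
  have "qform n A v = (\<Sum>a<n. cnj (v a) * (\<mu> * v a))"
    unfolding qform_def using assms
    by (intro sum.cong refl) (simp add: mult.assoc flip: sum_distrib_left)
  also have "\<dots> = \<mu> * of_real (\<Sum>a<n. (cmod (v a))\<^sup>2)"
    unfolding sum_distrib_left of_real_sum
    by (intro sum.cong refl) (simp add: complex_norm_square del: of_real_power)
  finally show ?thesis .
qed

lemma trace_prod_identity_scaled:
  "trace_prod n A (\<lambda>(a, b). if a = b then c else 0) = c * (\<Sum>a<n. A (a, a))"
  unfolding trace_prod_def by (simp add: mult_delta_right sum_distrib_left mult.commute)

lemma qform_identity_scaled: 
  "qform n (\<lambda>(a, b). if a = b then c else 0) v = c * of_real (\<Sum>a<n. (cmod (v a))\<^sup>2)"
  by (rule qform_eigen) (simp add: mult_delta_left)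

lemma qform_diff: "qform n (\<lambda>x. A x - B x) v = qform n A v - qform n B v"
  unfolding qform_def by (simp add: algebra_simps sum_subtractf)

text \<open>The Rayleigh principle, with mixed states instead of unit vectors: a maximising state is a
  sum of rank one matrices, each of which is then supported on the top eigenspace.\<close>

lemma lambda_max_variational:
  assumes A: "A \<in> carrier_mat n n" "hermitian_on n (($$) A)" and "0 < n"
  shows "\<And>\<rho>. state n \<rho> \<Longrightarrow> Re (trace_prod n \<rho> (($$) A)) \<le> lambda_max A"
    and "\<exists>\<rho>. state n \<rho> \<and> Re (trace_prod n \<rho> (($$) A)) = lambda_max A"
proof -
  let ?t = "\<lambda>\<rho>. Re (trace_prod n \<rho> (($$) A))"
  obtain \<rho> where \<rho>: "state n \<rho>" and max: "\<And>\<sigma>. state n \<sigma> \<Longrightarrow> ?t \<sigma> \<le> ?t \<rho>"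
  proof (rule state_minimiser_exists[of "\<lambda>\<rho>. - ?t \<rho>" UNIV n])
    show "continuous_on UNIV (\<lambda>\<rho>. - ?t \<rho>)" by (intro continuous_intros continuous_trace_prod)
  qed (use state_first_basis[OF \<open>0 < n\<close>] trace_prod_restrict in auto)
  define \<mu> where "\<mu> = ?t \<rho>"
  \<comment> \<open>This is \<open>\<mu>\<close> times the identity minus \<open>A\<close>.
    Maximality of \<open>\<mu>\<close> makes it positive semidefinite, and its expectation in
    \<open>\<rho>\<close> is zero, so every Gram vector of \<open>\<rho>\<close> lies in its
    kernel.\<close>
  define B where "B = (\<lambda>x. (\<lambda>(a, b). if a = b then of_real \<mu> else 0) x - A $$ x)"
  have rayleigh: "Re (qform n (($$) A) v) \<le> \<mu> * (\<Sum>a<n. (cmod (v a))\<^sup>2)" for v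
  proof (cases "(\<Sum>a<n. (cmod (v a))\<^sup>2) = 0")
    case True
    then have "\<forall>a\<in>{..<n}. (cmod (v a))\<^sup>2 = 0" by (subst (asm) sum_nonneg_eq_0_iff) auto
    then show ?thesis using True by (simp add: qform_def)
  next
    case False
    define s where "s = (\<Sum>a<n. (cmod (v a))\<^sup>2)"
    have "s > 0" using False unfolding s_def by (metis less_eq_real_def sum_nonneg zero_le_power2)
    define u where "u = (\<lambda>a. v a / of_real (sqrt s))"
    have sq: "of_real (sqrt s) * of_real (sqrt s) = (of_real s :: complex)"
      using \<open>s > 0\<close> by (simp flip: of_real_mult)
    have "(\<Sum>a<n. (cmod (u a))\<^sup>2) = 1"
      using \<open>s > 0\<close> unfolding u_def
      by (simp add: norm_divide power_divide flip: sum_divide_distrib s_def)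
    then have "Re (qform n (($$) A) u) \<le> \<mu>"
      using max[OF state_rank_one] by (simp add: trace_prod_rank_one \<mu>_def)
    moreover have "qform n (($$) A) u = qform n (($$) A) v / of_real s"
      unfolding qform_def u_def sum_divide_distrib
      by (intro sum.cong refl) (simp add: sq[symmetric])
    ultimately show ?thesis using \<open>s > 0\<close> by (simp add: field_simps s_def)
  qed
  have "psd n B"
    unfolding psd_def
  proof (intro conjI allI)
    show "hermitian_on n B"
      unfolding hermitian_on_def
    proof (intro allI impI)
      fix a b assume "a < n" "b < n"
      then show "B (a, b) = cnj (B (b, a))"
        using hermitian_onD[OF A(2), of a b] by (simp add: B_def)
    qed
    show "0 \<le> Re (qform n B v)" for v
      using rayleigh[of v] unfolding B_def qform_diff qform_identity_scaled by simp
  qed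
  obtain w where w: "\<And>a b. a < n \<Longrightarrow> b < n \<Longrightarrow> \<rho> (a, b) = (\<Sum>k<n. w k a * cnj (w k b))"
    using psd_decomposition \<rho> unfolding state_def by blast
  have "trace_prod n \<rho> B = of_real \<mu> * (\<Sum>a<n. \<rho> (a, a)) - trace_prod n \<rho> (($$) A)"
    unfolding B_def trace_prod_diff_right by (simp add: trace_prod_identity_scaled)
  then have "Re (trace_prod n \<rho> B) = 0" using \<rho> by (simp add: state_def \<mu>_def)
  then have "(\<Sum>k<n. Re (qform n B (w k))) = 0"
    using trace_prod_psd_eq[of n \<rho> w B, OF w] by simp
  then have q0: "Re (qform n B (w k)) = 0" if "k < n" for k
    using that \<open>psd n B\<close> sum_nonneg_eq_0_iff[of "{..<n}" "\<lambda>k. Re (qform n B (w k))"]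
    by (auto simp: psd_def)
  obtain k a where ka: "k < n" "a < n" "w k a \<noteq> 0"
  proof -
    have "(\<Sum>a<n. \<rho> (a, a)) \<noteq> 0" using \<rho> by (simp add: state_def)
    then obtain a where a: "a < n" "\<rho> (a, a) \<noteq> 0" by (elim sum.not_neutral_contains_not_neutral) auto
    then have "(\<Sum>k<n. w k a * cnj (w k a)) \<noteq> 0" using w by simp
    then obtain k where "k < n" "w k a \<noteq> 0" by (elim sum.not_neutral_contains_not_neutral) auto
    then show ?thesis using that a by blast
  qed
  have "(\<Sum>b<n. A $$ (c, b) * w k b) = of_real \<mu> * w k c" if "c < n" for c
  proof -
    have "(\<Sum>b<n. B (c, b) * w k b) = 0"
      using psd_qform_zero_imp_kernel[OF \<open>psd n B\<close> q0[OF ka(1)] that] .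
    moreover have "(\<Sum>b<n. B (c, b) * w k b) = (\<Sum>b<n. if c = b then of_real \<mu> * w k c else 0) - (\<Sum>b<n. A $$ (c, b) * w k b)"
      unfolding sum_subtractf[symmetric] B_def by (intro sum.cong) (auto simp: algebra_simps)
    ultimately show ?thesis using that by simp
  qed
  then have ev: "eigenvalue A (of_real \<mu>)"
    unfolding eigenvalue_iff_function[OF A(1)] using ka by blast
  have ub: "r \<le> \<mu>" if r: "eigenvalue A (of_real r)" for r
  proof -
    obtain v where v: "\<exists>a<n. v a \<noteq> 0" "\<And>a. a < n \<Longrightarrow> (\<Sum>b<n. A $$ (a, b) * v b) = of_real r * v a"
      using r unfolding eigenvalue_iff_function[OF A(1)] by blast
    obtain a where "a < n" "v a \<noteq> 0" using v(1) by blast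
    then have "0 < (\<Sum>a<n. (cmod (v a))\<^sup>2)" by (intro sum_pos2[where i = a]) auto
    moreover have "r * (\<Sum>a<n. (cmod (v a))\<^sup>2) \<le> \<mu> * (\<Sum>a<n. (cmod (v a))\<^sup>2)"
      using rayleigh[of v] qform_eigen[of n "($$) A" v, OF v(2)] by simp
    ultimately show ?thesis by simp
  qed
  \<comment> \<open>\<open>lambda_max\<close> is a \<open>Max\<close>, which has its intended value
    only on finite nonempty sets; finiteness comes from the nonzero characteristic
    polynomial.\<close>
  have "finite {z. eigenvalue A z}"
  proof -
    have "char_poly A \<noteq> 0" using degree_monic_char_poly[OF A(1)] by auto
    then show ?thesis using poly_roots_finite[of "char_poly A"] eigenvalue_root_char_poly[OF A(1)] by simp
  qed
  then have "finite {r :: real. eigenvalue A (complex_of_real r)}"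
    using finite_vimageI[of "{z. eigenvalue A z}" complex_of_real] by (simp add: inj_on_def vimage_def)
  then have "lambda_max A = \<mu>"
    unfolding lambda_max_def using ev ub by (intro Max_eqI) auto
  then show "\<And>\<rho>. state n \<rho> \<Longrightarrow> ?t \<rho> \<le> lambda_max A" "\<exists>\<rho>. state n \<rho> \<and> ?t \<rho> = lambda_max A"
    using max \<rho> \<mu>_def by auto
qed

section \<open>Tensor products of local operators\<close>

lemma sum_lessThan_mult:
  fixes F :: "nat \<Rightarrow> 'a :: comm_monoid_add"
  shows "(\<Sum>a<k * m. F a) = (\<Sum>u<k. \<Sum>b<m. F (u * m + b))"
proof -
  have "sum F {u * m..<u * m + m} = (\<Sum>b<m. F (u * m + b))" for u
    using sum.shift_bounds_nat_ivl[of F 0 "u * m" m]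
    by (simp add: add.commute atLeast0LessThan)
  then show ?thesis by (simp add: sum.nat_group[symmetric])
qed

lemma sum4_swap:
  fixes F :: "'a \<Rightarrow> 'b \<Rightarrow> 'c \<Rightarrow> 'd \<Rightarrow> 'e :: comm_monoid_add"
  shows "(\<Sum>a\<in>A. \<Sum>b\<in>B. \<Sum>c\<in>C. \<Sum>e\<in>E. F a b c e) = (\<Sum>c\<in>C. \<Sum>e\<in>E. \<Sum>a\<in>A. \<Sum>b\<in>B. F a b c e)"
proof -
  have "(\<Sum>x\<in>A \<times> B. \<Sum>y\<in>C \<times> E. F (fst x) (snd x) (fst y) (snd y))
      = (\<Sum>y\<in>C \<times> E. \<Sum>x\<in>A \<times> B. F (fst x) (snd x) (fst y) (snd y))"
    by (rule sum.swap)
  then show ?thesis by (simp only: sum.cartesian_product' fst_conv snd_conv)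
qed

lemma prod_indicator:
  "finite S \<Longrightarrow> (\<Prod>j\<in>S. if P j then 1 else 0) = (if \<forall>j\<in>S. P j then 1 else (0 :: complex))"
  by (induction S rule: finite_induct) auto

section \<open>Digits of an index as tensor factors\<close>

lemma digit_less: "0 < d \<Longrightarrow> digit d j a < d"
  by (simp add: digit_def)

lemma digit_add_high:
  assumes "0 < d" "j < n"
  shows "digit d j (u * d ^ n + b) = digit d j b"
proof -
  obtain r where r: "n = j + Suc r" using \<open>j < n\<close> less_iff_Suc_add by auto
  have "(u * d ^ n + b) div d ^ j = (b + u * d ^ Suc r * d ^ j) div d ^ j"
    by (simp add: r power_add ac_simps)
  also have "\<dots> = u * d ^ Suc r + b div d ^ j"
    using \<open>0 < d\<close> by (subst div_mult_self1) auto
  also have "\<dots> = b div d ^ j + (u * d ^ r) * d"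
    by simp
  finally show ?thesis unfolding digit_def by (simp only: mod_mult_self1)
qed

lemma digit_top: "u < d \<Longrightarrow> b < d ^ n \<Longrightarrow> digit d n (u * d ^ n + b) = u"
  by (simp add: digit_def)

lemma digits_eqI:
  assumes "a < d ^ n" "b < d ^ n" "\<And>j. j < n \<Longrightarrow> digit d j a = digit d j b"
  shows "a = b"
  using assms
proof (induction n arbitrary: a b)
  case (Suc n)
  have "0 < d" using Suc.prems(1) by (cases d) auto
  have decomp: "c = (c div d ^ n) * d ^ n + c mod d ^ n" for c
    by (rule div_mult_mod_eq[symmetric])
  have "a mod d ^ n = b mod d ^ n"
  proof (rule Suc.IH)
    fix j assume "j < n"
    then have "digit d j a = digit d j (a mod d ^ n)" "digit d j b = digit d j (b mod d ^ n)"
      using digit_add_high[OF \<open>0 < d\<close>] decomp by metis+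
    then show "digit d j (a mod d ^ n) = digit d j (b mod d ^ n)"
      using Suc.prems(3)[of j] \<open>j < n\<close> by simp
  qed (use \<open>0 < d\<close> in auto)
  moreover have "c div d ^ n = digit d n c" if "c < d ^ Suc n" for c
    using that by (simp add: digit_def less_mult_imp_div_less)
  then have "a div d ^ n = b div d ^ n"
    using Suc.prems by simp
  ultimately show ?case using decomp by metis
qed simp

text \<open>Indices below \<open>d ^ n\<close> are tuples of \<open>n\<close> digits, so this is the
  distributive law. It reduces computations with product operators to their factors.\<close>

lemma sum_prod_digits:
  fixes f :: "nat \<Rightarrow> nat \<Rightarrow> complex"
  assumes "0 < d"
  shows "(\<Sum>a<d ^ n. \<Prod>j<n. f j (digit d j a)) = (\<Prod>j<n. \<Sum>k<d. f j k)"
proof (induction n)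
  case (Suc n)
  have "(\<Sum>a<d ^ Suc n. \<Prod>j<Suc n. f j (digit d j a))
      = (\<Sum>u<d. \<Sum>b<d ^ n. \<Prod>j<Suc n. f j (digit d j (u * d ^ n + b)))"
    by (simp only: power_Suc sum_lessThan_mult)
  also have "\<dots> = (\<Sum>u<d. \<Sum>b<d ^ n. (\<Prod>j<n. f j (digit d j b)) * f n u)"
    using assms by (intro sum.cong refl) (simp add: digit_add_high digit_top)
  also have "\<dots> = (\<Prod>j<Suc n. \<Sum>k<d. f j k)"
    by (simp add: Suc sum_distrib_left flip: sum_distrib_right)
  finally show ?case .
qed simp

section \<open>Product operators, conjugation and isometries\<close>

definition id_op :: "nat \<times> nat \<Rightarrow> complex" where
  "id_op = (\<lambda>(k, l). if k = l then 1 else 0)"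

definition unit_op :: "nat \<Rightarrow> nat \<Rightarrow> nat \<times> nat \<Rightarrow> complex" where
  "unit_op k l = (\<lambda>(a, b). if a = k \<and> b = l then 1 else 0)"

definition adj :: "(nat \<times> nat \<Rightarrow> complex) \<Rightarrow> nat \<times> nat \<Rightarrow> complex" where
  "adj V = (\<lambda>(a, b). cnj (V (b, a)))"

definition conj_by :: "nat \<Rightarrow> (nat \<times> nat \<Rightarrow> complex) \<Rightarrow> (nat \<times> nat \<Rightarrow> complex) \<Rightarrow> nat \<times> nat \<Rightarrow> complex" where
  "conj_by n V A = (\<lambda>(a, b). \<Sum>c<n. \<Sum>e<n. V (a, c) * A (c, e) * cnj (V (b, e)))"

definition tensor_op :: "nat \<Rightarrow> nat \<Rightarrow> (nat \<Rightarrow> nat \<times> nat \<Rightarrow> complex) \<Rightarrow> nat \<times> nat \<Rightarrow> complex" where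
  "tensor_op d n M = (\<lambda>(a, b). \<Prod>j<n. M j (digit d j a, digit d j b))"

lemma id_op_apply [simp]: "id_op (k, l) = (if k = l then 1 else 0)"
  by (simp add: id_op_def)

lemma unit_op_apply [simp]: "unit_op k l (a, b) = (if a = k \<and> b = l then 1 else 0)"
  by (simp add: unit_op_def)

text \<open>Conjugation sends each Gram vector \<open>w k\<close> to its image \<open>u k\<close>
  under \<open>V\<close>.\<close>

lemma psd_conj_by:
  assumes "psd n \<rho>"
  shows "psd n (conj_by n V \<rho>)"
proof -
  obtain w where w: "\<And>a b. a < n \<Longrightarrow> b < n \<Longrightarrow> \<rho> (a, b) = (\<Sum>k<n. w k a * cnj (w k b))"
    using psd_decomposition[OF assms] by blast
  define u where "u k a = (\<Sum>c<n. V (a, c) * w k c)" for k a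
  have "conj_by n V \<rho> (a, b) = (\<Sum>k<n. (\<lambda>(a, b). u k a * cnj (u k b)) (a, b))" for a b
  proof -
    have "conj_by n V \<rho> (a, b) = (\<Sum>c<n. \<Sum>e<n. \<Sum>k<n. (V (a, c) * w k c) * (cnj (V (b, e)) * cnj (w k e)))"
      unfolding conj_by_def using w
      by (auto intro!: sum.cong simp: sum_distrib_left sum_distrib_right ac_simps)
    also have "\<dots> = (\<Sum>c<n. \<Sum>k<n. \<Sum>e<n. (V (a, c) * w k c) * (cnj (V (b, e)) * cnj (w k e)))"
      by (rule sum.cong, rule refl, rule sum.swap)
    also have "\<dots> = (\<Sum>k<n. \<Sum>c<n. \<Sum>e<n. (V (a, c) * w k c) * (cnj (V (b, e)) * cnj (w k e)))"
      by (rule sum.swap)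
    also have "\<dots> = (\<Sum>k<n. (\<lambda>(a, b). u k a * cnj (u k b)) (a, b))"
      by (simp only: u_def cnj_sum sum_product prod.case complex_cnj_mult)
    finally show ?thesis .
  qed
  then have "psd n (conj_by n V \<rho>) \<longleftrightarrow> psd n (\<lambda>x. \<Sum>k<n. (\<lambda>(a, b). u k a * cnj (u k b)) x)"
    by (intro psd_cong) simp
  moreover have "psd n (\<lambda>x. \<Sum>k<n. (\<lambda>(a, b). u k a * cnj (u k b)) x)"
    by (rule psd_sum) (rule psd_rank_one)
  ultimately show ?thesis by simp
qed

text \<open>Cyclicity of the trace. The conjugation is moved to the observable because the
  observables are built from product operators, while the state is arbitrary.\<close>

lemma trace_prod_conj_by:
  "trace_prod n (conj_by n V \<rho>) B = trace_prod n \<rho> (conj_by n (adj V) B)"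
proof -
  have "trace_prod n (conj_by n V \<rho>) B
      = (\<Sum>a<n. \<Sum>b<n. \<Sum>c<n. \<Sum>e<n. V (a, c) * \<rho> (c, e) * cnj (V (b, e)) * B (b, a))"
    by (simp add: trace_prod_def conj_by_def sum_distrib_right)
  also have "\<dots> = (\<Sum>c<n. \<Sum>e<n. \<Sum>a<n. \<Sum>b<n. V (a, c) * \<rho> (c, e) * cnj (V (b, e)) * B (b, a))"
    by (rule sum4_swap)
  also have "\<dots> = (\<Sum>c<n. \<Sum>e<n. \<Sum>b<n. \<Sum>a<n. V (a, c) * \<rho> (c, e) * cnj (V (b, e)) * B (b, a))"
    by (intro sum.cong refl sum.swap)
  also have "\<dots> = trace_prod n \<rho> (conj_by n (adj V) B)"
    by (simp add: trace_prod_def conj_by_def adj_def sum_distrib_left ac_simps)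
  finally show ?thesis .
qed

lemma tensor_op_cong:
  assumes "0 < d" "\<And>j k l. j < n \<Longrightarrow> k < d \<Longrightarrow> l < d \<Longrightarrow> M j (k, l) = M' j (k, l)"
  shows "tensor_op d n M = tensor_op d n M'"
  unfolding tensor_op_def using assms(2) digit_less[OF assms(1)] by (auto intro!: prod.cong)

lemma conj_by_tensor_op:
  assumes "0 < d"
  shows "conj_by (d ^ n) (adj (tensor_op d n K)) (tensor_op d n M)
       = tensor_op d n (\<lambda>j. conj_by d (adj (K j)) (M j))"
proof
  fix x :: "nat \<times> nat"
  obtain e c where x: "x = (e, c)" by (cases x)
  define f where "f j k l = cnj (K j (k, digit d j e)) * M j (k, l) * K j (l, digit d j c)" for j k l
  have "conj_by (d ^ n) (adj (tensor_op d n K)) (tensor_op d n M) x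
      = (\<Sum>b<d ^ n. \<Sum>a<d ^ n. \<Prod>j<n. f j (digit d j b) (digit d j a))"
    by (simp add: x conj_by_def adj_def tensor_op_def f_def prod.distrib)
  also have "\<dots> = (\<Sum>b<d ^ n. \<Prod>j<n. \<Sum>l<d. f j (digit d j b) l)"
    by (simp add: sum_prod_digits[OF assms, where f = "\<lambda>j. f j (digit d j _)"])
  also have "\<dots> = (\<Prod>j<n. \<Sum>k<d. \<Sum>l<d. f j k l)"
    by (rule sum_prod_digits[OF assms])
  also have "\<dots> = tensor_op d n (\<lambda>j. conj_by d (adj (K j)) (M j)) x"
    by (simp add: x conj_by_def adj_def tensor_op_def f_def)
  finally show "conj_by (d ^ n) (adj (tensor_op d n K)) (tensor_op d n M) x
      = tensor_op d n (\<lambda>j. conj_by d (adj (K j)) (M j)) x" .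
qed

lemma trace_prod_conj_tensor:
  assumes "0 < d"
  shows "trace_prod (d ^ n) (conj_by (d ^ n) (tensor_op d n K) \<rho>) (tensor_op d n M)
       = trace_prod (d ^ n) \<rho> (tensor_op d n (\<lambda>j. conj_by d (adj (K j)) (M j)))"
  by (simp add: trace_prod_conj_by conj_by_tensor_op[OF assms])

lemma tensor_op_id:
  assumes "a < d ^ n" "b < d ^ n"
  shows "tensor_op d n (\<lambda>_. id_op) (a, b) = id_op (a, b)"
  using digits_eqI[OF assms] by (auto simp: tensor_op_def prod_indicator)

lemma trace_prod_tensor_id: "trace_prod (d ^ n) \<rho> (tensor_op d n (\<lambda>_. id_op)) = (\<Sum>a<d ^ n. \<rho> (a, a))"
proof -
  have "trace_prod (d ^ n) \<rho> (tensor_op d n (\<lambda>_. id_op)) = trace_prod (d ^ n) \<rho> (\<lambda>(a, b). if a = b then 1 else 0)"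
    by (rule trace_prod_cong) (auto simp: tensor_op_id)
  then show ?thesis by (simp add: trace_prod_identity_scaled)
qed

lemma conj_by_adj_id_op:
  assumes "k < d" "l < d"
  shows "conj_by d (adj id_op) A (k, l) = A (k, l)"
proof -
  have "conj_by d (adj id_op) A (k, l) = (\<Sum>c<d. \<Sum>e<d. if e = l then if c = k then A (c, e) else 0 else 0)"
    unfolding conj_by_def adj_def prod.case by (intro sum.cong refl) auto
  then show ?thesis using assms by (simp add: sum.delta)
qed

text \<open>Summed over \<open>k\<close> and \<open>l\<close>, the right-hand side becomes the trace
  of \<open>A\<close> times the identity: up to normalisation, matrix units are the Kraus operators
  of complete depolarisation.\<close>

lemma conj_by_adj_unit_op:
  assumes "k < d" "l < d"
  shows "conj_by d (adj (unit_op k l)) A (x, y) = A (k, k) * unit_op l l (x, y)"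
proof -
  have "conj_by d (adj (unit_op k l)) A (x, y)
     = (\<Sum>c<d. \<Sum>e<d. if e = k then if c = k then A (k, k) * unit_op l l (x, y) else 0 else 0)"
    unfolding conj_by_def adj_def prod.case by (intro sum.cong refl) auto
  then show ?thesis using assms by (simp add: sum.delta)
qed

lemma conj_by_adj_of_unit_op:
  assumes "k < d" "l < d"
  shows "conj_by d (adj V) (unit_op k l) (x, y) = cnj (V (k, x)) * V (l, y)"
proof -
  have "conj_by d (adj V) (unit_op k l) (x, y)
     = (\<Sum>c<d. \<Sum>e<d. if e = l then if c = k then cnj (V (k, x)) * V (l, y) else 0 else 0)"
    unfolding conj_by_def adj_def prod.case by (intro sum.cong refl) auto
  then show ?thesis using assms by (simp add: sum.delta)
qed

text \<open>For a square matrix this is unitarity, in the form of orthonormal columns that the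
  computations use.\<close>

definition isometry :: "nat \<Rightarrow> (nat \<times> nat \<Rightarrow> complex) \<Rightarrow> bool" where
  "isometry d U \<longleftrightarrow> (\<forall>k<d. \<forall>l<d. (\<Sum>a<d. cnj (U (a, k)) * U (a, l)) = id_op (k, l))"

lemma conj_by_adj_isometry:
  assumes "isometry d U" "k < d" "l < d"
  shows "conj_by d (adj U) id_op (k, l) = id_op (k, l)"
proof -
  have "conj_by d (adj U) id_op (k, l) = (\<Sum>c<d. \<Sum>e<d. if c = e then cnj (U (c, k)) * U (c, l) else 0)"
    unfolding conj_by_def adj_def prod.case by (intro sum.cong refl) auto
  then show ?thesis using assms by (simp add: isometry_def)
qed

lemma isometry_tensor_op:
  assumes "0 < d" "\<And>j. j < n \<Longrightarrow> isometry d (K j)"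
  shows "isometry (d ^ n) (tensor_op d n K)"
  unfolding isometry_def
proof (intro allI impI)
  fix k l assume kl: "k < d ^ n" "l < d ^ n"
  have "(\<Sum>a<d ^ n. cnj (tensor_op d n K (a, k)) * tensor_op d n K (a, l))
     = (\<Sum>a<d ^ n. \<Prod>j<n. cnj (K j (digit d j a, digit d j k)) * K j (digit d j a, digit d j l))"
    by (simp add: tensor_op_def prod.distrib)
  also have "\<dots> = (\<Prod>j<n. \<Sum>a<d. cnj (K j (a, digit d j k)) * K j (a, digit d j l))"
    by (rule sum_prod_digits[OF assms(1)])
  also have "\<dots> = tensor_op d n (\<lambda>_. id_op) (k, l)"
    using assms digit_less by (simp add: tensor_op_def isometry_def)
  finally show "(\<Sum>a<d ^ n. cnj (tensor_op d n K (a, k)) * tensor_op d n K (a, l)) = id_op (k, l)"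
    using kl by (simp add: tensor_op_id)
qed

lemma isometry_norm:
  assumes "isometry n V"
  shows "(\<Sum>a<n. (cmod (\<Sum>c<n. V (a, c) * x c))\<^sup>2) = (\<Sum>c<n. (cmod (x c))\<^sup>2)"
proof -
  have "of_real (\<Sum>a<n. (cmod (\<Sum>c<n. V (a, c) * x c))\<^sup>2)
      = (\<Sum>a<n. (\<Sum>c<n. V (a, c) * x c) * cnj (\<Sum>c<n. V (a, c) * x c))"
    unfolding of_real_sum complex_norm_square ..
  also have "\<dots> = (\<Sum>a<n. \<Sum>c<n. \<Sum>e<n. (x c * cnj (x e)) * (cnj (V (a, e)) * V (a, c)))"
    by (simp add: sum_product ac_simps)
  also have "\<dots> = (\<Sum>c<n. \<Sum>e<n. \<Sum>a<n. (x c * cnj (x e)) * (cnj (V (a, e)) * V (a, c)))"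
    by (subst sum.swap) (intro sum.cong refl sum.swap)
  also have "\<dots> = (\<Sum>c<n. \<Sum>e<n. if e = c then x c * cnj (x e) else 0)"
    using assms by (intro sum.cong refl) (simp add: isometry_def flip: sum_distrib_left)
  also have "\<dots> = of_real (\<Sum>c<n. (cmod (x c))\<^sup>2)"
    unfolding of_real_sum complex_norm_square by simp
  finally show ?thesis by (simp only: of_real_eq_iff)
qed

text \<open>The square of the Hilbert-Schmidt norm.\<close>

definition hs_norm :: "nat \<Rightarrow> (nat \<times> nat \<Rightarrow> complex) \<Rightarrow> real" where
  "hs_norm n A = (\<Sum>a<n. \<Sum>b<n. (cmod (A (a, b)))\<^sup>2)"

lemma isometry_cnj: "isometry n V \<Longrightarrow> isometry n (\<lambda>x. cnj (V x))"
  unfolding isometry_def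
proof (intro allI impI)
  fix k l assume V: "\<forall>k<n. \<forall>l<n. (\<Sum>a<n. cnj (V (a, k)) * V (a, l)) = id_op (k, l)" and "k < n" "l < n"
  then have "(\<Sum>a<n. cnj (V (a, l)) * V (a, k)) = id_op (l, k)" by blast
  then show "(\<Sum>a<n. cnj (cnj (V (a, k))) * cnj (V (a, l))) = id_op (k, l)"
    by (simp add: ac_simps)
qed

text \<open>One side at a time: \<open>V\<close> acts on the first index and its entrywise conjugate
  on the second, and each preserves the sum of squares.\<close>

lemma hs_norm_conj_by:
  assumes "isometry n V"
  shows "hs_norm n (conj_by n V A) = hs_norm n A"
proof -
  define y where "y b c = (\<Sum>e<n. cnj (V (b, e)) * A (c, e))" for b c
  have "hs_norm n (conj_by n V A) = (\<Sum>b<n. \<Sum>a<n. (cmod (\<Sum>c<n. V (a, c) * y b c))\<^sup>2)"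
    unfolding hs_norm_def conj_by_def y_def
    by (subst sum.swap) (simp add: sum_distrib_left ac_simps)
  also have "\<dots> = (\<Sum>c<n. \<Sum>b<n. (cmod (y b c))\<^sup>2)"
    unfolding isometry_norm[OF assms] by (rule sum.swap)
  also have "\<dots> = hs_norm n A"
    unfolding hs_norm_def y_def
    using isometry_norm[OF isometry_cnj[OF assms]] by simp
  finally show ?thesis .
qed

lemma state_conj_tensor:
  assumes "0 < d" "\<And>j. j < n \<Longrightarrow> isometry d (K j)" "state (d ^ n) \<rho>"
  shows "state (d ^ n) (conj_by (d ^ n) (tensor_op d n K) \<rho>)"
proof -
  have "(\<Sum>a<d ^ n. conj_by (d ^ n) (tensor_op d n K) \<rho> (a, a)) =
      trace_prod (d ^ n) \<rho> (tensor_op d n (\<lambda>j. conj_by d (adj (K j)) id_op))"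
    by (simp add: trace_prod_conj_tensor[OF assms(1)] flip: trace_prod_tensor_id)
  also have "tensor_op d n (\<lambda>j. conj_by d (adj (K j)) id_op) = tensor_op d n (\<lambda>_. id_op)"
    using assms(1,2) by (intro tensor_op_cong) (auto simp: conj_by_adj_isometry)
  finally show ?thesis
    using assms(3) psd_conj_by by (simp add: state_def trace_prod_tensor_id)
qed

section \<open>Marginals on the factors 0 and i\<close>

definition pair_op :: "nat \<Rightarrow> (nat \<times> nat \<Rightarrow> complex) \<Rightarrow> (nat \<times> nat \<Rightarrow> complex) \<Rightarrow> nat \<Rightarrow> nat \<times> nat \<Rightarrow> complex" where
  "pair_op i A B = (\<lambda>j. if j = 0 then A else if j = i then B else id_op)"

text \<open>Up to transposition, these are the matrix entries of the marginal of \<open>\<rho>\<close> on the factors \<open>0\<close>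
  and \<open>i\<close>.\<close>

definition pair_coeff :: "nat \<Rightarrow> nat \<Rightarrow> nat \<Rightarrow> (nat \<times> nat \<Rightarrow> complex) \<Rightarrow> nat \<Rightarrow> nat \<Rightarrow> nat \<Rightarrow> nat \<Rightarrow> complex" where
  "pair_coeff d N i \<rho> k k' l l' = trace_prod (d ^ (N + 1)) \<rho> (tensor_op d (N + 1) (pair_op i (unit_op k k') (unit_op l l')))"

lemma tensor_op_pair:
  assumes "i \<in> {1..N}"
  shows "tensor_op d (N + 1) (pair_op i A B) (a, b) =
    A (digit d 0 a, digit d 0 b) * B (digit d i a, digit d i b) *
    (if \<forall>j\<le>N. j \<noteq> 0 \<and> j \<noteq> i \<longrightarrow> digit d j a = digit d j b then 1 else 0)"
proof -
  let ?S = "{..<N + 1} - {0, i}"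
  have S: "{..<N + 1} = insert 0 (insert i ?S)" using assms by auto
  have "tensor_op d (N + 1) (pair_op i A B) (a, b) =
      A (digit d 0 a, digit d 0 b) * (B (digit d i a, digit d i b) *
      (\<Prod>j\<in>?S. pair_op i A B j (digit d j a, digit d j b)))"
    unfolding tensor_op_def prod.case
    by (subst S, subst prod.insert, use assms in simp, use assms in force,
        subst prod.insert) (use assms in \<open>auto simp: pair_op_def\<close>)
  also have "(\<Prod>j\<in>?S. pair_op i A B j (digit d j a, digit d j b)) =
      (\<Prod>j\<in>?S. if digit d j a = digit d j b then 1 else 0)"
    by (intro prod.cong) (auto simp: pair_op_def)
  also have "\<dots> = (if \<forall>j\<le>N. j \<noteq> 0 \<and> j \<noteq> i \<longrightarrow> digit d j a = digit d j b then 1 else 0)"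
    by (subst prod_indicator) (auto simp: less_Suc_eq_le)
  finally show ?thesis by simp
qed

lemma sum_unit_op:
  assumes "x < d" "y < d"
  shows "(\<Sum>k<d. \<Sum>l<d. A (k, l) * unit_op k l (x, y)) = A (x, y)"
proof -
  have "(\<Sum>k<d. \<Sum>l<d. A (k, l) * unit_op k l (x, y))
      = (\<Sum>k<d. \<Sum>l<d. if l = y then if k = x then A (x, y) else 0 else 0)"
    by (intro sum.cong refl) auto
  then show ?thesis using assms by (simp add: sum.delta)
qed

text \<open>Expansion of \<open>A\<close> and \<open>B\<close> in matrix units: the coefficients
  \<open>pair_coeff\<close> determine the expectation of every product operator on the factors
  \<open>0\<close> and \<open>i\<close>.\<close>

lemma trace_prod_pair:
  assumes "0 < d" "i \<in> {1..N}"
  shows "trace_prod (d ^ (N + 1)) \<rho> (tensor_op d (N + 1) (pair_op i A B)) =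
    (\<Sum>k<d. \<Sum>k'<d. \<Sum>l<d. \<Sum>l'<d. A (k, k') * B (l, l') * pair_coeff d N i \<rho> k k' l l')"
proof -
  let ?U = "\<lambda>k k' l l'. tensor_op d (N + 1) (pair_op i (unit_op k k') (unit_op l l'))"
  have "tensor_op d (N + 1) (pair_op i A B) =
      (\<lambda>x. \<Sum>k<d. \<Sum>k'<d. \<Sum>l<d. \<Sum>l'<d. A (k, k') * B (l, l') * ?U k k' l l' x)"
  proof
    fix x :: "nat \<times> nat"
    obtain a b where x: "x = (a, b)" by (cases x)
    let ?R = "if \<forall>j\<le>N. j \<noteq> 0 \<and> j \<noteq> i \<longrightarrow> digit d j a = digit d j b then 1 else (0 :: complex)"
    let ?x = "(digit d 0 a, digit d 0 b)" and ?y = "(digit d i a, digit d i b)"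
    have "(\<Sum>k<d. \<Sum>k'<d. \<Sum>l<d. \<Sum>l'<d. A (k, k') * B (l, l') * ?U k k' l l' x)
       = (\<Sum>k<d. \<Sum>k'<d. \<Sum>l<d. \<Sum>l'<d. (A (k, k') * unit_op k k' ?x) * ((B (l, l') * unit_op l l' ?y) * ?R))"
      unfolding x tensor_op_pair[OF assms(2)] by (simp only: ac_simps)
    also have "\<dots> = (\<Sum>k<d. \<Sum>k'<d. A (k, k') * unit_op k k' ?x) * ((\<Sum>l<d. \<Sum>l'<d. B (l, l') * unit_op l l' ?y) * ?R)"
      by (simp only: sum_distrib_right) (simp only: sum_distrib_left)
    also have "\<dots> = A ?x * (B ?y * ?R)"
      using digit_less[OF assms(1)] by (simp only: sum_unit_op)
    finally show "tensor_op d (N + 1) (pair_op i A B) x =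
      (\<Sum>k<d. \<Sum>k'<d. \<Sum>l<d. \<Sum>l'<d. A (k, k') * B (l, l') * ?U k k' l l' x)"
      unfolding x tensor_op_pair[OF assms(2)] by (simp only: mult.assoc)
  qed
  then show ?thesis
    by (simp only: trace_prod_sum_right trace_prod_scale_right pair_coeff_def)
qed

text \<open>\<Omega> is the sum of the vectors \<open>|kk>\<close>, so \<omega> is the sum of the
  operators \<open>|kk><ll|\<close>, each a product of two matrix units. This makes the calculus of
  product operators available for \<omega>, which in general is not one itself.\<close>

lemma omega_0i_eq:
  assumes "0 < d" "i \<in> {1..N}" "a < d ^ (N + 1)" "b < d ^ (N + 1)"
  shows "omega_0i d N i $$ (a, b) =
    (\<Sum>k<d. \<Sum>l<d. tensor_op d (N + 1) (pair_op i (unit_op k l) (unit_op k l)) (a, b))"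
proof -
  let ?R = "if \<forall>j\<le>N. j \<noteq> 0 \<and> j \<noteq> i \<longrightarrow> digit d j a = digit d j b then 1 else (0 :: complex)"
  have "(\<Sum>k<d. \<Sum>l<d. tensor_op d (N + 1) (pair_op i (unit_op k l) (unit_op k l)) (a, b))
      = (\<Sum>k<d. \<Sum>l<d. (unit_op k l (digit d i a, digit d i b) * ?R) * unit_op k l (digit d 0 a, digit d 0 b))"
    unfolding tensor_op_pair[OF assms(2)] by (simp only: ac_simps)
  also have "\<dots> = unit_op (digit d 0 a) (digit d 0 b) (digit d i a, digit d i b) * ?R"
    using sum_unit_op[of "digit d 0 a" d "digit d 0 b" "\<lambda>(k, l). unit_op k l (digit d i a, digit d i b) * ?R"]
      digit_less[OF assms(1)] by simp
  also have "\<dots> = omega_0i d N i $$ (a, b)"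
    using assms(3,4) by (auto simp: omega_0i_def)
  finally show ?thesis by simp
qed

lemma trace_prod_omega:
  assumes "0 < d" "i \<in> {1..N}"
  shows "trace_prod (d ^ (N + 1)) \<rho> (($$) (omega_0i d N i)) = (\<Sum>k<d. \<Sum>l<d. pair_coeff d N i \<rho> k l k l)"
proof -
  have "trace_prod (d ^ (N + 1)) \<rho> (($$) (omega_0i d N i)) = trace_prod (d ^ (N + 1)) \<rho>
      (\<lambda>x. \<Sum>k<d. \<Sum>l<d. tensor_op d (N + 1) (pair_op i (unit_op k l) (unit_op k l)) x)"
    using omega_0i_eq[OF assms] by (intro trace_prod_cong) auto
  then show ?thesis by (simp only: trace_prod_sum_right pair_coeff_def)
qed

lemma pair_op_id: "pair_op i id_op id_op = (\<lambda>_. id_op)"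
  by (auto simp: pair_op_def)

lemma sum_id_op: "(\<Sum>k<d. \<Sum>k'<d. id_op (k, k') * f k k') = (\<Sum>k<d. f k k)"
proof -
  have "(\<Sum>k<d. \<Sum>k'<d. id_op (k, k') * f k k') = (\<Sum>k<d. \<Sum>k'<d. if k = k' then f k k' else 0)"
    by (intro sum.cong refl) auto
  then show ?thesis by simp
qed

lemma sum_pair_coeff_diag:
  assumes "0 < d" "i \<in> {1..N}"
  shows "(\<Sum>k<d. \<Sum>l<d. pair_coeff d N i \<rho> k k l l) = (\<Sum>a<d ^ (N + 1). \<rho> (a, a))"
proof -
  have "(\<Sum>a<d ^ (N + 1). \<rho> (a, a)) = (\<Sum>k<d. \<Sum>k'<d. \<Sum>l<d. \<Sum>l'<d. id_op (k, k') * id_op (l, l') * pair_coeff d N i \<rho> k k' l l')"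
    using trace_prod_pair[OF assms, of \<rho> id_op id_op] unfolding pair_op_id trace_prod_tensor_id .
  also have "\<dots> = (\<Sum>k<d. \<Sum>k'<d. id_op (k, k') * (\<Sum>l<d. \<Sum>l'<d. id_op (l, l') * pair_coeff d N i \<rho> k k' l l'))"
    by (simp only: sum_distrib_left mult.assoc)
  also have "\<dots> = (\<Sum>k<d. \<Sum>l<d. pair_coeff d N i \<rho> k k l l)"
    by (simp only: sum_id_op)
  finally show ?thesis by simp
qed

section \<open>Twirling and depolarising a state\<close>

definition twirl :: "nat \<Rightarrow> nat \<Rightarrow> (nat \<times> nat \<Rightarrow> complex) \<Rightarrow> (nat \<times> nat \<Rightarrow> complex) \<Rightarrow> nat \<times> nat \<Rightarrow> complex" where
  "twirl d N U \<rho> = conj_by (d ^ (N + 1)) (tensor_op d (N + 1) (\<lambda>j. if j = 0 then \<lambda>x. cnj (U x) else U)) \<rho>"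

lemma state_twirl:
  assumes "0 < d" "isometry d U" "state (d ^ (N + 1)) \<rho>"
  shows "state (d ^ (N + 1)) (twirl d N U \<rho>)"
  unfolding twirl_def using assms by (intro state_conj_tensor) (auto simp: isometry_cnj)

lemma hs_norm_twirl:
  assumes "0 < d" "isometry d U"
  shows "hs_norm (d ^ (N + 1)) (twirl d N U \<rho>) = hs_norm (d ^ (N + 1)) \<rho>"
  unfolding twirl_def using assms
  by (intro hs_norm_conj_by isometry_tensor_op) (auto simp: isometry_cnj)

text \<open>On every factor other than \<open>0\<close> and \<open>i\<close> the observable is the
  identity, which the isometry preserves; hence the coefficients of one pair transform among
  themselves.\<close>

lemma pair_coeff_twirl:
  assumes "0 < d" "i \<in> {1..N}" "isometry d U" "k < d" "k' < d" "l < d" "l' < d"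
  shows "pair_coeff d N i (twirl d N U \<rho>) k k' l l' =
    (\<Sum>m<d. \<Sum>m'<d. \<Sum>n<d. \<Sum>n'<d. U (k, m) * cnj (U (k', m')) * (cnj (U (l, n)) * U (l', n')) *
       pair_coeff d N i \<rho> m m' n n')"
proof -
  have "pair_coeff d N i (twirl d N U \<rho>) k k' l l' = trace_prod (d ^ (N + 1)) \<rho> (tensor_op d (N + 1)
      (\<lambda>j. conj_by d (adj (if j = 0 then \<lambda>x. cnj (U x) else U)) (pair_op i (unit_op k k') (unit_op l l') j)))"
    unfolding pair_coeff_def twirl_def by (rule trace_prod_conj_tensor[OF assms(1)])
  also have "tensor_op d (N + 1)
      (\<lambda>j. conj_by d (adj (if j = 0 then \<lambda>x. cnj (U x) else U)) (pair_op i (unit_op k k') (unit_op l l') j))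
    = tensor_op d (N + 1) (pair_op i (\<lambda>(m, m'). U (k, m) * cnj (U (k', m'))) (\<lambda>(n, n'). cnj (U (l, n)) * U (l', n')))"
    using assms by (intro tensor_op_cong)
      (auto simp: pair_op_def conj_by_adj_of_unit_op conj_by_adj_isometry)
  finally show ?thesis by (simp only: trace_prod_pair[OF assms(1,2)] prod.case)
qed

text \<open>The conjugate on factor \<open>0\<close> is there because \<open>cnj U\<close> tensor
  \<open>U\<close> fixes \<Omega>. In coefficients this is orthonormality of the columns of
  \<open>U\<close>, used once for the sum over \<open>k\<close> and once for the sum over
  \<open>k'\<close>.\<close>

lemma trace_prod_omega_twirl:
  assumes "0 < d" "i \<in> {1..N}" "isometry d U"
  shows "trace_prod (d ^ (N + 1)) (twirl d N U \<rho>) (($$) (omega_0i d N i))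
       = trace_prod (d ^ (N + 1)) \<rho> (($$) (omega_0i d N i))"
proof -
  let ?g = "pair_coeff d N i \<rho>"
  have "(\<Sum>k<d. \<Sum>k'<d. pair_coeff d N i (twirl d N U \<rho>) k k' k k') =
     (\<Sum>k<d. \<Sum>k'<d. \<Sum>x\<in>{..<d} \<times> {..<d}. \<Sum>y\<in>{..<d} \<times> {..<d}.
        U (k, fst x) * cnj (U (k', snd x)) * (cnj (U (k, fst y)) * U (k', snd y)) * ?g (fst x) (snd x) (fst y) (snd y))"
    using assms by (simp add: pair_coeff_twirl sum.cartesian_product')
  also have "\<dots> = (\<Sum>x\<in>{..<d} \<times> {..<d}. \<Sum>y\<in>{..<d} \<times> {..<d}. \<Sum>k<d. \<Sum>k'<d.
        U (k, fst x) * cnj (U (k', snd x)) * (cnj (U (k, fst y)) * U (k', snd y)) * ?g (fst x) (snd x) (fst y) (snd y))"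
    by (rule sum4_swap)
  also have "\<dots> = (\<Sum>x\<in>{..<d} \<times> {..<d}. \<Sum>y\<in>{..<d} \<times> {..<d}. if y = x then ?g (fst x) (snd x) (fst y) (snd y) else 0)"
  proof (intro sum.cong refl)
    fix x y assume xy: "x \<in> {..<d} \<times> {..<d}" "y \<in> {..<d} \<times> {..<d}"
    let ?G = "?g (fst x) (snd x) (fst y) (snd y)"
    have "(\<Sum>k<d. \<Sum>k'<d. U (k, fst x) * cnj (U (k', snd x)) * (cnj (U (k, fst y)) * U (k', snd y)) * ?G)
       = (\<Sum>k<d. cnj (U (k, fst y)) * U (k, fst x)) * ((\<Sum>k'<d. cnj (U (k', snd x)) * U (k', snd y)) * ?G)"
      unfolding sum_distrib_right unfolding sum_distrib_left by (intro sum.cong refl) (simp only: ac_simps)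
    also have "\<dots> = (if y = x then ?G else 0)"
      using assms(3) xy by (auto simp: isometry_def prod_eq_iff)
    finally show "(\<Sum>k<d. \<Sum>k'<d. U (k, fst x) * cnj (U (k', snd x)) * (cnj (U (k, fst y)) * U (k', snd y)) * ?G)
      = (if y = x then ?G else 0)" .
  qed
  also have "\<dots> = (\<Sum>x\<in>{..<d} \<times> {..<d}. ?g (fst x) (snd x) (fst x) (snd x))"
    by (intro sum.cong refl) (simp add: sum.delta)
  also have "\<dots> = (\<Sum>k<d. \<Sum>k'<d. ?g k k' k k')"
    by (simp add: sum.cartesian_product')
  finally show ?thesis by (simp only: trace_prod_omega[OF assms(1,2)])
qed

text \<open>The Kraus form of the map that traces out factor \<open>i\<close> and puts the maximally
  mixed state in its place.\<close>

definition depolarise :: "nat \<Rightarrow> nat \<Rightarrow> nat \<Rightarrow> (nat \<times> nat \<Rightarrow> complex) \<Rightarrow> nat \<times> nat \<Rightarrow> complex" where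
  "depolarise d n i \<rho> = (\<lambda>x. of_real (1 / real d) * (\<Sum>k<d. \<Sum>l<d.
     conj_by (d ^ n) (tensor_op d n (\<lambda>j. if j = i then unit_op k l else id_op)) \<rho> x))"

lemma tensor_op_upd:
  assumes "i < n"
  shows "tensor_op d n (M(i := X)) (a, b) = X (digit d i a, digit d i b) *
    (\<Prod>j\<in>{..<n} - {i}. M j (digit d j a, digit d j b))"
proof -
  have "tensor_op d n (M(i := X)) (a, b) = X (digit d i a, digit d i b) *
    (\<Prod>j\<in>{..<n} - {i}. (M(i := X)) j (digit d j a, digit d j b))"
    unfolding tensor_op_def prod.case using assms by (subst prod.remove[of _ i]) auto
  then show ?thesis by simp
qed

lemma trace_prod_depolarise:
  assumes "0 < d" "i < n"
  shows "trace_prod (d ^ n) (depolarise d n i \<rho>) (tensor_op d n M)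
       = of_real (1 / real d) * (\<Sum>k<d. M i (k, k)) * trace_prod (d ^ n) \<rho> (tensor_op d n (M(i := id_op)))"
proof -
  have "trace_prod (d ^ n) (depolarise d n i \<rho>) (tensor_op d n M) = of_real (1 / real d) *
      (\<Sum>k<d. \<Sum>l<d. trace_prod (d ^ n) \<rho> (tensor_op d n
         (\<lambda>j. conj_by d (adj (if j = i then unit_op k l else id_op)) (M j))))"
    unfolding depolarise_def
    by (simp only: trace_prod_scale_left trace_prod_sum_left trace_prod_conj_tensor[OF assms(1)])
  also have "\<dots> = of_real (1 / real d) *
      (\<Sum>k<d. \<Sum>l<d. trace_prod (d ^ n) \<rho> (tensor_op d n (M(i := \<lambda>x. M i (k, k) * unit_op l l x))))"
    using assms(1) by (intro arg_cong2[where f = "(*)"] sum.cong refl arg_cong[where f = "trace_prod _ _"] tensor_op_cong)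
      (auto simp: conj_by_adj_unit_op conj_by_adj_id_op)
  also have "(\<Sum>k<d. \<Sum>l<d. trace_prod (d ^ n) \<rho> (tensor_op d n (M(i := \<lambda>x. M i (k, k) * unit_op l l x))))
    = (\<Sum>k<d. trace_prod (d ^ n) \<rho> (\<lambda>x. M i (k, k) * tensor_op d n (M(i := id_op)) x))"
  proof (rule sum.cong)
    fix k assume "k \<in> {..<d}"
    have "(\<Sum>l<d. tensor_op d n (M(i := \<lambda>x. M i (k, k) * unit_op l l x)) (a, b))
        = M i (k, k) * tensor_op d n (M(i := id_op)) (a, b)" for a b
    proof -
      have "(\<Sum>l<d. unit_op l l (digit d i a, digit d i b)) = id_op (digit d i a, digit d i b)"
      proof -
        have "(\<Sum>l<d. unit_op l l (digit d i a, digit d i b))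
            = (\<Sum>l<d. if l = digit d i a then id_op (digit d i a, digit d i b) else 0)"
          by (intro sum.cong) (auto)
        then show ?thesis using digit_less[OF assms(1)] by simp
      qed
      then show ?thesis
        unfolding tensor_op_upd[OF assms(2)]
        by (simp only: mult.assoc flip: sum_distrib_left sum_distrib_right)
    qed
    then show "(\<Sum>l<d. trace_prod (d ^ n) \<rho> (tensor_op d n (M(i := \<lambda>x. M i (k, k) * unit_op l l x))))
      = trace_prod (d ^ n) \<rho> (\<lambda>x. M i (k, k) * tensor_op d n (M(i := id_op)) x)"
      by (subst trace_prod_sum_right[symmetric], intro trace_prod_cong) auto
  qed simp
  finally show ?thesis by (simp add: trace_prod_scale_right sum_distrib_right)
qed

lemma state_depolarise:
  assumes "0 < d" "i < n" "state (d ^ n) \<rho>"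
  shows "state (d ^ n) (depolarise d n i \<rho>)"
proof -
  have "psd (d ^ n) (depolarise d n i \<rho>)"
    unfolding depolarise_def using assms(3) by (intro psd_scale psd_sum psd_conj_by) (auto simp: state_def)
  moreover have "(\<Sum>a<d ^ n. depolarise d n i \<rho> (a, a)) = 1"
  proof -
    have "(\<lambda>_. id_op)(i := id_op) = (\<lambda>_. id_op)" by auto
    then show ?thesis
      using trace_prod_depolarise[OF assms(1,2), of \<rho> "\<lambda>_. id_op"] assms
      by (simp add: trace_prod_tensor_id state_def)
  qed
  ultimately show ?thesis by (simp add: state_def)
qed

text \<open>The partial trace of \<omega> over factor \<open>i\<close> is the identity on factor
  \<open>0\<close>, so besides the prefactor \<open>1 / d\<close> only the trace of the state
  remains.\<close>

lemma trace_prod_omega_depolarise_same: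
  assumes "0 < d" "i \<in> {1..N}" "state (d ^ (N + 1)) \<rho>"
  shows "trace_prod (d ^ (N + 1)) (depolarise d (N + 1) i \<rho>) (($$) (omega_0i d N i)) = of_real (1 / real d)"
proof -
  have upd: "(pair_op i A B)(i := id_op) = pair_op i A id_op" for A B
    using assms(2) by (auto simp: pair_op_def)
  have i: "i < N + 1" "pair_op i A B i = B" for A B using assms(2) by (auto simp: pair_op_def)
  have tr: "(\<Sum>m<d. unit_op k l (m, m)) = id_op (k, l)" if "k < d" for k l
  proof -
    have "(\<Sum>m<d. unit_op k l (m, m)) = (\<Sum>m<d. if m = k then id_op (k, l) else 0)"
      by (intro sum.cong) (auto)
    then show ?thesis using that by simp
  qed
  have "trace_prod (d ^ (N + 1)) (depolarise d (N + 1) i \<rho>) (($$) (omega_0i d N i))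
     = (\<Sum>k<d. \<Sum>l<d. of_real (1 / real d) * (id_op (k, l) *
         trace_prod (d ^ (N + 1)) \<rho> (tensor_op d (N + 1) (pair_op i (unit_op k l) id_op))))"
    unfolding trace_prod_omega[OF assms(1,2)] pair_coeff_def trace_prod_depolarise[OF assms(1) i(1)] upd i(2)
    by (intro sum.cong refl) (simp only: tr lessThan_iff mult.assoc)
  also have "\<dots> = of_real (1 / real d) * (\<Sum>k<d. trace_prod (d ^ (N + 1)) \<rho> (tensor_op d (N + 1) (pair_op i (unit_op k k) id_op)))"
    by (simp only: sum_id_op flip: sum_distrib_left)
  also have "(\<Sum>k<d. trace_prod (d ^ (N + 1)) \<rho> (tensor_op d (N + 1) (pair_op i (unit_op k k) id_op)))
      = (\<Sum>k<d. \<Sum>l<d. pair_coeff d N i \<rho> k k l l)"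
  proof (rule sum.cong)
    fix k assume k: "k \<in> {..<d}"
    have "trace_prod (d ^ (N + 1)) \<rho> (tensor_op d (N + 1) (pair_op i (unit_op k k) id_op)) =
       (\<Sum>m<d. \<Sum>m'<d. (\<Sum>l<d. pair_coeff d N i \<rho> m m' l l) * unit_op m m' (k, k))"
    proof -
      have "(\<Sum>l<d. \<Sum>l'<d. unit_op k k (m, m') * id_op (l, l') * pair_coeff d N i \<rho> m m' l l')
          = (\<Sum>l<d. pair_coeff d N i \<rho> m m' l l) * unit_op m m' (k, k)" for m m'
      proof -
        have "unit_op k k (m, m') = unit_op m m' (k, k)" by auto
        then show ?thesis
          by (simp only: mult.assoc sum_id_op flip: sum_distrib_left) (simp only: mult.commute)
      qed
      then show ?thesis by (simp only: trace_prod_pair[OF assms(1,2)])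
    qed
    then show "trace_prod (d ^ (N + 1)) \<rho> (tensor_op d (N + 1) (pair_op i (unit_op k k) id_op))
        = (\<Sum>l<d. pair_coeff d N i \<rho> k k l l)"
      using sum_unit_op[of k d k "\<lambda>(m, m'). \<Sum>l<d. pair_coeff d N i \<rho> m m' l l"] k by simp
  qed simp
  finally show ?thesis
    using assms(3) unfolding sum_pair_coeff_diag[OF assms(1,2)] state_def by simp
qed

text \<open>\<open>omega_0i d N m\<close> is the identity on factor \<open>i\<close>, and the dual
  of depolarising fixes the identity.\<close>

lemma trace_prod_omega_depolarise_other:
  assumes "0 < d" "i \<in> {1..N}" "m \<in> {1..N}" "m \<noteq> i"
  shows "trace_prod (d ^ (N + 1)) (depolarise d (N + 1) i \<rho>) (($$) (omega_0i d N m))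
    = trace_prod (d ^ (N + 1)) \<rho> (($$) (omega_0i d N m))"
proof -
  have "(pair_op m A B)(i := id_op) = pair_op m A B" "i < N + 1" "pair_op m A B i = id_op" for A B
    using assms by (auto simp: pair_op_def)
  note upd = this
  show ?thesis
    unfolding trace_prod_omega[OF assms(1,3)] pair_coeff_def trace_prod_depolarise[OF assms(1) upd(2)] upd(1,3)
    using assms(1) by simp
qed

section \<open>States invariant under the symmetry group\<close>

definition overlap :: "nat \<Rightarrow> nat \<Rightarrow> nat \<Rightarrow> (nat \<times> nat \<Rightarrow> complex) \<Rightarrow> real" where
  "overlap d N i \<rho> = Re (trace_prod (d ^ (N + 1)) \<rho> (($$) (omega_0i d N i)))"

lemma trace_prod_S_mat:
  "Re (trace_prod (d ^ (N + 1)) \<rho> (($$) (S_mat d N x))) = (\<Sum>i\<in>{1..N}. \<bar>x i\<bar> * overlap d N i \<rho>)"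
proof -
  have "trace_prod (d ^ (N + 1)) \<rho> (($$) (S_mat d N x)) =
      trace_prod (d ^ (N + 1)) \<rho> (\<lambda>y. \<Sum>i\<in>{1..N}. of_real \<bar>x i\<bar> * omega_0i d N i $$ y)"
    by (rule trace_prod_cong) (auto simp: S_mat_def)
  also have "\<dots> = (\<Sum>i\<in>{1..N}. of_real \<bar>x i\<bar> * trace_prod (d ^ (N + 1)) \<rho> (($$) (omega_0i d N i)))"
    by (simp only: trace_prod_sum_right trace_prod_scale_right)
  finally show ?thesis by (simp add: overlap_def)
qed

lemma omega_0i_symmetric:
  "a < d ^ (N + 1) \<Longrightarrow> b < d ^ (N + 1) \<Longrightarrow> omega_0i d N i $$ (a, b) = omega_0i d N i $$ (b, a)"
  by (auto simp: omega_0i_def)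

lemma omega_0i_cnj:
  "a < d ^ (N + 1) \<Longrightarrow> b < d ^ (N + 1) \<Longrightarrow> cnj (omega_0i d N i $$ (a, b)) = omega_0i d N i $$ (a, b)"
  by (auto simp: omega_0i_def)

lemma hermitian_omega_0i: "hermitian_on (d ^ (N + 1)) (($$) (omega_0i d N i))"
  unfolding hermitian_on_def by (metis omega_0i_symmetric omega_0i_cnj)

lemma hermitian_S_mat: "hermitian_on (d ^ (N + 1)) (($$) (S_mat d N x))"
  unfolding hermitian_on_def
proof (intro allI impI)
  fix a b assume ab: "a < d ^ (N + 1)" "b < d ^ (N + 1)"
  then show "S_mat d N x $$ (a, b) = cnj (S_mat d N x $$ (b, a))"
    unfolding S_mat_def using omega_0i_cnj[OF ab(2,1)] omega_0i_symmetric[OF ab]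
    by simp
qed

text \<open>In convex terms, \<open>lambda_max (S_mat d N x)\<close> is the support function, in the
  direction of the absolute values of \<open>x\<close>, of the set of overlap vectors of states.
  This is the form in which a separation argument can use it.\<close>

lemma S_mat_variational:
  assumes "0 < d"
  shows "state (d ^ (N + 1)) \<rho> \<Longrightarrow> (\<Sum>i\<in>{1..N}. \<bar>x i\<bar> * overlap d N i \<rho>) \<le> lambda_max (S_mat d N x)"
    and "\<exists>\<rho>. state (d ^ (N + 1)) \<rho> \<and> (\<Sum>i\<in>{1..N}. \<bar>x i\<bar> * overlap d N i \<rho>) = lambda_max (S_mat d N x)"
proof -
  have S: "S_mat d N x \<in> carrier_mat (d ^ (N + 1)) (d ^ (N + 1))" by (simp add: S_mat_def)
  have "0 < d ^ (N + 1)" using assms by simp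
  note * = lambda_max_variational[OF S hermitian_S_mat this, unfolded trace_prod_S_mat]
  show "state (d ^ (N + 1)) \<rho> \<Longrightarrow> (\<Sum>i\<in>{1..N}. \<bar>x i\<bar> * overlap d N i \<rho>) \<le> lambda_max (S_mat d N x)"
    by (rule *(1))
  show "\<exists>\<rho>. state (d ^ (N + 1)) \<rho> \<and> (\<Sum>i\<in>{1..N}. \<bar>x i\<bar> * overlap d N i \<rho>) = lambda_max (S_mat d N x)"
    by (rule *(2))
qed

lemma overlap_convex:
  "overlap d N i (\<lambda>x. of_real (1 - s) * \<rho> x + of_real s * \<sigma> x)
     = (1 - s) * overlap d N i \<rho> + s * overlap d N i \<sigma>"
  unfolding overlap_def trace_prod_add_left trace_prod_scale_left by simp

lemma continuous_overlap: "continuous_on UNIV (overlap d N i)"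
  unfolding overlap_def[abs_def] by (intro continuous_intros continuous_trace_prod)

lemma overlap_restrict: "overlap d N i (restrict_entries (d ^ (N + 1)) \<rho>) = overlap d N i \<rho>"
  by (simp only: overlap_def trace_prod_restrict)

text \<open>The residual \<open>x\<close> of the best approximation of \<open>q\<close> by the overlaps of a state is a separating
  functional: it is nonnegative because depolarising factor \<open>i\<close> lowers the \<open>i\<close>-th overlap to \<open>1/d\<close>
  without changing the others, and so the hypothesis forces \<open>x = 0\<close>.\<close>

lemma exists_state_with_overlaps:
  assumes "0 < d"
    and q: "\<And>i. i \<in> {1..N} \<Longrightarrow> 1 / real d \<le> q i"
    and sep: "\<And>x. (\<And>i. i \<in> {1..N} \<Longrightarrow> 0 \<le> x i) \<Longrightarrow> (\<exists>i\<in>{1..N}. x i \<noteq> 0) \<Longrightarrow>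
               (\<Sum>i\<in>{1..N}. x i * q i) \<le> lambda_max (S_mat d N x)"
  obtains \<rho> where "state (d ^ (N + 1)) \<rho>" "\<And>i. i \<in> {1..N} \<Longrightarrow> overlap d N i \<rho> = q i"
proof -
  define f where "f \<rho> = (\<Sum>i\<in>{1..N}. (q i - overlap d N i \<rho>)\<^sup>2)" for \<rho>
  obtain \<rho> where \<rho>: "state (d ^ (N + 1)) \<rho>" and min: "\<And>\<sigma>. state (d ^ (N + 1)) \<sigma> \<Longrightarrow> f \<rho> \<le> f \<sigma>"
  proof (rule state_minimiser_exists[of f UNIV "d ^ (N + 1)"])
    show "continuous_on UNIV f"
      unfolding f_def by (intro continuous_intros continuous_overlap)
    show "f (restrict_entries (d ^ (N + 1)) \<rho>) = f \<rho>" for \<rho>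
      by (simp only: f_def overlap_restrict)
    show "state (d ^ (N + 1)) (\<lambda>(a, b). (if a = 0 then 1 else 0) * cnj (if b = 0 then 1 else 0))"
      using assms(1) by (intro state_first_basis) simp
  qed auto
  define x where "x i = q i - overlap d N i \<rho>" for i
  \<comment> \<open>The obtuse angle at a nearest point: moving from \<open>\<rho>\<close> towards
    \<open>\<sigma>\<close> cannot decrease the distance to \<open>q\<close>.\<close>
  have var: "(\<Sum>i\<in>{1..N}. x i * (overlap d N i \<sigma> - overlap d N i \<rho>)) \<le> 0"
    if \<sigma>: "state (d ^ (N + 1)) \<sigma>" for \<sigma>
  proof (rule nonneg_quadratic_imp_linear_nonpos)
    fix s :: real assume s: "0 < s" "s \<le> 1"
    let ?y = "\<lambda>i. overlap d N i \<sigma> - overlap d N i \<rho>"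
    have "f \<rho> \<le> f (\<lambda>x. of_real (1 - s) * \<rho> x + of_real s * \<sigma> x)"
      using s by (intro min state_convex \<rho> \<sigma>) auto
    also have "\<dots> = (\<Sum>i\<in>{1..N}. (x i - s * ?y i)\<^sup>2)"
      unfolding f_def overlap_convex x_def by (intro sum.cong refl arg_cong[where f = "\<lambda>z. z\<^sup>2"]) (simp add: algebra_simps)
    also have "\<dots> = f \<rho> + s\<^sup>2 * (\<Sum>i\<in>{1..N}. (?y i)\<^sup>2) - 2 * s * (\<Sum>i\<in>{1..N}. x i * ?y i)"
      unfolding f_def sum_distrib_left x_def[symmetric] sum.distrib[symmetric] sum_subtractf[symmetric]
      by (intro sum.cong refl) (simp add: power2_eq_square algebra_simps)
    finally show "0 \<le> s\<^sup>2 * (\<Sum>i\<in>{1..N}. (?y i)\<^sup>2) - 2 * s * (\<Sum>i\<in>{1..N}. x i * ?y i)" by simp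
  qed
  have nonneg: "0 \<le> x i" if i: "i \<in> {1..N}" for i
  proof (rule ccontr)
    assume neg: "\<not> 0 \<le> x i"
    let ?\<sigma> = "depolarise d (N + 1) i \<rho>"
    have "i < N + 1" using i by simp
    then have "(\<Sum>m\<in>{1..N}. x m * (overlap d N m ?\<sigma> - overlap d N m \<rho>)) \<le> 0"
      using \<open>0 < d\<close> \<rho> by (intro var state_depolarise)
    moreover have "(\<Sum>m\<in>{1..N}. x m * (overlap d N m ?\<sigma> - overlap d N m \<rho>))
        = (\<Sum>m\<in>{1..N}. if m = i then x i * (1 / real d - overlap d N i \<rho>) else 0)"
      using trace_prod_omega_depolarise_same[OF \<open>0 < d\<close> i \<rho>] trace_prod_omega_depolarise_other[OF \<open>0 < d\<close> i]
      by (intro sum.cong) (auto simp: overlap_def simp del: power_Suc)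
    ultimately have "x i * (1 / real d - overlap d N i \<rho>) \<le> 0" using i by simp
    then have "overlap d N i \<rho> \<le> 1 / real d"
      using neg by (simp add: mult_le_0_iff not_le)
    then show False using q[OF i] neg by (simp add: x_def)
  qed
  have "x i = 0" if "i \<in> {1..N}" for i
  proof (rule ccontr)
    assume "x i \<noteq> 0"
    obtain \<sigma> where \<sigma>: "state (d ^ (N + 1)) \<sigma>"
        "(\<Sum>i\<in>{1..N}. \<bar>x i\<bar> * overlap d N i \<sigma>) = lambda_max (S_mat d N x)"
      using S_mat_variational(2)[OF \<open>0 < d\<close>] by blast
    \<comment> \<open>Here \<open>\<sigma>\<close> attains the support function in direction
      \<open>x\<close>. The pairing of \<open>x\<close> with \<open>q\<close> is at most that with
      the overlaps of \<open>\<sigma>\<close>, which by \<open>var\<close> is at most that with the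
      overlaps of \<open>\<rho>\<close>. But the first exceeds the last by the sum of the squares of
      \<open>x\<close>.\<close>
    have "(\<Sum>i\<in>{1..N}. x i * q i) \<le> (\<Sum>i\<in>{1..N}. \<bar>x i\<bar> * overlap d N i \<sigma>)"
      unfolding \<sigma>(2) using nonneg \<open>x i \<noteq> 0\<close> that by (intro sep) auto
    also have "\<dots> = (\<Sum>i\<in>{1..N}. x i * overlap d N i \<sigma>)"
      using nonneg by (intro sum.cong) auto
    finally have "(\<Sum>i\<in>{1..N}. x i * q i) \<le> (\<Sum>i\<in>{1..N}. x i * overlap d N i \<sigma>)" .
    moreover have "(\<Sum>i\<in>{1..N}. x i * x i) = (\<Sum>i\<in>{1..N}. x i * q i) - (\<Sum>i\<in>{1..N}. x i * overlap d N i \<rho>)"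
      unfolding sum_subtractf[symmetric] by (intro sum.cong refl) (simp add: x_def algebra_simps)
    moreover have "(\<Sum>i\<in>{1..N}. x i * overlap d N i \<sigma>) - (\<Sum>i\<in>{1..N}. x i * overlap d N i \<rho>) \<le> 0"
      using var[OF \<sigma>(1)] by (simp add: right_diff_distrib sum_subtractf)
    ultimately have "(\<Sum>i\<in>{1..N}. x i * x i) \<le> 0" by linarith
    moreover have "0 < (\<Sum>i\<in>{1..N}. x i * x i)"
      using that \<open>x i \<noteq> 0\<close> by (intro sum_pos2[where i = i]) (auto simp: zero_less_mult_iff)
    ultimately show False by simp
  qed
  then show ?thesis using \<rho> that[of \<rho>] by (simp add: x_def)
qed

text \<open>The parallelogram law, summed over the entries. The weight is written
  \<open>1 - 1 / 2\<close> so that \<open>state_convex\<close> and \<open>overlap_convex\<close>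
  apply to the same expression with \<open>s = 1 / 2\<close>.\<close>

lemma hs_norm_midpoint:
  "hs_norm n (\<lambda>x. of_real (1 - 1 / 2) * A x + of_real (1 / 2) * B x)
     = (hs_norm n A + hs_norm n B) / 2 - hs_norm n (\<lambda>x. A x - B x) / 4"
proof -
  have "(cmod (of_real (1 - 1 / 2) * u + of_real (1 / 2) * v))\<^sup>2
      = ((cmod u)\<^sup>2 + (cmod v)\<^sup>2) / 2 - (cmod (u - v))\<^sup>2 / 4" for u v
    unfolding cmod_power2 by (simp add: power2_eq_square field_simps)
  then show ?thesis
    unfolding hs_norm_def
    by (simp only: sum.distrib sum_subtractf flip: sum_divide_distrib)
qed

lemma hs_norm_zero_imp:
  assumes "hs_norm n A \<le> 0" "a < n" "b < n"
  shows "A (a, b) = 0"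
proof -
  have "hs_norm n A = 0" using assms(1) by (simp add: hs_norm_def order_antisym sum_nonneg)
  then have "(\<Sum>b<n. (cmod (A (a, b)))\<^sup>2) = 0"
    using assms(2) unfolding hs_norm_def by (subst (asm) sum_nonneg_eq_0_iff) (auto intro: sum_nonneg)
  then show ?thesis using assms(3) by (subst (asm) sum_nonneg_eq_0_iff) auto
qed

text \<open>Minimality of the Hilbert-Schmidt norm replaces averaging over the Haar measure: the norm is
  strictly convex and unitarily invariant, so the minimiser is fixed by the symmetry group.\<close>

lemma exists_twirl_invariant_state:
  assumes "0 < d" "state (d ^ (N + 1)) \<sigma>" "\<And>i. i \<in> {1..N} \<Longrightarrow> overlap d N i \<sigma> = q i"
  obtains \<rho> where "state (d ^ (N + 1)) \<rho>" "\<And>i. i \<in> {1..N} \<Longrightarrow> overlap d N i \<rho> = q i"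
    "\<And>U a b. isometry d U \<Longrightarrow> a < d ^ (N + 1) \<Longrightarrow> b < d ^ (N + 1) \<Longrightarrow> twirl d N U \<rho> (a, b) = \<rho> (a, b)"
proof -
  let ?n = "d ^ (N + 1)"
  define C where "C = {\<rho>. \<forall>i\<in>{1..N}. overlap d N i \<rho> = q i}"
  have "C = (\<Inter>i\<in>{1..N}. {\<rho>. overlap d N i \<rho> = q i})" by (auto simp: C_def)
  then have "closed C"
    by (auto intro!: closed_INT closed_Collect_eq continuous_overlap continuous_intros)
  obtain \<rho> where \<rho>: "state ?n \<rho>" "\<rho> \<in> C"
    and min: "\<And>\<sigma>. state ?n \<sigma> \<Longrightarrow> \<sigma> \<in> C \<Longrightarrow> hs_norm ?n \<rho> \<le> hs_norm ?n \<sigma>"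
  proof (rule state_minimiser_exists[of "hs_norm ?n" C ?n \<sigma>])
    show "continuous_on UNIV (hs_norm ?n)"
      unfolding hs_norm_def[abs_def] by (intro continuous_intros continuous_entry)
    show "hs_norm ?n (restrict_entries ?n \<rho>) = hs_norm ?n \<rho>" for \<rho>
      by (simp add: hs_norm_def restrict_entries_def)
    show "restrict_entries ?n \<rho> \<in> C" if "\<rho> \<in> C" for \<rho>
      using that unfolding C_def mem_Collect_eq overlap_restrict .
    show "\<sigma> \<in> C" using assms(3) by (simp add: C_def)
  qed (use \<open>closed C\<close> assms in auto)
  have inv: "twirl d N U \<rho> (a, b) = \<rho> (a, b)" if U: "isometry d U" and ab: "a < ?n" "b < ?n" for U a b
  proof -
    let ?\<tau> = "twirl d N U \<rho>"
    let ?m = "\<lambda>x. of_real (1 - 1 / 2) * ?\<tau> x + of_real (1 / 2) * \<rho> x"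
    have "overlap d N i ?\<tau> = overlap d N i \<rho>" if "i \<in> {1..N}" for i
      unfolding overlap_def trace_prod_omega_twirl[OF assms(1) that U] ..
    then have "overlap d N i ?m = q i" if "i \<in> {1..N}" for i
      using that \<rho>(2) unfolding overlap_convex by (simp add: C_def)
    then have "?m \<in> C" by (simp add: C_def)
    moreover have "state ?n ?m"
      using assms(1) U \<rho> by (intro state_convex state_twirl) auto
    ultimately have "hs_norm ?n \<rho> \<le> hs_norm ?n ?m" by (intro min)
    \<comment> \<open>Both endpoints have the same norm, so the midpoint would be strictly shorter
      unless they agree on the block.\<close>
    then have "hs_norm ?n (\<lambda>x. ?\<tau> x - \<rho> x) \<le> 0"
      unfolding hs_norm_midpoint hs_norm_twirl[OF assms(1) U] by simp
    from hs_norm_zero_imp[OF this ab] show ?thesis by simp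
  qed
  then show ?thesis using \<rho> that[of \<rho>] by (simp only: C_def mem_Collect_eq)
qed

lemma trace_prod_hermitian_real:
  assumes "hermitian_on n A" "hermitian_on n B"
  shows "trace_prod n A B = of_real (Re (trace_prod n A B))"
proof -
  have "cnj (trace_prod n A B) = (\<Sum>a<n. \<Sum>b<n. A (b, a) * B (a, b))"
    unfolding trace_prod_def cnj_sum complex_cnj_mult
    by (intro sum.cong refl arg_cong2[where f = "(*)"])
      (use assms in \<open>simp_all add: hermitian_onD[of n, symmetric]\<close>)
  also have "\<dots> = trace_prod n A B" unfolding trace_prod_def by (rule sum.swap)
  finally show ?thesis by (simp add: complex_eq_iff)
qed

section \<open>Unitaries that force the isotropic form\<close>

definition monomial_op :: "(nat \<Rightarrow> nat) \<Rightarrow> (nat \<Rightarrow> complex) \<Rightarrow> nat \<times> nat \<Rightarrow> complex" where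
  "monomial_op \<pi> u = (\<lambda>(k, m). if m = \<pi> k then u k else 0)"

text \<open>An involution is its own inverse, so the one nonzero entry of column \<open>m\<close>
  sits in row \<open>\<pi> m\<close>. The identity and transpositions are the cases applied
  later.\<close>

lemma isometry_monomial_op:
  assumes "\<And>a. a < d \<Longrightarrow> \<pi> a < d" "\<And>a. \<pi> (\<pi> a) = a" "\<And>a. cmod (u a) = 1"
  shows "isometry d (monomial_op \<pi> u)"
  unfolding isometry_def
proof (intro allI impI)
  fix k l assume kl: "k < d" "l < d"
  have eq: "m = \<pi> a \<longleftrightarrow> a = \<pi> m" for a m using assms(2) by metis
  have "cnj (u a) * u a = 1" for a
    using assms(3)[of a] complex_norm_square[of "u a"] by (simp add: mult.commute)
  then have "(\<Sum>a<d. cnj (monomial_op \<pi> u (a, k)) * monomial_op \<pi> u (a, l)) =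
     (\<Sum>a<d. if a = \<pi> k then if k = l then 1 else 0 else 0)"
    unfolding monomial_op_def prod.case eq[of k] eq[of l] using assms(2)
    by (intro sum.cong refl) (auto, metis)
  also have "\<dots> = id_op (k, l)" using assms(1)[OF kl(1)] by simp
  finally show "(\<Sum>a<d. cnj (monomial_op \<pi> u (a, k)) * monomial_op \<pi> u (a, l)) = id_op (k, l)" .
qed

definition swap_nat :: "nat \<Rightarrow> nat \<Rightarrow> nat \<Rightarrow> nat" where
  "swap_nat a b x = (if x = a then b else if x = b then a else x)"

text \<open>A Hadamard matrix on the first two basis vectors, the identity on the others.\<close>

definition mixing_op :: "nat \<times> nat \<Rightarrow> complex" where
  "mixing_op = (\<lambda>(k, m). if k < 2 \<and> m < 2 then (if k = 1 \<and> m = 1 then - of_real (sqrt (1 / 2)) else of_real (sqrt (1 / 2)))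
     else if k = m then 1 else 0)"

lemma half_sqrt_square: "of_real (sqrt (1 / 2)) * of_real (sqrt (1 / 2)) = (1 / 2 :: complex)"
proof -
  have "of_real (sqrt (1 / 2)) * of_real (sqrt (1 / 2)) = (of_real (1 / 2) :: complex)"
    by (simp only: real_sqrt_mult_self flip: of_real_mult) simp
  then show ?thesis by simp
qed

lemma sum_split_two:
  fixes f :: "nat \<Rightarrow> complex"
  assumes "2 \<le> d"
  shows "(\<Sum>a<d. f a) = f 0 + f 1 + (\<Sum>a\<in>{2..<d}. f a)"
proof -
  have "{..<d} = insert 0 (insert 1 {2..<d})" using assms by auto
  then show ?thesis by (simp add: add.assoc)
qed

lemma isometry_mixing_op:
  assumes "2 \<le> d"
  shows "isometry d mixing_op"
  unfolding isometry_def
proof (intro allI impI)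
  fix k l assume kl: "k < d" "l < d"
  have rest: "(\<Sum>a\<in>{2..<d}. cnj (mixing_op (a, k)) * mixing_op (a, l)) = (if k = l \<and> 2 \<le> k then 1 else 0)"
  proof -
    have "(\<Sum>a\<in>{2..<d}. cnj (mixing_op (a, k)) * mixing_op (a, l)) =
        (\<Sum>a\<in>{2..<d}. if a = k then if k = l then 1 else 0 else 0)"
      by (intro sum.cong refl) (auto simp: mixing_op_def)
    then show ?thesis using kl by auto
  qed
  have "k = 0 \<or> k = 1 \<or> 2 \<le> k" "l = 0 \<or> l = 1 \<or> 2 \<le> l" by auto
  then show "(\<Sum>a<d. cnj (mixing_op (a, k)) * mixing_op (a, l)) = id_op (k, l)"
    unfolding sum_split_two[OF assms] rest
    by (elim disjE) (simp_all add: mixing_op_def half_sqrt_square)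
qed

lemma sum_mixing_op_row:
  assumes "2 \<le> d"
  shows "(\<Sum>m<d. mixing_op (0, m) * f m) = of_real (sqrt (1 / 2)) * (f 0 + f 1)"
    and "(\<Sum>m<d. cnj (mixing_op (0, m)) * f m) = of_real (sqrt (1 / 2)) * (f 0 + f 1)"
proof -
  have "(\<Sum>m\<in>{2..<d}. mixing_op (0, m) * f m) = 0" "(\<Sum>m\<in>{2..<d}. cnj (mixing_op (0, m)) * f m) = 0"
    by (intro sum.neutral ballI; simp add: mixing_op_def)+
  then show "(\<Sum>m<d. mixing_op (0, m) * f m) = of_real (sqrt (1 / 2)) * (f 0 + f 1)"
    "(\<Sum>m<d. cnj (mixing_op (0, m)) * f m) = of_real (sqrt (1 / 2)) * (f 0 + f 1)"
    unfolding sum_split_two[OF assms] by (simp_all add: mixing_op_def algebra_simps)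
qed

text \<open>An elementary description of the commutant of all \<open>cnj U\<close> tensor
  \<open>U\<close>. Diagonal phases leave only two patterns of coinciding indices, transpositions
  make the coefficients constant, and the Hadamard matrix ties the value where both patterns hold to
  the sum of the other two.\<close>

lemma isotropic_form:
  fixes g :: "nat \<Rightarrow> nat \<Rightarrow> nat \<Rightarrow> nat \<Rightarrow> complex"
  assumes "2 \<le> d"
    and inv: "\<And>U k k' l l'. isometry d U \<Longrightarrow> k < d \<Longrightarrow> k' < d \<Longrightarrow> l < d \<Longrightarrow> l' < d \<Longrightarrow>
      g k k' l l' = (\<Sum>m<d. \<Sum>m'<d. \<Sum>n<d. \<Sum>n'<d.
         U (k, m) * cnj (U (k', m')) * (cnj (U (l, n)) * U (l', n')) * g m m' n n')"
  obtains c e where "\<And>k k' l l'. k < d \<Longrightarrow> k' < d \<Longrightarrow> l < d \<Longrightarrow> l' < d \<Longrightarrow>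
     g k k' l l' = (if k = l \<and> k' = l' then c else 0) + (if k = k' \<and> l = l' then e else 0)"
proof -
  have monomial: "g k k' l l' = u k * cnj (u k') * (cnj (u l) * u l') * g (\<pi> k) (\<pi> k') (\<pi> l) (\<pi> l')"
    if "\<And>a. a < d \<Longrightarrow> \<pi> a < d" "\<And>a. \<pi> (\<pi> a) = a" "\<And>a. cmod (u a) = 1" "k < d" "k' < d" "l < d" "l' < d"
    for k k' l l' \<pi> u
  proof -
    let ?G = "u k * cnj (u k') * (cnj (u l) * u l') * g (\<pi> k) (\<pi> k') (\<pi> l) (\<pi> l')"
    have "g k k' l l' = (\<Sum>m<d. \<Sum>m'<d. \<Sum>n<d. \<Sum>n'<d.
       monomial_op \<pi> u (k, m) * cnj (monomial_op \<pi> u (k', m')) *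
       (cnj (monomial_op \<pi> u (l, n)) * monomial_op \<pi> u (l', n')) * g m m' n n')"
      using that by (intro inv isometry_monomial_op)
    also have "\<dots> = (\<Sum>m<d. \<Sum>m'<d. \<Sum>n<d. \<Sum>n'<d.
       if n' = \<pi> l' then if n = \<pi> l then if m' = \<pi> k' then if m = \<pi> k then ?G else 0 else 0 else 0 else 0)"
      by (intro sum.cong refl) (auto simp: monomial_op_def)
    also have "\<dots> = ?G" using that by (simp add: sum.delta)
    finally show ?thesis .
  qed
  have phase: "g k k' l l' = 0"
    if kl: "k < d" "k' < d" "l < d" "l' < d" and off: "\<not> (k = k' \<and> l = l')" "\<not> (k = l \<and> k' = l')" for k k' l l'
  proof -
    \<comment> \<open>An index whose phases do not cancel: \<open>k\<close> and \<open>l'\<close>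
      carry \<open>u\<close>, while \<open>k'\<close> and \<open>l\<close> carry its conjugate. The
      phase is \<open>\<i>\<close> and not \<open>-1\<close> because \<open>s\<close> may equal both
      \<open>k\<close> and \<open>l'\<close>, where the square of the phase must still differ from
      \<open>1\<close>.\<close>
    define s where "s = (if k \<noteq> k' \<and> k \<noteq> l then k else l')"
    define u where "u a = (if a = s then \<i> else 1)" for a
    have "g k k' l l' = (u k * cnj (u k') * (cnj (u l) * u l')) * g k k' l l'"
      using monomial[of "\<lambda>a. a" u] kl by (simp add: u_def)
    moreover have "u k * cnj (u k') * (cnj (u l) * u l') \<noteq> 1"
      using off by (auto simp: u_def s_def complex_eq_iff)
    ultimately show ?thesis by (metis mult_cancel_right1 mult.commute)
  qed
  have swap: "g k k' l l' = g (swap_nat a b k) (swap_nat a b k') (swap_nat a b l) (swap_nat a b l')"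
    if "a < d" "b < d" "k < d" "k' < d" "l < d" "l' < d" for a b k k' l l'
    using monomial[of "swap_nat a b" "\<lambda>_. 1" k k' l l'] that by (simp add: swap_nat_def)
  define c where "c = g 0 1 0 1"
  define e where "e = g 0 0 1 1"
  have d: "0 < d" "1 < d" using assms(1) by auto
  \<comment> \<open>Two transpositions carry the pair \<open>(a, b)\<close> to
    \<open>(0, 1)\<close>: the first moves \<open>a\<close> to \<open>0\<close>, and
    \<open>?b\<close> is where \<open>b\<close> lands. The Booleans record which of the two values
    each index takes.\<close>
  have two: "g (if i then a else b) (if j then a else b) (if k then a else b) (if l then a else b) =
      g (if i then 0 else 1) (if j then 0 else 1) (if k then 0 else 1) (if l then 0 else 1)"
    if "a < d" "b < d" "a \<noteq> b" for a b and i j k l :: bool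
  proof -
    let ?b = "swap_nat 0 a b"
    have b: "?b < d" "?b \<noteq> 0" using that d by (auto simp: swap_nat_def)
    have "g (if i then a else b) (if j then a else b) (if k then a else b) (if l then a else b) =
        g (if i then 0 else ?b) (if j then 0 else ?b) (if k then 0 else ?b) (if l then 0 else ?b)"
      using that d by (subst swap[of 0 a]) (auto simp: swap_nat_def)
    also have "\<dots> = g (if i then 0 else 1) (if j then 0 else 1) (if k then 0 else 1) (if l then 0 else 1)"
      using b d by (subst swap[of 1 ?b]) (auto simp: swap_nat_def)
    finally show ?thesis .
  qed
  have diag: "g a a a a = g 0 0 0 0" if "a < d" for a
    using that d by (subst swap[of 0 a]) (auto simp: swap_nat_def)
  have "g 0 0 0 0 = c + e"
  proof -
    let ?h = "of_real (sqrt (1 / 2)) :: complex"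
    \<comment> \<open>Row \<open>0\<close> of \<open>mixing_op\<close> has two nonzero entries, both
      \<open>?h\<close>, and by \<open>phase\<close> six of the sixteen resulting coefficients
      survive. Four factors \<open>?h\<close> give \<open>1 / 4\<close>, so
      \<open>4 * g 0 0 0 0\<close> is twice the sum of \<open>g 0 0 0 0\<close>, \<open>c\<close>
      and \<open>e\<close>.\<close>
    have "g 0 0 0 0 = (\<Sum>m<d. \<Sum>m'<d. \<Sum>n<d. \<Sum>n'<d. mixing_op (0, m) * cnj (mixing_op (0, m')) *
        (cnj (mixing_op (0, n)) * mixing_op (0, n')) * g m m' n n')"
      using d by (intro inv isometry_mixing_op assms(1))
    also have "\<dots> = (\<Sum>m<d. mixing_op (0, m) * (\<Sum>m'<d. cnj (mixing_op (0, m')) *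
        (\<Sum>n<d. cnj (mixing_op (0, n)) * (\<Sum>n'<d. mixing_op (0, n') * g m m' n n'))))"
      by (simp only: sum_distrib_left mult.assoc)
    also have "\<dots> = (?h * ?h) * (?h * ?h) *
       (g 0 0 0 0 + g 1 1 1 1 + (g 0 0 1 1 + g 1 1 0 0) + (g 0 1 0 1 + g 1 0 1 0))"
      unfolding sum_mixing_op_row[OF assms(1)]
      using d by (simp add: phase algebra_simps)
    also have "g 1 1 1 1 = g 0 0 0 0" using d by (intro diag) auto
    also have "g 1 1 0 0 = e" unfolding e_def using two[of 1 0 True True False False] d by simp
    also have "g 1 0 1 0 = c" unfolding c_def using two[of 1 0 True False True False] d by simp
    finally have "2 * g 0 0 0 0 = 2 * (c + e)"
      unfolding half_sqrt_square c_def[symmetric] e_def[symmetric] by (simp add: field_simps)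
    then show ?thesis by (simp only: mult_cancel_left) simp
  qed
  show ?thesis
  proof (rule that[of c e])
    fix k k' l l' assume kl: "k < d" "k' < d" "l < d" "l' < d"
    consider "k = k'" "l = l'" "k = l" | "k = k'" "l = l'" "k \<noteq> l" | "k = l" "k' = l'" "k \<noteq> k'"
      | "\<not> (k = k' \<and> l = l')" "\<not> (k = l \<and> k' = l')" by blast
    then show "g k k' l l' = (if k = l \<and> k' = l' then c else 0) + (if k = k' \<and> l = l' then e else 0)"
    proof cases
      case 1
      then show ?thesis using diag[of k] kl \<open>g 0 0 0 0 = c + e\<close> by simp
    next
      case 2
      then show ?thesis using two[of k l True True False False] kl by (simp add: e_def)
    next
      case 3
      then show ?thesis using two[of k k' True False True False] kl by (simp add: c_def)
    next
      case 4
      then show ?thesis using phase kl by auto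
    qed
  qed
qed

text \<open>The isotropic form has two unknowns, and unit trace and prescribed overlap are two
  linear equations for them. Eliminating \<open>e\<close> leaves a factor
  \<open>d\<^sup>2 - 1\<close>, which is nonzero because \<open>d \<ge> 2\<close>.\<close>

lemma invariant_state_pair_coeff:
  assumes "2 \<le> d" "i \<in> {1..N}" "state (d ^ (N + 1)) \<rho>"
    and inv: "\<And>U a b. isometry d U \<Longrightarrow> a < d ^ (N + 1) \<Longrightarrow> b < d ^ (N + 1) \<Longrightarrow> twirl d N U \<rho> (a, b) = \<rho> (a, b)"
    and overlap: "overlap d N i \<rho> = (p * ((real d)\<^sup>2 - 1) + 1) / real d"
    and kl: "k < d" "k' < d" "l < d" "l' < d"
  shows "pair_coeff d N i \<rho> k k' l l' =
    (if k = l \<and> k' = l' then of_real (p / real d) else 0) + (if k = k' \<and> l = l' then of_real ((1 - p) / (real d)\<^sup>2) else 0)"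
proof -
  have "0 < d" using assms(1) by simp
  have "pair_coeff d N i \<rho> k k' l l' = (\<Sum>m<d. \<Sum>m'<d. \<Sum>n<d. \<Sum>n'<d.
       U (k, m) * cnj (U (k', m')) * (cnj (U (l, n)) * U (l', n')) * pair_coeff d N i \<rho> m m' n n')"
    if "isometry d U" "k < d" "k' < d" "l < d" "l' < d" for U k k' l l'
  proof -
    have "pair_coeff d N i \<rho> k k' l l' = pair_coeff d N i (twirl d N U \<rho>) k k' l l'"
      unfolding pair_coeff_def using inv[OF that(1)] by (intro trace_prod_cong) auto
    also note pair_coeff_twirl[OF \<open>0 < d\<close> assms(2) that]
    finally show ?thesis .
  qed
  then obtain c e where ce: "\<And>k k' l l'. k < d \<Longrightarrow> k' < d \<Longrightarrow> l < d \<Longrightarrow> l' < d \<Longrightarrow>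
     pair_coeff d N i \<rho> k k' l l' = (if k = l \<and> k' = l' then c else 0) + (if k = k' \<and> l = l' then e else 0)"
    using isotropic_form[OF assms(1), of "pair_coeff d N i \<rho>"] by blast
  have eq1: "of_nat d * c + (of_nat d)\<^sup>2 * e = 1"
  proof -
    have "(\<Sum>k<d. \<Sum>l<d. pair_coeff d N i \<rho> k k l l) = (\<Sum>k<d. \<Sum>l<d. (if k = l then c else 0) + e)"
      by (intro sum.cong refl) (simp add: ce)
    also have "\<dots> = of_nat d * c + (of_nat d)\<^sup>2 * e"
      by (simp add: sum.distrib power2_eq_square algebra_simps)
    finally show ?thesis
      using assms(3) unfolding sum_pair_coeff_diag[OF \<open>0 < d\<close> assms(2)] state_def by simp
  qed
  have eq2: "(of_nat d)\<^sup>2 * c + of_nat d * e = of_real ((p * ((real d)\<^sup>2 - 1) + 1) / real d)"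
  proof -
    have "(\<Sum>k<d. \<Sum>l<d. pair_coeff d N i \<rho> k l k l) = (\<Sum>k<d. \<Sum>l<d. c + (if k = l then e else 0))"
      by (intro sum.cong refl) (simp add: ce)
    also have "\<dots> = (of_nat d)\<^sup>2 * c + of_nat d * e"
      by (simp add: sum.distrib power2_eq_square algebra_simps)
    finally have "trace_prod (d ^ (N + 1)) \<rho> (($$) (omega_0i d N i)) = (of_nat d)\<^sup>2 * c + of_nat d * e"
      unfolding trace_prod_omega[OF \<open>0 < d\<close> assms(2)] .
    moreover have "trace_prod (d ^ (N + 1)) \<rho> (($$) (omega_0i d N i)) = of_real (overlap d N i \<rho>)"
      unfolding overlap_def using assms(3) hermitian_omega_0i
      by (intro trace_prod_hermitian_real) (auto simp: state_def psd_def)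
    ultimately show ?thesis using overlap by simp
  qed
  let ?d = "of_nat d :: complex"
  have d: "?d \<noteq> 0" using \<open>0 < d\<close> by simp
  have d1: "?d\<^sup>2 \<noteq> 1"
  proof
    assume "?d\<^sup>2 = 1"
    then have "of_nat (d\<^sup>2) = (of_nat 1 :: complex)" by simp
    then have "d\<^sup>2 = 1" by (simp only: of_nat_eq_iff)
    then show False using assms(1) by simp
  qed
  have eq2': "?d ^ 3 * c + ?d\<^sup>2 * e = of_real p * (?d\<^sup>2 - 1) + 1"
  proof -
    have "?d * (?d\<^sup>2 * c + ?d * e) = of_real p * (?d\<^sup>2 - 1) + 1"
      unfolding eq2 using d by simp
    then show ?thesis by (simp add: algebra_simps power2_eq_square power3_eq_cube)
  qed
  have "(?d\<^sup>2 - 1) * (?d * c) = (?d\<^sup>2 - 1) * of_real p"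
  proof -
    have "(?d\<^sup>2 - 1) * (?d * c) = (?d ^ 3 * c + ?d\<^sup>2 * e) - (?d * c + ?d\<^sup>2 * e)"
      by (simp add: algebra_simps power2_eq_square power3_eq_cube)
    then show ?thesis unfolding eq1 eq2' by (simp add: algebra_simps)
  qed
  then have dc: "?d * c = of_real p" using d1 by simp
  then have c: "c = of_real (p / real d)" using d by (simp add: field_simps)
  have "?d\<^sup>2 * e = 1 - of_real p" using eq1 dc by (simp add: algebra_simps)
  then have e: "e = of_real ((1 - p) / (real d)\<^sup>2)" using d by (simp add: field_simps)
  show ?thesis unfolding ce[OF kl] c e ..
qed

section \<open>Choi matrices and marginals\<close>

lemma sum_index_split:
  fixes F :: "nat \<Rightarrow> 'a :: comm_monoid_add"
  shows "(\<Sum>c<d ^ (N + 1). F c) = (\<Sum>a<d ^ N. \<Sum>u<d. F (a * d + u))"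
  using sum_lessThan_mult[where F = F and k = "d ^ N" and m = d] by (simp add: mult.commute)

lemma digit_0_split: "u < d \<Longrightarrow> digit d 0 (a * d + u) = u"
  by (simp add: digit_def)

lemma digit_Suc_split: "u < d \<Longrightarrow> digit d (Suc j) (a * d + u) = digit d j a"
  by (simp add: digit_def div_mult2_eq)

definition marginal_index :: "nat \<Rightarrow> nat \<Rightarrow> nat \<Rightarrow> nat \<Rightarrow> nat \<Rightarrow> nat \<Rightarrow> nat \<Rightarrow> bool" where
  "marginal_index d N i u v a b \<longleftrightarrow> digit d (i - 1) a = u \<and> digit d (i - 1) b = v \<and>
     (\<forall>j<N. j \<noteq> i - 1 \<longrightarrow> digit d j a = digit d j b)"

text \<open>Splitting off the lowest digit exhibits \<open>pair_coeff\<close> as a partial trace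
  with the index condition of \<open>marginal\<close>; factor \<open>i\<close> is digit
  \<open>i\<close> of the long index and digit \<open>i - 1\<close> of the short one. The indices
  come out transposed because \<open>trace_prod\<close> pairs entry \<open>(a, b)\<close> with entry
  \<open>(b, a)\<close>.\<close>

lemma pair_coeff_split:
  assumes "0 < d" "i \<in> {1..N}" "k < d" "l < d"
  shows "pair_coeff d N i \<rho> l k v u = (\<Sum>a<d ^ N. \<Sum>b<d ^ N.
     if marginal_index d N i u v a b then \<rho> (a * d + k, b * d + l) else 0)"
proof -
  let ?C = "marginal_index d N i u v"
  obtain i' where i': "i = Suc i'" "i' < N" using assms(2) by (cases i) auto
  have C: "(\<forall>j\<le>N. j \<noteq> 0 \<and> j \<noteq> i \<longrightarrow> digit d j (b * d + y) = digit d j (a * d + x)) \<longleftrightarrow>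
      (\<forall>j<N. j \<noteq> i - 1 \<longrightarrow> digit d j a = digit d j b)" if "x < d" "y < d" for a b x y
  proof
    assume L: "\<forall>j\<le>N. j \<noteq> 0 \<and> j \<noteq> i \<longrightarrow> digit d j (b * d + y) = digit d j (a * d + x)"
    show "\<forall>j<N. j \<noteq> i - 1 \<longrightarrow> digit d j a = digit d j b"
    proof (intro allI impI)
      fix j assume "j < N" "j \<noteq> i - 1"
      then show "digit d j a = digit d j b"
        using L[rule_format, of "Suc j"] that i' by (simp add: digit_Suc_split)
    qed
  next
    assume R: "\<forall>j<N. j \<noteq> i - 1 \<longrightarrow> digit d j a = digit d j b"
    show "\<forall>j\<le>N. j \<noteq> 0 \<and> j \<noteq> i \<longrightarrow> digit d j (b * d + y) = digit d j (a * d + x)"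
    proof (intro allI impI)
      fix j assume j: "j \<le> N" "j \<noteq> 0 \<and> j \<noteq> i"
      then obtain j' where "j = Suc j'" by (cases j) auto
      then show "digit d j (b * d + y) = digit d j (a * d + x)"
        using R[rule_format, of j'] j that i' by (simp add: digit_Suc_split)
    qed
  qed
  have "pair_coeff d N i \<rho> l k v u = (\<Sum>a<d ^ N. \<Sum>x<d. \<Sum>b<d ^ N. \<Sum>y<d. \<rho> (a * d + x, b * d + y) *
      tensor_op d (N + 1) (pair_op i (unit_op l k) (unit_op v u)) (b * d + y, a * d + x))"
    by (simp only: pair_coeff_def trace_prod_def sum_index_split)
  also have "\<dots> = (\<Sum>a<d ^ N. \<Sum>x<d. \<Sum>b<d ^ N. \<Sum>y<d.
      if y = l then if x = k then if ?C a b then \<rho> (a * d + k, b * d + l) else 0 else 0 else 0)"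
  proof (intro sum.cong refl)
    fix a x b y assume "x \<in> {..<d}" "y \<in> {..<d}"
    then have xy: "x < d" "y < d" by auto
    have "digit d i (b * d + y) = digit d (i - 1) b" "digit d i (a * d + x) = digit d (i - 1) a"
      using i' xy by (simp_all add: digit_Suc_split)
    then show "\<rho> (a * d + x, b * d + y) *
        tensor_op d (N + 1) (pair_op i (unit_op l k) (unit_op v u)) (b * d + y, a * d + x) =
      (if y = l then if x = k then if ?C a b then \<rho> (a * d + k, b * d + l) else 0 else 0 else 0)"
      unfolding tensor_op_pair[OF assms(2)] C[OF xy] digit_0_split[OF xy(1)] digit_0_split[OF xy(2)]
      by (simp only: unit_op_apply marginal_index_def) auto
  qed
  also have "\<dots> = (\<Sum>a<d ^ N. \<Sum>b<d ^ N. \<Sum>x<d. \<Sum>y<d.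
      if y = l then if x = k then if ?C a b then \<rho> (a * d + k, b * d + l) else 0 else 0 else 0)"
    by (rule sum.cong, rule refl, rule sum.swap)
  also have "\<dots> = (\<Sum>a<d ^ N. \<Sum>b<d ^ N. if ?C a b then \<rho> (a * d + k, b * d + l) else 0)"
    using assms(3,4) by (simp add: sum.delta)
  finally show ?thesis .
qed

text \<open>On the diagonal of the marginal all digits of \<open>a\<close> and \<open>b\<close>
  agree, so \<open>a = b\<close>. This lets trace preservation of a channel be read off from a
  single marginal.\<close>

lemma mtrace_marginal:
  assumes "0 < d" "i \<in> {1..N}" "M \<in> carrier_mat (d ^ N) (d ^ N)"
  shows "mtrace (marginal d N i M) = mtrace M"
proof -
  have "mtrace (marginal d N i M) = (\<Sum>u<d. \<Sum>a<d ^ N. \<Sum>b<d ^ N.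
        if digit d (i - 1) a = u \<and> digit d (i - 1) b = u
           \<and> (\<forall>j<N. j \<noteq> i - 1 \<longrightarrow> digit d j a = digit d j b)
        then M $$ (a, b) else 0)"
    by (simp add: mtrace_def marginal_def)
  also have "\<dots> = (\<Sum>u<d. \<Sum>a<d ^ N. \<Sum>b<d ^ N.
        if b = a then if u = digit d (i - 1) a then M $$ (a, a) else 0 else 0)"
  proof (intro sum.cong refl)
    fix u a b assume "a \<in> {..<d ^ N}" "b \<in> {..<d ^ N}"
    moreover have "a = b" if "digit d (i - 1) a = digit d (i - 1) b" "\<forall>j<N. j \<noteq> i - 1 \<longrightarrow> digit d j a = digit d j b"
    proof (rule digits_eqI[of a d N b])
      show "digit d j a = digit d j b" if "j < N" for j
        using \<open>digit d (i - 1) a = digit d (i - 1) b\<close> that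
          \<open>\<forall>j<N. j \<noteq> i - 1 \<longrightarrow> digit d j a = digit d j b\<close> by (cases "j = i - 1") auto
    qed (use calculation in auto)
    ultimately show "(if digit d (i - 1) a = u \<and> digit d (i - 1) b = u
           \<and> (\<forall>j<N. j \<noteq> i - 1 \<longrightarrow> digit d j a = digit d j b) then M $$ (a, b) else 0) =
        (if b = a then if u = digit d (i - 1) a then M $$ (a, a) else 0 else 0)"
      by auto
  qed
  also have "\<dots> = (\<Sum>u<d. \<Sum>a<d ^ N. if u = digit d (i - 1) a then M $$ (a, a) else 0)"
    by (simp add: sum.delta)
  also have "\<dots> = (\<Sum>a<d ^ N. \<Sum>u<d. if u = digit d (i - 1) a then M $$ (a, a) else 0)"
    by (rule sum.swap)
  also have "\<dots> = mtrace M"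
    using assms digit_less[OF assms(1)] by (simp add: mtrace_def)
  finally show ?thesis .
qed

lemma marginal_entry:
  "u < d \<Longrightarrow> v < d \<Longrightarrow> marginal d N i M $$ (u, v) =
     (\<Sum>a<d ^ N. \<Sum>b<d ^ N. if marginal_index d N i u v a b then M $$ (a, b) else 0)"
  by (simp add: marginal_def marginal_index_def)

lemma marginal_add:
  assumes "M \<in> carrier_mat (d ^ N) (d ^ N)" "M' \<in> carrier_mat (d ^ N) (d ^ N)" "u < d" "v < d"
  shows "marginal d N i (M + M') $$ (u, v) = marginal d N i M $$ (u, v) + marginal d N i M' $$ (u, v)"
  using assms unfolding marginal_entry[OF assms(3,4)] sum.distrib[symmetric]
  by (intro sum.cong refl) simp

lemma marginal_smult:
  assumes "M \<in> carrier_mat (d ^ N) (d ^ N)" "u < d" "v < d"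
  shows "marginal d N i (c \<cdot>\<^sub>m M) $$ (u, v) = c * marginal d N i M $$ (u, v)"
  using assms unfolding marginal_entry[OF assms(2,3)] sum_distrib_left
  by (intro sum.cong refl) simp

text \<open>The Gram vectors are pulled back along \<open>\<sigma>\<close>. The lemma serves to move
  the input factor from the high position that \<open>ampliate\<close> gives it to the lowest
  digit.\<close>

lemma psd_reindex:
  assumes "psd n A" "\<And>x. x < m \<Longrightarrow> \<sigma> x < n"
  shows "psd m (\<lambda>(x, y). A (\<sigma> x, \<sigma> y))"
proof -
  obtain w where w: "\<And>a b. a < n \<Longrightarrow> b < n \<Longrightarrow> A (a, b) = (\<Sum>k<n. w k a * cnj (w k b))"
    using psd_decomposition[OF assms(1)] by blast
  have "psd m (\<lambda>(x, y). A (\<sigma> x, \<sigma> y)) \<longleftrightarrow> psd m (\<lambda>x. \<Sum>k<n. (\<lambda>(a, b). w k (\<sigma> a) * cnj (w k (\<sigma> b))) x)"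
    using assms(2) w by (intro psd_cong) simp
  moreover have "psd m (\<lambda>x. \<Sum>k<n. (\<lambda>(a, b). w k (\<sigma> a) * cnj (w k (\<sigma> b))) x)"
    by (rule psd_sum) (rule psd_rank_one)
  ultimately show ?thesis by simp
qed

text \<open>The input factor is the lowest digit of an index of \<open>J\<close>, as in the definition of \<open>S_mat\<close>.\<close>

definition choi_channel :: "nat \<Rightarrow> nat \<Rightarrow> (nat \<times> nat \<Rightarrow> complex) \<Rightarrow> complex mat \<Rightarrow> complex mat" where
  "choi_channel d m J A = mat m m (\<lambda>(a, b). \<Sum>k<d. \<Sum>l<d. A $$ (k, l) * J (a * d + k, b * d + l))"

text \<open>Contracting the input index of the Gram vectors \<open>z s\<close> of \<open>X\<close>
  with that of the Gram vectors \<open>w t\<close> of \<open>J\<close> gives Gram vectors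
  \<open>f t s\<close> of the output.\<close>

lemma choi_channel_completely_positive:
  assumes "psd (m * d) J" "X \<in> carrier_mat (K * d) (K * d)" "is_psd X"
  shows "is_psd (ampliate K d m (choi_channel d m J) X)"
proof -
  obtain w where w: "\<And>a b. a < m * d \<Longrightarrow> b < m * d \<Longrightarrow> J (a, b) = (\<Sum>t<m * d. w t a * cnj (w t b))"
    using psd_decomposition[OF assms(1)] by blast
  have "psd (K * d) (($$) X)" using assms(2,3) by (simp add: is_psd_iff_psd)
  then obtain z where z: "\<And>a b. a < K * d \<Longrightarrow> b < K * d \<Longrightarrow> X $$ (a, b) = (\<Sum>s<K * d. z s a * cnj (z s b))"
    using psd_decomposition by blast
  let ?Y = "ampliate K d m (choi_channel d m J) X"
  define f where "f t s r = (\<Sum>u<d. z s ((r div m) * d + u) * w t ((r mod m) * d + u))" for t s r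
  have index: "q * d + u < Q * d" if "q < Q" "u < d" for q Q u :: nat
  proof -
    have "q * d + u < Suc q * d" using that(2) by simp
    also have "\<dots> \<le> Q * d" using that(1) by (intro mult_right_mono) auto
    finally show ?thesis .
  qed
  have "?Y $$ (r, r') = (\<Sum>t<m * d. \<Sum>s<K * d. (\<lambda>(a, b). f t s a * cnj (f t s b)) (r, r'))"
    if r: "r < K * m" "r' < K * m" for r r'
  proof -
    have "0 < m" using r by (cases m) auto
    have rr: "r div m < K" "r' div m < K" "r mod m < m" "r' mod m < m"
      using r \<open>0 < m\<close> by (auto simp: less_mult_imp_div_less)
    have "?Y $$ (r, r') = (\<Sum>u<d. \<Sum>v<d. X $$ ((r div m) * d + u, (r' div m) * d + v) *
        J ((r mod m) * d + u, (r' mod m) * d + v))"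
      using r rr by (simp add: ampliate_def choi_channel_def)
    also have "\<dots> = (\<Sum>u<d. \<Sum>v<d. (\<Sum>s<K * d. z s ((r div m) * d + u) * cnj (z s ((r' div m) * d + v))) *
        (\<Sum>t<m * d. w t ((r mod m) * d + u) * cnj (w t ((r' mod m) * d + v))))"
      using rr by (intro sum.cong refl) (simp add: z w index)
    also have "\<dots> = (\<Sum>u<d. \<Sum>v<d. \<Sum>t<m * d. \<Sum>s<K * d.
        (z s ((r div m) * d + u) * w t ((r mod m) * d + u)) *
        (cnj (z s ((r' div m) * d + v)) * cnj (w t ((r' mod m) * d + v))))"
    proof -
      have "(\<Sum>s<K * d. z s x * cnj (z s y)) * (\<Sum>t<m * d. w t x' * cnj (w t y')) =
          (\<Sum>t<m * d. \<Sum>s<K * d. (z s x * w t x') * (cnj (z s y) * cnj (w t y')))" for x y x' y'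
        unfolding sum_product by (subst sum.swap) (simp only: ac_simps)
      then show ?thesis by (simp only:)
    qed
    also have "\<dots> = (\<Sum>t<m * d. \<Sum>s<K * d. \<Sum>u<d. \<Sum>v<d.
        (z s ((r div m) * d + u) * w t ((r mod m) * d + u)) *
        (cnj (z s ((r' div m) * d + v)) * cnj (w t ((r' mod m) * d + v))))"
      by (rule sum4_swap)
    also have "\<dots> = (\<Sum>t<m * d. \<Sum>s<K * d. (\<lambda>(a, b). f t s a * cnj (f t s b)) (r, r'))"
      by (simp only: f_def sum_product cnj_sum complex_cnj_mult prod.case)
    finally show ?thesis .
  qed
  then have "psd (K * m) (($$) ?Y) \<longleftrightarrow>
      psd (K * m) (\<lambda>x. \<Sum>t<m * d. \<Sum>s<K * d. (\<lambda>(a, b). f t s a * cnj (f t s b)) x)"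
    by (intro psd_cong)
  moreover have "psd (K * m) (\<lambda>x. \<Sum>t<m * d. \<Sum>s<K * d. (\<lambda>(a, b). f t s a * cnj (f t s b)) x)"
    by (intro psd_sum) (rule psd_rank_one)
  moreover have "?Y \<in> carrier_mat (K * m) (K * m)" by (simp add: ampliate_def)
  ultimately show ?thesis by (simp add: is_psd_iff_psd)
qed

lemma marginal_choi_channel:
  assumes "0 < d" "i \<in> {1..N}" "u < d" "v < d"
  shows "marginal d N i (choi_channel d (d ^ N) J A) $$ (u, v)
       = (\<Sum>k<d. \<Sum>l<d. A $$ (k, l) * pair_coeff d N i J l k v u)"
proof -
  let ?C = "marginal_index d N i u v"
  have "marginal d N i (choi_channel d (d ^ N) J A) $$ (u, v) =
      (\<Sum>a<d ^ N. \<Sum>b<d ^ N. \<Sum>k<d. \<Sum>l<d. A $$ (k, l) * (if ?C a b then J (a * d + k, b * d + l) else 0))"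
    unfolding marginal_entry[OF assms(3,4)]
  proof (intro sum.cong refl)
    fix a b assume "a \<in> {..<d ^ N}" "b \<in> {..<d ^ N}"
    then show "(if ?C a b then choi_channel d (d ^ N) J A $$ (a, b) else 0) =
        (\<Sum>k<d. \<Sum>l<d. A $$ (k, l) * (if ?C a b then J (a * d + k, b * d + l) else 0))"
      by (cases "?C a b") (simp_all add: choi_channel_def)
  qed
  also have "\<dots> = (\<Sum>k<d. \<Sum>l<d. \<Sum>a<d ^ N. \<Sum>b<d ^ N. A $$ (k, l) * (if ?C a b then J (a * d + k, b * d + l) else 0))"
    by (rule sum4_swap)
  also have "\<dots> = (\<Sum>k<d. \<Sum>l<d. A $$ (k, l) * pair_coeff d N i J l k v u)"
    using assms by (intro sum.cong refl) (simp add: pair_coeff_split sum_distrib_left)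
  finally show ?thesis .
qed

lemma isotropic_state_imp_cloning_region:
  assumes "0 < d" "1 \<le> N" "\<forall>i\<in>{1..N}. 0 \<le> p i \<and> p i \<le> 1"
    and "state (d ^ (N + 1)) \<rho>"
    and coeff: "\<And>i k k' l l'. i \<in> {1..N} \<Longrightarrow> k < d \<Longrightarrow> k' < d \<Longrightarrow> l < d \<Longrightarrow> l' < d \<Longrightarrow>
      pair_coeff d N i \<rho> k k' l l' = (if k = l \<and> k' = l' then of_real (p i / real d) else 0)
         + (if k = k' \<and> l = l' then of_real ((1 - p i) / (real d)\<^sup>2) else 0)"
  shows "p \<in> cloning_region N d"
proof -
  \<comment> \<open>The factor \<open>d\<close> undoes the normalisation: the Choi matrix of a
    trace-preserving map on \<open>d\<close> by \<open>d\<close> matrices has trace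
    \<open>d\<close>.\<close>
  define J where "J = (\<lambda>x. of_real (real d) * \<rho> x)"
  let ?T = "choi_channel d (d ^ N) J"
  have "psd (d ^ (N + 1)) J"
    unfolding J_def using assms(4) by (intro psd_scale) (auto simp: state_def)
  then have J: "psd (d ^ N * d) J" by (simp add: mult.commute)
  \<comment> \<open>Proved for all matrices, with \<open>mtrace A\<close> in front of the identity,
    because trace preservation is derived from it below.\<close>
  have marg: "marginal d N i (?T A) = of_real (p i) \<cdot>\<^sub>m A + (of_real ((1 - p i) / real d) * mtrace A) \<cdot>\<^sub>m 1\<^sub>m d"
    if i: "i \<in> {1..N}" and A: "A \<in> carrier_mat d d" for i A
  proof (rule eq_matI)
    fix u v assume "u < dim_row (of_real (p i) \<cdot>\<^sub>m A + (of_real ((1 - p i) / real d) * mtrace A) \<cdot>\<^sub>m 1\<^sub>m d)"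
      and "v < dim_col (of_real (p i) \<cdot>\<^sub>m A + (of_real ((1 - p i) / real d) * mtrace A) \<cdot>\<^sub>m 1\<^sub>m d)"
    then have uv: "u < d" "v < d" by auto
    have "marginal d N i (?T A) $$ (u, v) = (\<Sum>k<d. \<Sum>l<d. A $$ (k, l) * pair_coeff d N i J l k v u)"
      by (rule marginal_choi_channel[OF assms(1) i uv])
    also have "\<dots> = (\<Sum>k<d. \<Sum>l<d. (if l = v then if k = u then of_real (p i) * A $$ (u, v) else 0 else 0)
         + (if l = k then if u = v then of_real ((1 - p i) / real d) * A $$ (k, k) else 0 else 0))"
    proof (intro sum.cong refl)
      fix k l assume "k \<in> {..<d}" "l \<in> {..<d}"
      then have "pair_coeff d N i J l k v u = of_real (real d) *
          ((if l = v \<and> k = u then of_real (p i / real d) else 0)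
         + (if l = k \<and> v = u then of_real ((1 - p i) / (real d)\<^sup>2) else 0))"
        using coeff[OF i, of l k v u] uv
        unfolding J_def pair_coeff_def trace_prod_scale_left by simp
      then show "A $$ (k, l) * pair_coeff d N i J l k v u =
         (if l = v then if k = u then of_real (p i) * A $$ (u, v) else 0 else 0)
         + (if l = k then if u = v then of_real ((1 - p i) / real d) * A $$ (k, k) else 0 else 0)"
        using assms(1) by (auto simp: field_simps power2_eq_square)
    qed
    also have "\<dots> = of_real (p i) * A $$ (u, v) + (if u = v then of_real ((1 - p i) / real d) * mtrace A else 0)"
      using uv A by (simp add: sum.distrib sum.delta mtrace_def sum_distrib_left)
    also have "\<dots> = (of_real (p i) \<cdot>\<^sub>m A + (of_real ((1 - p i) / real d) * mtrace A) \<cdot>\<^sub>m 1\<^sub>m d) $$ (u, v)"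
      using uv A by simp
    finally show "marginal d N i (?T A) $$ (u, v) =
      (of_real (p i) \<cdot>\<^sub>m A + (of_real ((1 - p i) / real d) * mtrace A) \<cdot>\<^sub>m 1\<^sub>m d) $$ (u, v)" .
  qed (use A in \<open>auto simp: marginal_def\<close>)
  have "quantum_channel d (d ^ N) ?T"
    unfolding quantum_channel_def
  proof (intro conjI ballI allI impI)
    fix A :: "complex mat" assume A: "A \<in> carrier_mat d d"
    show "?T A \<in> carrier_mat (d ^ N) (d ^ N)" by (simp add: choi_channel_def)
    show "?T (A + B) = ?T A + ?T B" if "B \<in> carrier_mat d d" for B
      using A that by (auto simp: choi_channel_def sum.distrib[symmetric] algebra_simps intro!: sum.cong eq_matI)
    show "?T (c \<cdot>\<^sub>m A) = c \<cdot>\<^sub>m ?T A" for c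
      using A by (auto simp: choi_channel_def sum_distrib_left algebra_simps intro!: sum.cong eq_matI)
    \<comment> \<open>Any one output factor would do: the isotropic marginal on it has trace
      \<open>p 1 + (1 - p 1) = 1\<close> times that of the input.\<close>
    have 1: "1 \<in> {1..N}" using assms(2) by simp
    have "mtrace (?T A) = mtrace (marginal d N 1 (?T A))"
      using mtrace_marginal[OF assms(1) 1, of "?T A"] by (simp add: choi_channel_def)
    also have "\<dots> = of_real (p 1) * mtrace A + of_nat d * (of_real ((1 - p 1) / real d) * mtrace A)"
      unfolding marg[OF 1 A] using A by (simp add: mtrace_def sum.distrib sum_distrib_left)
    also have "\<dots> = mtrace A" using assms(1) by (simp add: field_simps)
    finally show "mtrace (?T A) = mtrace A" .
  next
    fix K X assume "X \<in> carrier_mat (K * d) (K * d)" "is_psd X"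
    then show "is_psd (ampliate K d (d ^ N) ?T X)" by (rule choi_channel_completely_positive[OF J])
  qed
  moreover have "marginal d N i (?T A) = of_real (p i) \<cdot>\<^sub>m A + of_real ((1 - p i) / real d) \<cdot>\<^sub>m 1\<^sub>m d"
    if "density_matrix d A" "i \<in> {1..N}" for A i
    using marg[OF that(2), of A] that(1) by (simp add: density_matrix_def)
  ultimately show ?thesis using assms(3) unfolding cloning_region_def by blast
qed

text \<open>Density matrices span all matrices. The marginal condition is given on density matrices,
  while the Choi matrix is made of the images of matrix units.\<close>

lemma linear_functional_zero_on_units:
  fixes F :: "complex mat \<Rightarrow> complex"
  assumes add: "\<And>A B. A \<in> carrier_mat d d \<Longrightarrow> B \<in> carrier_mat d d \<Longrightarrow> F (A + B) = F A + F B"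
    and smult: "\<And>c A. A \<in> carrier_mat d d \<Longrightarrow> F (c \<cdot>\<^sub>m A) = c * F A"
    and zero: "\<And>\<rho>. density_matrix d \<rho> \<Longrightarrow> F \<rho> = 0"
    and kl: "k < d" "l < d"
  shows "F (mat d d (unit_op k l)) = 0"
proof -
  have rank_one: "F (mat d d (\<lambda>(a, b). v a * cnj (v b))) = 0" if v: "\<exists>a<d. v a \<noteq> 0" for v
  proof -
    define s where "s = (\<Sum>a<d. (cmod (v a))\<^sup>2)"
    obtain a where "a < d" "v a \<noteq> 0" using v by blast
    then have "s > 0" unfolding s_def by (intro sum_pos2[where i = a]) auto
    let ?R = "mat d d (\<lambda>(a, b). v a * cnj (v b))"
    let ?D = "of_real (1 / s) \<cdot>\<^sub>m ?R"
    have "psd d (\<lambda>x. of_real (1 / s) * (\<lambda>(a, b). v a * cnj (v b)) x)"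
      using \<open>s > 0\<close> by (intro psd_scale psd_rank_one) auto
    moreover have "psd d (($$) ?D) \<longleftrightarrow> psd d (\<lambda>x. of_real (1 / s) * (\<lambda>(a, b). v a * cnj (v b)) x)"
      by (intro psd_cong) simp
    ultimately have "is_psd ?D" by (subst is_psd_iff_psd[of _ d]) auto
    moreover have "mtrace ?D = 1"
    proof -
      have "mtrace ?D = of_real (1 / s) * (\<Sum>a<d. v a * cnj (v a))"
        by (simp add: mtrace_def sum_distrib_left)
      also have "(\<Sum>a<d. v a * cnj (v a)) = of_real s"
        unfolding s_def of_real_sum complex_norm_square ..
      finally show ?thesis using \<open>s > 0\<close> by simp
    qed
    ultimately have "F ?D = 0" by (intro zero) (simp add: density_matrix_def)
    then show ?thesis using \<open>s > 0\<close> by (simp add: smult)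
  qed
  have diag: "F (mat d d (unit_op m m)) = 0" if "m < d" for m
  proof -
    have "mat d d (unit_op m m) = mat d d (\<lambda>(a, b). (if a = m then 1 else 0) * cnj (if b = m then 1 else 0))"
      by (intro eq_matI) auto
    then show ?thesis using rank_one[of "\<lambda>a. if a = m then 1 else 0"] that by auto
  qed
  show ?thesis
  proof (cases "k = l")
    case True
    then show ?thesis using diag kl by simp
  next
    case False
    \<comment> \<open>Polarisation: in \<open>?R v1\<close> plus \<open>\<i>\<close> times
      \<open>?R v2\<close> the entries at \<open>(l, k)\<close> cancel, those at
      \<open>(k, l)\<close> add up to \<open>2\<close>, and the diagonal entries at \<open>k\<close>
      and \<open>l\<close> are \<open>1 + \<i>\<close>.\<close>
    define v1 where "v1 a = (if a = k then 1 else if a = l then 1 else (0 :: complex))" for a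
    define v2 where "v2 a = (if a = k then 1 else if a = l then \<i> else 0)" for a
    let ?R = "\<lambda>v. mat d d (\<lambda>(a, b). v a * cnj (v b))"
    have "2 \<cdot>\<^sub>m mat d d (unit_op k l) = ?R v1 + (\<i> \<cdot>\<^sub>m ?R v2 +
        (- (1 + \<i>)) \<cdot>\<^sub>m (mat d d (unit_op k k) + mat d d (unit_op l l)))"
      using False by (intro eq_matI) (auto simp: v1_def v2_def algebra_simps)
    then have "2 * F (mat d d (unit_op k l)) = F (?R v1) + (\<i> * F (?R v2) +
        (- (1 + \<i>)) * (F (mat d d (unit_op k k)) + F (mat d d (unit_op l l))))"
      using add smult by (metis (no_types, lifting) add_carrier_mat mat_carrier smult_carrier_mat)
    moreover have "F (?R v1) = 0" "F (?R v2) = 0"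
      using kl by (auto intro!: rank_one simp: v1_def v2_def)
    ultimately show ?thesis using diag kl by simp
  qed
qed

lemma cloning_region_imp_state:
  assumes "0 < d" "p \<in> cloning_region N d"
  obtains \<rho> where "state (d ^ (N + 1)) \<rho>"
    "\<And>i. i \<in> {1..N} \<Longrightarrow> overlap d N i \<rho> = (p i * ((real d)\<^sup>2 - 1) + 1) / real d"
proof -
  let ?m = "d ^ N"
  let ?E = "\<lambda>k l. mat d d (unit_op k l)"
  obtain T where T: "quantum_channel d ?m T"
    and marg: "\<And>\<rho> i. density_matrix d \<rho> \<Longrightarrow> i \<in> {1..N} \<Longrightarrow> marginal d N i (T \<rho>) =
       of_real (p i) \<cdot>\<^sub>m \<rho> + of_real ((1 - p i) / real d) \<cdot>\<^sub>m 1\<^sub>m d"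
    using assms(2) unfolding cloning_region_def by blast
  have T_carrier: "T A \<in> carrier_mat ?m ?m" if "A \<in> carrier_mat d d" for A
    using T that by (simp add: quantum_channel_def)
  define \<rho> where "\<rho> = (\<lambda>x. of_real (1 / real d) * (\<lambda>(x, y). T (?E (x mod d) (y mod d)) $$ (x div d, y div d)) x)"
  have "psd (d ^ (N + 1)) \<rho>"
  proof -
    \<comment> \<open>The vector \<open>v\<close> is \<Omega> on two copies of the input space and
      \<open>X\<close> is \<omega>; the channel applied to one copy gives the Choi matrix.
      Positivity is thus complete positivity with ancilla dimension \<open>d\<close>.\<close>
    define v :: "nat \<Rightarrow> complex" where "v r = (if r div d = r mod d then 1 else 0)" for r
    define X where "X = mat (d * d) (d * d) (\<lambda>(r, s). v r * cnj (v s))"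
    let ?Y = "ampliate d d ?m T X"
    have "psd (d * d) (($$) X) \<longleftrightarrow> psd (d * d) (\<lambda>(r, s). v r * cnj (v s))"
      by (intro psd_cong) (simp add: X_def)
    then have "is_psd X" by (subst is_psd_iff_psd[of _ "d * d"]) (auto simp: X_def psd_rank_one)
    then have "is_psd ?Y" using T unfolding quantum_channel_def by (auto simp: X_def)
    then have Y: "psd (d * ?m) (($$) ?Y)" by (subst (asm) is_psd_iff_psd[of _ "d * ?m"]) (auto simp: ampliate_def)
    \<comment> \<open>\<open>ampliate\<close> has the untouched copy in the high position,
      \<open>\<rho>\<close> has it as the lowest digit; \<open>\<sigma>\<close> translates.\<close>
    define \<sigma> where "\<sigma> x = (x mod d) * ?m + x div d" for x
    have "0 < ?m" using assms(1) by simp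
    have \<sigma>: "\<sigma> x < d * ?m" "\<sigma> x div ?m = x mod d" "\<sigma> x mod ?m = x div d" if "x < d ^ (N + 1)" for x
    proof -
      have x: "x div d < ?m" using that assms(1) by (simp add: less_mult_imp_div_less mult.commute)
      then show "\<sigma> x div ?m = x mod d" "\<sigma> x mod ?m = x div d"
        using assms(1) by (simp_all add: \<sigma>_def)
      have "\<sigma> x < Suc (x mod d) * ?m" using x by (simp add: \<sigma>_def)
      also have "\<dots> \<le> d * ?m" using assms(1) by (intro mult_right_mono) (auto simp: Suc_le_eq)
      finally show "\<sigma> x < d * ?m" .
    qed
    have "?Y $$ (\<sigma> x, \<sigma> y) = T (?E (x mod d) (y mod d)) $$ (x div d, y div d)"
      if "x < d ^ (N + 1)" "y < d ^ (N + 1)" for x y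
    proof -
      have "mat d d (\<lambda>(u, w). X $$ ((x mod d) * d + u, (y mod d) * d + w)) = ?E (x mod d) (y mod d)"
      proof (rule eq_matI)
        fix u w assume "u < dim_row (?E (x mod d) (y mod d))" "w < dim_col (?E (x mod d) (y mod d))"
        then have uw: "u < d" "w < d" by auto
        have index: "q mod d * d + u < d * d" if "u < d" for q u
        proof -
          have "q mod d * d + u < Suc (q mod d) * d" using that by simp
          also have "\<dots> \<le> d * d" using assms(1) by (intro mult_right_mono) (auto simp: Suc_le_eq)
          finally show ?thesis .
        qed
        show "mat d d (\<lambda>(u, w). X $$ ((x mod d) * d + u, (y mod d) * d + w)) $$ (u, w) = ?E (x mod d) (y mod d) $$ (u, w)"
          using uw index[OF uw(1), of x] index[OF uw(2), of y] by (auto simp: X_def v_def)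
      qed simp_all
      then show ?thesis
        using \<sigma>[OF that(1)] \<sigma>[OF that(2)] by (simp add: ampliate_def)
    qed
    then have "psd (d ^ (N + 1)) (\<lambda>(x, y). ?Y $$ (\<sigma> x, \<sigma> y)) \<longleftrightarrow>
        psd (d ^ (N + 1)) (\<lambda>(x, y). T (?E (x mod d) (y mod d)) $$ (x div d, y div d))"
      by (intro psd_cong) simp
    moreover have "psd (d ^ (N + 1)) (\<lambda>(x, y). ?Y $$ (\<sigma> x, \<sigma> y))"
      using Y \<sigma>(1) by (rule psd_reindex)
    ultimately show ?thesis unfolding \<rho>_def by (intro psd_scale) auto
  qed
  have entry: "\<rho> (a * d + k, b * d + l) = of_real (1 / real d) * T (?E k l) $$ (a, b)" if "k < d" "l < d" for a b k l
    using that by (simp add: \<rho>_def)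
  have "(\<Sum>c<d ^ (N + 1). \<rho> (c, c)) = 1"
  proof -
    have "(\<Sum>c<d ^ (N + 1). \<rho> (c, c)) = (\<Sum>a<?m. \<Sum>k<d. of_real (1 / real d) * T (?E k k) $$ (a, a))"
      unfolding sum_index_split by (intro sum.cong refl) (simp add: entry)
    also have "\<dots> = of_real (1 / real d) * (\<Sum>k<d. mtrace (T (?E k k)))"
      unfolding mtrace_def sum_distrib_left
      by (subst sum.swap) (use carrier_matD(1)[OF T_carrier] in \<open>simp\<close>)
    also have "(\<Sum>k<d. mtrace (T (?E k k))) = (\<Sum>k<d. 1)"
    proof (intro sum.cong refl)
      fix k assume "k \<in> {..<d}"
      have "mtrace (T (?E k k)) = mtrace (?E k k)" using T by (simp add: quantum_channel_def)
      also have "\<dots> = 1" using \<open>k \<in> {..<d}\<close> by (simp add: mtrace_def)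
      finally show "mtrace (T (?E k k)) = 1" .
    qed
    finally show ?thesis using assms(1) by simp
  qed
  then have state: "state (d ^ (N + 1)) \<rho>" using \<open>psd (d ^ (N + 1)) \<rho>\<close> by (simp only: state_def)
  have "overlap d N i \<rho> = (p i * ((real d)\<^sup>2 - 1) + 1) / real d" if i: "i \<in> {1..N}" for i
  proof -
    have marg_unit: "marginal d N i (T (?E k l)) $$ (u, v) =
        of_real (p i) * ?E k l $$ (u, v) + of_real ((1 - p i) / real d) * mtrace (?E k l) * id_op (u, v)"
      if kl: "k < d" "l < d" and uv: "u < d" "v < d" for k l u v
    proof -
      define e where "e = complex_of_real ((1 - p i) / real d)"
      \<comment> \<open>The failure of the marginal formula at entry \<open>(u, v)\<close>. The
        factor \<open>mtrace A\<close>, which is \<open>1\<close> on density matrices, makes it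
        linear in \<open>A\<close>.\<close>
      define F where "F A = marginal d N i (T A) $$ (u, v) -
        (of_real (p i) * A $$ (u, v) + e * mtrace A * id_op (u, v))" for A
      have "F (?E k l) = 0"
      proof (rule linear_functional_zero_on_units[OF _ _ _ kl])
        show "F (A + B) = F A + F B" if AB: "A \<in> carrier_mat d d" "B \<in> carrier_mat d d" for A B
        proof -
          have "marginal d N i (T A + T B) $$ (u, v) = marginal d N i (T A) $$ (u, v) + marginal d N i (T B) $$ (u, v)"
            by (rule marginal_add[OF T_carrier[OF AB(1)] T_carrier[OF AB(2)] uv])
          moreover have "T (A + B) = T A + T B" using T AB by (simp add: quantum_channel_def)
          moreover have "mtrace (A + B) = mtrace A + mtrace B"
            using AB by (simp add: mtrace_def sum.distrib)
          ultimately show ?thesis unfolding F_def using AB uv by (simp add: algebra_simps)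
        qed
        show "F (c \<cdot>\<^sub>m A) = c * F A" if A: "A \<in> carrier_mat d d" for c A
        proof -
          have "marginal d N i (c \<cdot>\<^sub>m T A) $$ (u, v) = c * marginal d N i (T A) $$ (u, v)"
            by (rule marginal_smult[OF T_carrier[OF A] uv])
          moreover have "T (c \<cdot>\<^sub>m A) = c \<cdot>\<^sub>m T A" using T A by (simp add: quantum_channel_def)
          moreover have "mtrace (c \<cdot>\<^sub>m A) = c * mtrace A"
            using A by (simp add: mtrace_def sum_distrib_left)
          ultimately show ?thesis unfolding F_def using A uv by (simp add: algebra_simps)
        qed
        show "F A = 0" if "density_matrix d A" for A
          unfolding F_def e_def marg[OF that i] using that uv by (auto simp: density_matrix_def)
      qed
      then show ?thesis by (simp add: F_def e_def)
    qed
    have "trace_prod (d ^ (N + 1)) \<rho> (($$) (omega_0i d N i)) =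
        (\<Sum>l<d. \<Sum>k<d. of_real (1 / real d) * marginal d N i (T (?E k l)) $$ (k, l))"
      unfolding trace_prod_omega[OF assms(1) i]
    proof (intro sum.cong refl)
      fix l k assume kl: "l \<in> {..<d}" "k \<in> {..<d}"
      then have kl': "k < d" "l < d" by auto
      have "pair_coeff d N i \<rho> l k l k = (\<Sum>a<d ^ N. \<Sum>b<d ^ N.
         if marginal_index d N i k l a b then \<rho> (a * d + k, b * d + l) else 0)"
        by (rule pair_coeff_split[OF assms(1) i kl'])
      also have "\<dots> = of_real (1 / real d) * marginal d N i (T (?E k l)) $$ (k, l)"
        unfolding marginal_entry[OF kl'] sum_distrib_left entry[OF kl'] by (intro sum.cong refl) simp
      finally show "pair_coeff d N i \<rho> l k l k = of_real (1 / real d) * marginal d N i (T (?E k l)) $$ (k, l)" .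
    qed
    also have "\<dots> = of_real (1 / real d) * (\<Sum>l<d. \<Sum>k<d. of_real (p i) +
        (if k = l then of_real ((1 - p i) / real d) else 0))"
      unfolding sum_distrib_left
    proof (intro sum.cong refl)
      fix l k assume kl: "l \<in> {..<d}" "k \<in> {..<d}"
      have "mtrace (?E k l) = id_op (k, l)"
      proof -
        have "mtrace (?E k l) = (\<Sum>a<d. if a = k then id_op (k, l) else 0)"
          unfolding mtrace_def by (intro sum.cong) auto
        then show ?thesis using kl by simp
      qed
      then show "of_real (1 / real d) * marginal d N i (T (?E k l)) $$ (k, l) =
        of_real (1 / real d) * (of_real (p i) + (if k = l then of_real ((1 - p i) / real d) else 0))"
        using kl by (simp add: marg_unit)
    qed
    \<comment> \<open>All \<open>d * d\<close> pairs contribute \<open>p i\<close>, the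
      \<open>d\<close> diagonal pairs another \<open>(1 - p i) / d\<close> each, and the
      normalisation divides by \<open>d\<close>.\<close>
    also have "\<dots> = of_real ((p i * ((real d)\<^sup>2 - 1) + 1) / real d)"
      using assms(1) by (simp add: sum.distrib field_simps power2_eq_square)
    finally show ?thesis by (simp only: overlap_def Re_complex_of_real)
  qed
  then show ?thesis using state that by blast
qed

section \<open>The dual norm\<close>

lemma qform_uniform:
  assumes "\<And>k. k < d \<Longrightarrow> \<sigma> k < n"
  shows "qform n A (\<lambda>a. \<Sum>k<d. if a = \<sigma> k then of_real h else 0) = of_real (h\<^sup>2) * (\<Sum>k<d. \<Sum>l<d. A (\<sigma> k, \<sigma> l))"
proof -
  have "qform n A (\<lambda>a. \<Sum>k<d. if a = \<sigma> k then of_real h else 0) =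
     (\<Sum>a<n. \<Sum>b<n. \<Sum>k<d. \<Sum>l<d. if b = \<sigma> l then if a = \<sigma> k then of_real (h\<^sup>2) * A (\<sigma> k, \<sigma> l) else 0 else 0)"
    unfolding qform_def cnj_sum sum_distrib_right unfolding sum_distrib_left
    by (intro sum.cong refl) (auto simp: power2_eq_square)
  also have "\<dots> = (\<Sum>k<d. \<Sum>l<d. \<Sum>a<n. \<Sum>b<n. if b = \<sigma> l then if a = \<sigma> k then of_real (h\<^sup>2) * A (\<sigma> k, \<sigma> l) else 0 else 0)"
    by (rule sum4_swap)
  also have "\<dots> = of_real (h\<^sup>2) * (\<Sum>k<d. \<Sum>l<d. A (\<sigma> k, \<sigma> l))"
    unfolding sum_distrib_left using assms by (intro sum.cong refl) (simp add: sum.delta)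
  finally show ?thesis .
qed

lemma digit_repeated:
  assumes "k < d" "1 \<le> i"
  shows "digit d j (k * d ^ i + k) = (if j = 0 \<or> j = i then k else 0)"
proof -
  have "k < d ^ i" using assms less_le_trans[OF assms(1) self_le_power[of d i]] by simp
  consider "j = i" | "j < i" | "i < j" by linarith
  then show ?thesis
  proof cases
    case 1
    then show ?thesis using digit_top[OF assms(1) \<open>k < d ^ i\<close>] by simp
  next
    case 2
    have "digit d j k = (if j = 0 then k else 0)"
    proof (cases "j = 0")
      case False
      then have "k < d ^ j" using assms less_le_trans[OF assms(1) self_le_power[of d j]] by simp
      then show ?thesis using False by (simp add: digit_def)
    qed (use assms in \<open>simp add: digit_def\<close>)
    then show ?thesis using 2 assms digit_add_high[of d j i k k] by simp
  next
    case 3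
    have "k * d ^ i + k < Suc k * d ^ i" using \<open>k < d ^ i\<close> by simp
    also have "\<dots> \<le> d * d ^ i" using assms by (intro mult_right_mono) auto
    also have "\<dots> = d ^ Suc i" by simp
    also have "\<dots> \<le> d ^ j" using 3 assms by (intro power_increasing) auto
    finally show ?thesis using 3 by (simp add: digit_def)
  qed
qed

text \<open>The pure state \<open>\<Omega>\<^sub>(\<^sub>0\<^sub>,\<^sub>i\<^sub>)\<close>, normalised, with all other factors in the first basis state.\<close>

lemma maximally_entangled_state:
  assumes "0 < d" "i \<in> {1..N}"
  obtains \<rho> where "state (d ^ (N + 1)) \<rho>"
    "\<And>j. j \<in> {1..N} \<Longrightarrow> overlap d N j \<rho> = (if j = i then real d else 1 / real d)"
proof -
  define h where "h = sqrt (1 / real d)"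
  define \<sigma> where "\<sigma> k = k * d ^ i + k" for k
  define v :: "nat \<Rightarrow> complex" where "v a = (\<Sum>k<d. if a = \<sigma> k then of_real h else 0)" for a
  let ?n = "d ^ (N + 1)"
  have h: "h\<^sup>2 = 1 / real d" by (simp add: h_def)
  have i: "1 \<le> i" "i \<le> N" using assms(2) by auto
  have dig: "digit d j (\<sigma> k) = (if j = 0 \<or> j = i then k else 0)" if "k < d" for j k
    unfolding \<sigma>_def by (rule digit_repeated[OF that i(1)])
  have \<sigma>: "\<sigma> k < ?n" if "k < d" for k
  proof -
    have "k < d ^ i" using that i less_le_trans[OF that self_le_power[of d i]] by simp
    then have "\<sigma> k < Suc k * d ^ i" by (simp add: \<sigma>_def)
    also have "\<dots> \<le> d * d ^ i" using that by (intro mult_right_mono) auto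
    also have "\<dots> = d ^ Suc i" by simp
    also have "\<dots> \<le> ?n" using i assms(1) by (intro power_increasing) auto
    finally show ?thesis .
  qed
  have inj: "\<sigma> k = \<sigma> l \<longleftrightarrow> k = l" if "k < d" "l < d" for k l
  proof
    assume "\<sigma> k = \<sigma> l"
    then have "digit d 0 (\<sigma> k) = digit d 0 (\<sigma> l)" by simp
    then show "k = l" by (simp add: dig that)
  qed simp
  have "(\<Sum>a<?n. (cmod (v a))\<^sup>2) = 1"
  proof -
    have "of_real (\<Sum>a<?n. (cmod (v a))\<^sup>2) = qform ?n (\<lambda>(a, b). if a = b then 1 else 0) v"
      by (simp only: qform_identity_scaled mult_1)
    also have "\<dots> = of_real (h\<^sup>2) * (\<Sum>k<d. \<Sum>l<d. if k = l then 1 else 0)"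
      unfolding v_def using inj by (subst qform_uniform[OF \<sigma>]) (auto intro!: sum.cong)
    also have "\<dots> = of_real 1" using assms(1) by (simp add: h)
    finally show ?thesis by (simp only: of_real_eq_iff)
  qed
  then have "state ?n (\<lambda>(a, b). v a * cnj (v b))" by (rule state_rank_one)
  moreover have "overlap d N j (\<lambda>(a, b). v a * cnj (v b)) = (if j = i then real d else 1 / real d)"
    if j: "j \<in> {1..N}" for j
  proof -
    \<comment> \<open>For \<open>j = i\<close> every pair of terms contributes. For other
      \<open>j\<close>, factor \<open>j\<close> is in basis state \<open>0\<close>, so factor
      \<open>0\<close> must be as well and only \<open>k = l = 0\<close> contributes.\<close>
    have "omega_0i d N j $$ (\<sigma> k, \<sigma> l) = (if j = i then 1 else if l = 0 then if k = 0 then 1 else 0 else 0)"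
      if "k < d" "l < d" for k l
      using \<sigma>[OF that(1)] \<sigma>[OF that(2)] j i by (auto simp: omega_0i_def dig that)
    then have "qform ?n (($$) (omega_0i d N j)) v = of_real (h\<^sup>2) *
        (\<Sum>k<d. \<Sum>l<d. if j = i then 1 else if l = 0 then if k = 0 then 1 else 0 else 0)"
      unfolding v_def by (subst qform_uniform[OF \<sigma>]) (auto intro!: sum.cong)
    also have "\<dots> = of_real (if j = i then real d else 1 / real d)"
      using assms(1) by (cases "j = i") (simp_all add: h)
    finally show ?thesis by (simp only: overlap_def trace_prod_rank_one Re_complex_of_real)
  qed
  ultimately show ?thesis using that by blast
qed

text \<open>The maximally entangled state bounds the top eigenvalue from below, and the baseline
  \<open>1 / d\<close> in all its overlaps accounts for exactly the 1-norm that
  \<open>Q_norm\<close> subtracts. The result gives both positivity of \<open>Q_norm\<close> away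
  from zero and boundedness of the quotients in its dual.\<close>

lemma abs_le_Q_norm:
  assumes "2 \<le> d" "i \<in> {1..N}"
  shows "\<bar>x i\<bar> \<le> Q_norm N d x"
proof -
  have "0 < d" using assms by simp
  obtain \<rho> where \<rho>: "state (d ^ (N + 1)) \<rho>"
    "\<And>j. j \<in> {1..N} \<Longrightarrow> overlap d N j \<rho> = (if j = i then real d else 1 / real d)"
    using maximally_entangled_state[OF \<open>0 < d\<close> assms(2)] by blast
  have "(\<Sum>j\<in>{1..N}. \<bar>x j\<bar> * overlap d N j \<rho>)
      = (\<Sum>j\<in>{1..N}. \<bar>x j\<bar> / real d + (if j = i then \<bar>x i\<bar> * (real d - 1 / real d) else 0))"
    using \<rho>(2) by (intro sum.cong refl) (auto simp: algebra_simps)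
  also have "\<dots> = l1norm N x / real d + \<bar>x i\<bar> * (real d - 1 / real d)"
    using assms(2) by (simp add: sum.distrib l1norm_def sum_divide_distrib)
  finally have "l1norm N x / real d + \<bar>x i\<bar> * (real d - 1 / real d) \<le> lambda_max (S_mat d N x)"
    using S_mat_variational(1)[OF \<open>0 < d\<close> \<rho>(1), of x] by simp
  then have "real d * (l1norm N x / real d + \<bar>x i\<bar> * (real d - 1 / real d)) \<le> real d * lambda_max (S_mat d N x)"
    by (intro mult_left_mono) auto
  moreover have "real d * (l1norm N x / real d + \<bar>x i\<bar> * (real d - 1 / real d))
      = l1norm N x + \<bar>x i\<bar> * ((real d)\<^sup>2 - 1)"
    using \<open>0 < d\<close> by (simp add: field_simps power2_eq_square)
  moreover have "0 < (real d)\<^sup>2 - 1"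
  proof -
    have "1 < (real d)\<^sup>2" using assms(1) by (intro one_less_power) auto
    then show ?thesis by simp
  qed
  ultimately show ?thesis by (simp add: Q_norm_def field_simps)
qed

text \<open>\<open>Sup\<close> of reals is a least upper bound only for nonempty bounded sets, hence
  the crude bound \<open>N\<close> on the quotients; positivity of \<open>Q_norm\<close> then clears
  the denominators.\<close>

lemma Q_dual_norm_le_one_iff:
  assumes "2 \<le> d" "1 \<le> N" "\<forall>i\<in>{1..N}. 0 \<le> p i \<and> p i \<le> 1"
  shows "Q_dual_norm N d p \<le> 1 \<longleftrightarrow> (\<forall>x. (\<exists>i\<in>{1..N}. x i \<noteq> 0) \<longrightarrow> (\<Sum>i\<in>{1..N}. p i * x i) \<le> Q_norm N d x)"
proof -
  let ?V = "{(\<Sum>i\<in>{1..N}. p i * x i) / Q_norm N d x | x. \<exists>i\<in>{1..N}. x i \<noteq> 0}"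
  have pos: "0 < Q_norm N d x" if ex: "\<exists>i\<in>{1..N}. x i \<noteq> 0" for x
  proof -
    obtain i where "i \<in> {1..N}" "x i \<noteq> 0" using ex by blast
    then show ?thesis using abs_le_Q_norm[OF assms(1), of i N x] by simp
  qed
  have "r \<le> real N" if rV: "r \<in> ?V" for r
  proof -
    obtain x where r: "r = (\<Sum>i\<in>{1..N}. p i * x i) / Q_norm N d x" and x: "\<exists>i\<in>{1..N}. x i \<noteq> 0"
      using rV by blast
    have "(\<Sum>i\<in>{1..N}. p i * x i) \<le> (\<Sum>i\<in>{1..N}. Q_norm N d x)"
    proof (rule sum_mono)
      fix i assume i: "i \<in> {1..N}"
      have "p i * x i \<le> 1 * \<bar>x i\<bar>"
        using assms(3) i by (intro order_trans[OF mult_left_mono[OF abs_ge_self] mult_right_mono]) auto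
      then show "p i * x i \<le> Q_norm N d x" using abs_le_Q_norm[OF assms(1) i, of x] by simp
    qed
    then show ?thesis using pos[OF x] by (simp add: r field_simps)
  qed
  then have "bdd_above ?V" by (rule bdd_aboveI)
  moreover have "?V \<noteq> {}"
    using assms(2) by (auto intro!: exI[of _ "\<lambda>_. 1"])
  ultimately have "Q_dual_norm N d p \<le> 1 \<longleftrightarrow> (\<forall>r\<in>?V. r \<le> 1)"
    unfolding Q_dual_norm_def by (subst cSup_le_iff) auto
  also have "\<dots> \<longleftrightarrow> (\<forall>x. (\<exists>i\<in>{1..N}. x i \<noteq> 0) \<longrightarrow> (\<Sum>i\<in>{1..N}. p i * x i) / Q_norm N d x \<le> 1)"
    by blast
  also have "\<dots> \<longleftrightarrow> (\<forall>x. (\<exists>i\<in>{1..N}. x i \<noteq> 0) \<longrightarrow> (\<Sum>i\<in>{1..N}. p i * x i) \<le> Q_norm N d x)"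
  proof (intro iff_allI imp_cong refl)
    fix x :: "nat \<Rightarrow> real" assume "\<exists>i\<in>{1..N}. x i \<noteq> 0"
    from pos[OF this] show "(\<Sum>i\<in>{1..N}. p i * x i) / Q_norm N d x \<le> 1 \<longleftrightarrow> (\<Sum>i\<in>{1..N}. p i * x i) \<le> Q_norm N d x"
      by (simp add: pos_divide_le_eq)
  qed
  finally show ?thesis .
qed

lemma weighted_overlap_le_lambda_max_iff:
  assumes "2 \<le> d"
  shows "(\<Sum>i\<in>{1..N}. \<bar>x i\<bar> * ((p i * ((real d)\<^sup>2 - 1) + 1) / real d)) \<le> lambda_max (S_mat d N x)
    \<longleftrightarrow> (\<Sum>i\<in>{1..N}. p i * \<bar>x i\<bar>) \<le> Q_norm N d x"
proof -
  have pos: "0 < (real d)\<^sup>2 - 1"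
  proof -
    have "1 < (real d)\<^sup>2" using assms(1) by (intro one_less_power) auto
    then show ?thesis by simp
  qed
  have "(\<Sum>i\<in>{1..N}. \<bar>x i\<bar> * ((p i * ((real d)\<^sup>2 - 1) + 1) / real d))
     = (((real d)\<^sup>2 - 1) * (\<Sum>i\<in>{1..N}. p i * \<bar>x i\<bar>) + l1norm N x) / real d"
    unfolding l1norm_def sum_distrib_left sum.distrib[symmetric] sum_divide_distrib
    by (intro sum.cong refl) (simp add: algebra_simps)
  note eq = this
  show ?thesis unfolding eq Q_norm_def using assms pos
    by (simp add: pos_divide_le_eq pos_le_divide_eq) (simp add: algebra_simps)
qed

theorem mainTheorem1:
  fixes N d :: nat and p :: "nat \<Rightarrow> real"
  assumes "d \<ge> 2" and "N \<ge> 1"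
    and "\<forall>i\<in>{1..N}. 0 \<le> p i \<and> p i \<le> 1"
  shows "p \<in> cloning_region N d \<longleftrightarrow> Q_dual_norm N d p \<le> 1"
proof -
  have "0 < d" using assms(1) by simp
  define q where "q i = (p i * ((real d)\<^sup>2 - 1) + 1) / real d" for i
  note le_iff = weighted_overlap_le_lambda_max_iff[OF assms(1), where p = p, folded q_def]
  show ?thesis
    unfolding Q_dual_norm_le_one_iff[OF assms]
  proof
    assume "p \<in> cloning_region N d"
    then obtain \<rho> where \<rho>: "state (d ^ (N + 1)) \<rho>" "\<And>i. i \<in> {1..N} \<Longrightarrow> overlap d N i \<rho> = q i"
      using cloning_region_imp_state[OF \<open>0 < d\<close>] unfolding q_def by blast
    show "\<forall>x. (\<exists>i\<in>{1..N}. x i \<noteq> 0) \<longrightarrow> (\<Sum>i\<in>{1..N}. p i * x i) \<le> Q_norm N d x"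
    proof (intro allI impI)
      fix x :: "nat \<Rightarrow> real"
      have "(\<Sum>i\<in>{1..N}. \<bar>x i\<bar> * q i) \<le> lambda_max (S_mat d N x)"
        using S_mat_variational(1)[OF \<open>0 < d\<close> \<rho>(1), of x] \<rho>(2) by simp
      then have "(\<Sum>i\<in>{1..N}. p i * \<bar>x i\<bar>) \<le> Q_norm N d x" by (simp only: le_iff)
      \<comment> \<open>Signs in \<open>x\<close> only lower the pairing with the nonnegative
        \<open>p\<close>, whereas \<open>Q_norm\<close> depends on absolute values alone.\<close>
      moreover have "(\<Sum>i\<in>{1..N}. p i * x i) \<le> (\<Sum>i\<in>{1..N}. p i * \<bar>x i\<bar>)"
        using assms(3) by (intro sum_mono mult_left_mono) auto
      ultimately show "(\<Sum>i\<in>{1..N}. p i * x i) \<le> Q_norm N d x" by simp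
    qed
  next
    assume dual: "\<forall>x. (\<exists>i\<in>{1..N}. x i \<noteq> 0) \<longrightarrow> (\<Sum>i\<in>{1..N}. p i * x i) \<le> Q_norm N d x"
    \<comment> \<open>\<open>1 / d\<close> is the overlap that depolarising produces, so
      \<open>0 \<le> p i\<close> enters the separation argument through this bound.\<close>
    have q_ge: "1 / real d \<le> q i" if "i \<in> {1..N}" for i
    proof -
      have "1 \<le> (real d)\<^sup>2" using assms(1) by (intro one_le_power) auto
      then have "0 \<le> p i * ((real d)\<^sup>2 - 1)" using assms(3) that by (intro mult_nonneg_nonneg) auto
      then show ?thesis unfolding q_def by (intro divide_right_mono) auto
    qed
    have sep: "(\<Sum>i\<in>{1..N}. x i * q i) \<le> lambda_max (S_mat d N x)"
      if "\<And>i. i \<in> {1..N} \<Longrightarrow> 0 \<le> x i" "\<exists>i\<in>{1..N}. x i \<noteq> 0" for x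
    proof -
      have "(\<Sum>i\<in>{1..N}. p i * \<bar>x i\<bar>) \<le> Q_norm N d x"
        using dual that by simp
      then have "(\<Sum>i\<in>{1..N}. \<bar>x i\<bar> * q i) \<le> lambda_max (S_mat d N x)" by (simp only: le_iff)
      then show ?thesis using that(1) by simp
    qed
    obtain \<sigma> where \<sigma>: "state (d ^ (N + 1)) \<sigma>" "\<And>i. i \<in> {1..N} \<Longrightarrow> overlap d N i \<sigma> = q i"
      using exists_state_with_overlaps[OF \<open>0 < d\<close> q_ge sep] by blast
    obtain \<rho> where \<rho>: "state (d ^ (N + 1)) \<rho>" "\<And>i. i \<in> {1..N} \<Longrightarrow> overlap d N i \<rho> = q i"
      "\<And>U a b. isometry d U \<Longrightarrow> a < d ^ (N + 1) \<Longrightarrow> b < d ^ (N + 1) \<Longrightarrow> twirl d N U \<rho> (a, b) = \<rho> (a, b)"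
      using exists_twirl_invariant_state[OF \<open>0 < d\<close> \<sigma>] by blast
    show "p \<in> cloning_region N d"
    proof (rule isotropic_state_imp_cloning_region[OF \<open>0 < d\<close> assms(2,3) \<rho>(1)])
      fix i k k' l l' assume i: "i \<in> {1..N}" and "k < d" "k' < d" "l < d" "l' < d"
      then show "pair_coeff d N i \<rho> k k' l l' = (if k = l \<and> k' = l' then of_real (p i / real d) else 0)
         + (if k = k' \<and> l = l' then of_real ((1 - p i) / (real d)\<^sup>2) else 0)"
        using \<rho>(2)[OF i] unfolding q_def
        by (intro invariant_state_pair_coeff[OF assms(1) i \<rho>(1,3)])
    qed
  qed
qed

end
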